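(* For every integer $j\ge 1$, put $n=3j+2$ (so $n\ge5$). Then for every prescribed indefinite metric signature in dimension $n$ there exists a compact pseudo-Riemannian manifold $(M,g)$ of dimension $n$, with $g$ of that signature, such that $(M,g)$ is essentially conformally symmetric and Ricci-recurrent, $M$ is diffeomorphic to a torus bundle over the circle, and $M$ is neither homeomorphic to, nor covered by, the torus $T^n$.
   Context: A pseudo-Riemannian manifold $(M,g)$ of dimension $n\ge4$ is called conformally symmetric if its Weyl conformal tensor $W$ is parallel ($\nabla W=0$ for the Levi-Civita connection $\nabla$). It is called essentially conformally symmetric if it is conformally symmetric but neither conformally flat ($W=0$) nor locally symmetric ($\nabla R=0$, $R$ being the curvature tensor). It is called Ricci-recurrent if, for every tangent vector field $w$, the Ricci tensor $\mathrm{Ric}$ and the covariant derivative $\nabla_w\mathrm{Ric}$ are linearly dependent at every point. A torus bundle over the circle means a $C^\infty$ locally trivial bundle over the circle whose fibre is a torus (of dimension $n-1$). *)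

theory Defs
  imports "HOL-Analysis.Analysis"
begin

section \<open>Smooth maps between open sets\<close>

text \<open>Meant for open \<open>S\<close>. All directional derivatives are taken, so on finite-dimensional
  spaces this is the usual notion of a map of class \<open>C\<^sup>k\<close>.\<close>

primrec Ck_on ::
  "nat \<Rightarrow> 'e::real_normed_vector set \<Rightarrow> ('e \<Rightarrow> 'f::real_normed_vector) \<Rightarrow> bool" where
  "Ck_on 0 S f \<longleftrightarrow> continuous_on S f"
| "Ck_on (Suc k) S f \<longleftrightarrow>
     (\<forall>x\<in>S. f differentiable (at x)) \<and>
     (\<forall>v. Ck_on k S (\<lambda>x. frechet_derivative f (at x) v))"

definition smooth_on ::
  "'e::real_normed_vector set \<Rightarrow> ('e \<Rightarrow> 'f::real_normed_vector) \<Rightarrow> bool" where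
  "smooth_on S f \<longleftrightarrow> (\<forall>k. Ck_on k S f)"


section \<open>Smooth manifolds\<close>

text \<open>A chart \<open>(U, \<phi>)\<close> consists of its domain and its coordinate map; the values of \<open>\<phi>\<close> outside
  \<open>U\<close> are irrelevant. The dimension of a manifold is that of the model space \<open>'e\<close>. The atlas is
  not required to be maximal: it generates the smooth structure.\<close>

type_synonym ('a, 'e) chart = "'a set \<times> ('a \<Rightarrow> 'e)"

record ('a, 'e) manifold =
  mtop :: "'a topology"
  charts :: "('a, 'e) chart set"

definition chart_img :: "('a, 'e) chart \<Rightarrow> 'e set" where
  "chart_img c = snd c ` fst c"

definition chart_inv :: "('a, 'e) chart \<Rightarrow> 'e \<Rightarrow> 'a" where
  "chart_inv c = inv_into (fst c) (snd c)"

definition transition :: "('a, 'e) chart \<Rightarrow> ('a, 'e) chart \<Rightarrow> 'e \<Rightarrow> 'e" where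
  "transition c d = snd d \<circ> chart_inv c"

definition smooth_manifold :: "('a, 'e::euclidean_space) manifold \<Rightarrow> bool" where
  "smooth_manifold M \<longleftrightarrow>
     Hausdorff_space (mtop M) \<and> second_countable (mtop M) \<and>
     (\<Union>c\<in>charts M. fst c) = topspace (mtop M) \<and>
     (\<forall>c\<in>charts M.
        openin (mtop M) (fst c) \<and> open (chart_img c) \<and>
        homeomorphic_map (subtopology (mtop M) (fst c)) (top_of_set (chart_img c)) (snd c)) \<and>
     (\<forall>c\<in>charts M. \<forall>d\<in>charts M. smooth_on (snd c ` (fst c \<inter> fst d)) (transition c d))"

definition smooth_map ::
  "('a, 'e::euclidean_space) manifold \<Rightarrow> ('b, 'f::euclidean_space) manifold \<Rightarrow> ('a \<Rightarrow> 'b) \<Rightarrow> bool"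
  where
  "smooth_map M N f \<longleftrightarrow>
     continuous_map (mtop M) (mtop N) f \<and>
     (\<forall>c\<in>charts M. \<forall>d\<in>charts N.
        smooth_on (snd c ` (fst c \<inter> f -` fst d)) (snd d \<circ> f \<circ> chart_inv c))"

definition diffeomorphism ::
  "('a, 'e::euclidean_space) manifold \<Rightarrow> ('b, 'f::euclidean_space) manifold \<Rightarrow> ('a \<Rightarrow> 'b) \<Rightarrow> bool"
  where
  "diffeomorphism M N f \<longleftrightarrow>
     (\<exists>f'. homeomorphic_maps (mtop M) (mtop N) f f' \<and> smooth_map M N f \<and> smooth_map N M f')"

definition open_submanifold :: "('a, 'e) manifold \<Rightarrow> 'a set \<Rightarrow> ('a, 'e) manifold" where
  "open_submanifold M W =
     \<lparr>mtop = subtopology (mtop M) W, charts = (\<lambda>c. (fst c \<inter> W, snd c)) ` charts M\<rparr>"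

definition prod_manifold ::
  "('a, 'e) manifold \<Rightarrow> ('b, 'f) manifold \<Rightarrow> ('a \<times> 'b, 'e \<times> 'f) manifold" where
  "prod_manifold M N =
     \<lparr>mtop = prod_topology (mtop M) (mtop N),
      charts = {(fst c \<times> fst d, map_prod (snd c) (snd d)) | c d. c \<in> charts M \<and> d \<in> charts N}\<rparr>"


section \<open>Circles, tori and torus bundles\<close>

text \<open>The charts of the unit circle are the local inverses of the angle parametrization
  \<open>t \<mapsto> cis t\<close>.\<close>

definition circle :: "(complex, real) manifold" where
  "circle =
     \<lparr>mtop = top_of_set (sphere 0 1),
      charts = {(cis ` {a<..<a + 2 * pi}, inv_into {a<..<a + 2 * pi} cis) | a. True}\<rparr>"

text \<open>The product of copies of the circle indexed by \<open>'m\<close>, a torus of dimension \<open>CARD('m)\<close>.\<close>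

definition torus :: "('m::finite \<Rightarrow> complex, real ^ 'm) manifold" where
  "torus =
     \<lparr>mtop = product_topology (\<lambda>_. mtop circle) UNIV,
      charts = {(Pi\<^sub>E UNIV (\<lambda>i. fst (c i)), \<lambda>z. \<chi> i. snd (c i) (z i)) | c.
                  \<forall>i. c i \<in> charts circle}\<rparr>"

definition smooth_bundle ::
  "('a, 'e::euclidean_space) manifold \<Rightarrow> ('b, 'f::euclidean_space) manifold \<Rightarrow>
   ('c, 'g::euclidean_space) manifold \<Rightarrow> ('a \<Rightarrow> 'b) \<Rightarrow> bool" where
  "smooth_bundle E B F \<pi> \<longleftrightarrow>
     smooth_map E B \<pi> \<and>
     (\<forall>b\<in>topspace (mtop B). \<exists>U. openin (mtop B) U \<and> b \<in> U \<and>
        (\<exists>h. diffeomorphism (open_submanifold E (topspace (mtop E) \<inter> \<pi> -` U))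
                            (prod_manifold (open_submanifold B U) F) h \<and>
             (\<forall>x \<in> topspace (mtop E) \<inter> \<pi> -` U. fst (h x) = \<pi> x)))"

text \<open>The index type \<open>'m\<close> fixes the dimension \<open>CARD('m)\<close> of the torus fibre.\<close>

definition diffeomorphic_to_torus_bundle ::
  "'m::finite itself \<Rightarrow> ('a, 'e::euclidean_space) manifold \<Rightarrow> bool" where
  "diffeomorphic_to_torus_bundle _ M \<longleftrightarrow>
     (\<exists>(E :: ('a, 'e) manifold) \<pi> h.
        smooth_manifold E \<and>
        smooth_bundle E circle (torus :: ('m \<Rightarrow> complex, real ^ 'm) manifold) \<pi> \<and>
        diffeomorphism M E h)"

text \<open>The counterpart of \<^const>\<open>covering_space\<close> for abstract topologies.\<close>

definition covering_projection :: "'a topology \<Rightarrow> 'b topology \<Rightarrow> ('a \<Rightarrow> 'b) \<Rightarrow> bool" where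
  "covering_projection X Y p \<longleftrightarrow>
     continuous_map X Y p \<and> p ` topspace X = topspace Y \<and>
     (\<forall>y\<in>topspace Y. \<exists>T. y \<in> T \<and> openin Y T \<and>
        (\<exists>\<V>. \<Union>\<V> = topspace X \<inter> p -` T \<and> (\<forall>V\<in>\<V>. openin X V) \<and> pairwise disjnt \<V> \<and>
             (\<forall>V\<in>\<V>. homeomorphic_map (subtopology X V) (subtopology Y T) p)))"


section \<open>Pseudo-Riemannian metrics and vector fields\<close>

text \<open>\<open>p\<close> is the number of positive and \<open>q\<close> the number of negative squares.\<close>

definition has_signature :: "real ^ 'n ^ 'n \<Rightarrow> nat \<Rightarrow> nat \<Rightarrow> bool" where
  "has_signature G p q \<longleftrightarrow>
     (\<exists>P (\<epsilon> :: 'n \<Rightarrow> real). invertible P \<and> (\<forall>i. \<epsilon> i = 1 \<or> \<epsilon> i = -1) \<and>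
        card {i. \<epsilon> i = 1} = p \<and> card {i. \<epsilon> i = -1} = q \<and>
        transpose P ** G ** P = (\<chi> i j. if i = j then \<epsilon> i else 0))"

text \<open>Tensor fields on a manifold are given by their components with respect to the charts of
  the atlas, subject to the transformation law: \<open>g c x\<close> is the matrix of the metric, and \<open>w c x\<close>
  the coordinate vector of the vector field, in the chart \<open>c\<close> at the coordinate point \<open>x\<close>.\<close>

type_synonym ('a, 'n) metric = "('a, real ^ 'n) chart \<Rightarrow> real ^ 'n \<Rightarrow> real ^ 'n ^ 'n"

type_synonym ('a, 'n) vfield = "('a, real ^ 'n) chart \<Rightarrow> real ^ 'n \<Rightarrow> real ^ 'n"

definition pseudo_riemannian_metric ::
  "('a, real ^ 'n) manifold \<Rightarrow> ('a, 'n::finite) metric \<Rightarrow> nat \<Rightarrow> nat \<Rightarrow> bool" where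
  "pseudo_riemannian_metric M g p q \<longleftrightarrow>
     (\<forall>c\<in>charts M. smooth_on (chart_img c) (g c) \<and> (\<forall>x\<in>chart_img c. has_signature (g c x) p q)) \<and>
     (\<forall>c\<in>charts M. \<forall>d\<in>charts M. \<forall>x \<in> snd c ` (fst c \<inter> fst d).
        let J = matrix (frechet_derivative (transition c d) (at x))
        in g c x = transpose J ** g d (transition c d x) ** J)"

definition vector_field ::
  "('a, real ^ 'n) manifold \<Rightarrow> ('a, 'n::finite) vfield \<Rightarrow> bool" where
  "vector_field M w \<longleftrightarrow>
     (\<forall>c\<in>charts M. smooth_on (chart_img c) (w c)) \<and>
     (\<forall>c\<in>charts M. \<forall>d\<in>charts M. \<forall>x \<in> snd c ` (fst c \<inter> fst d).
        w d (transition c d x) = frechet_derivative (transition c d) (at x) (w c x))"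


section \<open>Curvature in local coordinates\<close>

text \<open>In this section \<open>G\<close> is the matrix of the metric in a chart, as a function of the coordinates.\<close>

definition pd :: "'n::finite \<Rightarrow> (real ^ 'n \<Rightarrow> real) \<Rightarrow> real ^ 'n \<Rightarrow> real" where
  "pd k f x = frechet_derivative f (at x) (axis k 1)"

text \<open>\<open>christoffel G k i j\<close> is \<open>\<Gamma>\<^sup>k\<^sub>i\<^sub>j\<close>.\<close>

definition christoffel ::
  "(real ^ 'n \<Rightarrow> real ^ 'n ^ 'n) \<Rightarrow> 'n::finite \<Rightarrow> 'n \<Rightarrow> 'n \<Rightarrow> real ^ 'n \<Rightarrow> real" where
  "christoffel G k i j x =
     (\<Sum>l\<in>UNIV. matrix_inv (G x) $ k $ l *
        (pd i (\<lambda>y. G y $ j $ l) x + pd j (\<lambda>y. G y $ i $ l) x - pd l (\<lambda>y. G y $ i $ j) x)) / 2"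

text \<open>\<open>curv_up G i j k l\<close> is the \<open>l\<close>-th component of
  \<open>R(\<partial>\<^sub>i, \<partial>\<^sub>j)\<partial>\<^sub>k = \<nabla>\<^sub>i\<nabla>\<^sub>j\<partial>\<^sub>k - \<nabla>\<^sub>j\<nabla>\<^sub>i\<partial>\<^sub>k\<close>, and \<open>curv\<close> is obtained by lowering the last index.
  The Ricci tensor is then positive on round spheres.\<close>

definition curv_up ::
  "(real ^ 'n \<Rightarrow> real ^ 'n ^ 'n) \<Rightarrow> 'n::finite \<Rightarrow> 'n \<Rightarrow> 'n \<Rightarrow> 'n \<Rightarrow> real ^ 'n \<Rightarrow> real" where
  "curv_up G i j k l x =
     pd i (christoffel G l j k) x - pd j (christoffel G l i k) x +
     (\<Sum>m\<in>UNIV. christoffel G l i m x * christoffel G m j k x -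
                christoffel G l j m x * christoffel G m i k x)"

definition curv ::
  "(real ^ 'n \<Rightarrow> real ^ 'n ^ 'n) \<Rightarrow> 'n::finite \<Rightarrow> 'n \<Rightarrow> 'n \<Rightarrow> 'n \<Rightarrow> real ^ 'n \<Rightarrow> real" where
  "curv G i j k l x = (\<Sum>m\<in>UNIV. G x $ l $ m * curv_up G i j k m x)"

definition ricci ::
  "(real ^ 'n \<Rightarrow> real ^ 'n ^ 'n) \<Rightarrow> 'n::finite \<Rightarrow> 'n \<Rightarrow> real ^ 'n \<Rightarrow> real" where
  "ricci G j k x = (\<Sum>i\<in>UNIV. curv_up G i j k i x)"

definition scalar_curv :: "(real ^ 'n \<Rightarrow> real ^ 'n ^ 'n) \<Rightarrow> real ^ 'n::finite \<Rightarrow> real" where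
  "scalar_curv G x = (\<Sum>j\<in>UNIV. \<Sum>k\<in>UNIV. matrix_inv (G x) $ j $ k * ricci G j k x)"

definition weyl ::
  "(real ^ 'n \<Rightarrow> real ^ 'n ^ 'n) \<Rightarrow> 'n::finite \<Rightarrow> 'n \<Rightarrow> 'n \<Rightarrow> 'n \<Rightarrow> real ^ 'n \<Rightarrow> real" where
  "weyl G i j k l x =
     (let n = real CARD('n) in
      curv G i j k l x
      - (G x $ i $ l * ricci G j k x - G x $ i $ k * ricci G j l x +
         G x $ j $ k * ricci G i l x - G x $ j $ l * ricci G i k x) / (n - 2)
      + scalar_curv G x * (G x $ i $ l * G x $ j $ k - G x $ i $ k * G x $ j $ l)
        / ((n - 1) * (n - 2)))"

text \<open>Levi-Civita covariant derivatives of covariant tensors of rank two and four; the first index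
  is the direction of differentiation.\<close>

definition cov_deriv2 ::
  "(real ^ 'n \<Rightarrow> real ^ 'n ^ 'n) \<Rightarrow> ('n::finite \<Rightarrow> 'n \<Rightarrow> real ^ 'n \<Rightarrow> real) \<Rightarrow>
   'n \<Rightarrow> 'n \<Rightarrow> 'n \<Rightarrow> real ^ 'n \<Rightarrow> real" where
  "cov_deriv2 G T m i j x =
     pd m (T i j) x -
     (\<Sum>s\<in>UNIV. christoffel G s m i x * T s j x + christoffel G s m j x * T i s x)"

definition cov_deriv4 ::
  "(real ^ 'n \<Rightarrow> real ^ 'n ^ 'n) \<Rightarrow> ('n::finite \<Rightarrow> 'n \<Rightarrow> 'n \<Rightarrow> 'n \<Rightarrow> real ^ 'n \<Rightarrow> real) \<Rightarrow>
   'n \<Rightarrow> 'n \<Rightarrow> 'n \<Rightarrow> 'n \<Rightarrow> 'n \<Rightarrow> real ^ 'n \<Rightarrow> real" where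
  "cov_deriv4 G T m i j k l x =
     pd m (T i j k l) x -
     (\<Sum>s\<in>UNIV. christoffel G s m i x * T s j k l x + christoffel G s m j x * T i s k l x +
                christoffel G s m k x * T i j s l x + christoffel G s m l x * T i j k s x)"


section \<open>Conformal symmetry and Ricci recurrence\<close>

definition conformally_flat ::
  "('a, real ^ 'n) manifold \<Rightarrow> ('a, 'n::finite) metric \<Rightarrow> bool" where
  "conformally_flat M g \<longleftrightarrow>
     (\<forall>c\<in>charts M. \<forall>x\<in>chart_img c. \<forall>i j k l. weyl (g c) i j k l x = 0)"

definition locally_symmetric ::
  "('a, real ^ 'n) manifold \<Rightarrow> ('a, 'n::finite) metric \<Rightarrow> bool" where
  "locally_symmetric M g \<longleftrightarrow>
     (\<forall>c\<in>charts M. \<forall>x\<in>chart_img c. \<forall>m i j k l. cov_deriv4 (g c) (curv (g c)) m i j k l x = 0)"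

definition conformally_symmetric ::
  "('a, real ^ 'n) manifold \<Rightarrow> ('a, 'n::finite) metric \<Rightarrow> bool" where
  "conformally_symmetric M g \<longleftrightarrow>
     4 \<le> CARD('n) \<and>
     (\<forall>c\<in>charts M. \<forall>x\<in>chart_img c. \<forall>m i j k l. cov_deriv4 (g c) (weyl (g c)) m i j k l x = 0)"

definition essentially_conformally_symmetric ::
  "('a, real ^ 'n) manifold \<Rightarrow> ('a, 'n::finite) metric \<Rightarrow> bool" where
  "essentially_conformally_symmetric M g \<longleftrightarrow>
     conformally_symmetric M g \<and> \<not> conformally_flat M g \<and> \<not> locally_symmetric M g"

definition ricci_recurrent ::
  "('a, real ^ 'n) manifold \<Rightarrow> ('a, 'n::finite) metric \<Rightarrow> bool" where
  "ricci_recurrent M g \<longleftrightarrow>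
     (\<forall>w. vector_field M w \<longrightarrow>
       (\<forall>c\<in>charts M. \<forall>x\<in>chart_img c. \<exists>a b. (a \<noteq> 0 \<or> b \<noteq> 0) \<and>
          (\<forall>i j. a * ricci (g c) i j x +
                 b * (\<Sum>m\<in>UNIV. w c x $ m * cov_deriv2 (g c) (ricci (g c)) m i j x) = 0)))"

end

theory Submission
  imports Defs
begin

text \<open>
  The examples are quotients of plane waves in Rosen coordinates. On \<open>\<real>\<^sup>n\<close> with coordinates
  \<open>t, r\<close> and \<open>w\<^sub>i\<close>, where \<open>i\<close> runs over \<open>n - 2 = 3j\<close> indices, consider
  \<open>g = P(t) (2 dt dr + \<Sum>\<^sub>i \<epsilon>\<^sub>i \<psi>\<^sub>i(t)\<^sup>2 dw\<^sub>i\<^sup>2)\<close> with signs \<open>\<epsilon>\<^sub>i\<close>, which may be prescribed at will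
  and so realise every indefinite signature. Up to symmetries the only
  curvature components are \<open>R(\<partial>\<^sub>t, \<partial>\<^sub>i)\<partial>\<^sub>t = E\<^sub>i(t) \<partial>\<^sub>i\<close>. Hence the Ricci tensor is a function of \<open>t\<close>
  times \<open>dt \<otimes> dt\<close>, and so are its covariant derivatives, which gives Ricci recurrence; the Weyl
  tensor is built in the same way from \<open>E\<^sub>i\<close> minus the mean of all \<open>E\<^sub>k\<close>. The Weyl tensor is
  parallel if and only if these differences are constant multiples of \<open>P\<^sup>2\<close>, and the metric is
  locally symmetric if and only if the \<open>E\<^sub>i\<close> themselves are.

  The point of the construction is that \<open>E\<^sub>i - E\<^sub>k = \<psi>\<^sub>i''/\<psi>\<^sub>i - \<psi>\<^sub>k''/\<psi>\<^sub>k\<close> whatever \<open>P\<close> is. Divide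
  the indices into \<open>j\<close> triples and let the functions of each triple be \<open>exp (\<mu> t)\<close>, \<open>exp (- \<mu> t)\<close>
  and \<open>\<psi>(t)\<close>, where \<open>\<psi>(t) = c + cos (2 \<pi> t)\<close> with \<open>c\<close> large. Then \<open>\<sigma> = \<mu>\<^sup>2 - \<psi>''/\<psi>\<close> is positive, and
  \<open>P = \<surd>\<sigma>\<close> makes the differences equal to \<open>P\<^sup>2/3\<close>, \<open>P\<^sup>2/3\<close> and \<open>- 2 P\<^sup>2/3\<close>. For
  the third kind of index \<open>E/P\<^sup>2\<close> is negative at \<open>t = 0\<close> and positive at \<open>t = 1/2\<close>, so the metric is
  not locally symmetric (lemmas \<open>weyl_parallel\<close>, \<open>weyl_nonzero\<close>, \<open>curv_not_parallel\<close>).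

  The map \<open>t \<mapsto> t + 1\<close>, combined with the multiplication of the three coordinates \<open>w\<close> of each triple
  by \<open>exp (- \<mu>)\<close>, \<open>exp \<mu>\<close> and \<open>1\<close>, is an isometry, as are the translations in \<open>r\<close> and \<open>w\<close>. If
  \<open>exp \<mu>\<close> is the square of the golden ratio, these multiplications preserve the lattice of the ring
  \<open>\<int>[(1 + \<surd>5)/2]\<close>, embedded in the plane of the first two coordinates of the triple by its two real
  embeddings. The quotient by the lattice translations and this map is the mapping torus of an
  automorphism of a torus: a compact manifold, fibred over the circle by \<open>t\<close> with toral fibre
  (lemmas \<open>smooth_manifold_M\<close>, \<open>compact_qtop\<close>, \<open>smooth_bundle_M\<close>). In the natural charts all
  maps between these manifolds are locally affine, so their smoothness is immediate.

  Finally let \<open>p\<close> be a continuous open map from a torus to the quotient, for instance a covering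
  projection or a homeomorphism. Composed with the universal covering of the torus it lifts to a
  map \<open>F\<close> into \<open>\<real>\<^sup>n\<close> with open image, and a period of the torus changes \<open>F\<close> by a deck transformation.
  These deck transformations commute. If none of them moves \<open>t\<close>, then \<open>t \<circ> F\<close> is periodic. If one
  does, then all of them preserve \<open>(w\<^sub>a - b) exp (\<mu> t)\<close> for a suitable constant \<open>b\<close>,
  where \<open>a\<close> is an index of the first kind; for indices of the second kind the sign of \<open>\<mu>\<close> changes.
  In both cases a function without local maxima, composed with \<open>F\<close>, attains its maximum, which
  contradicts the openness of the image (lemma \<open>no_open_map_from_torus\<close>).
\<close>

section \<open>Smoothness of locally affine maps\<close>

definition locally_affine_at ::
  "('e::real_normed_vector \<Rightarrow> 'f::real_normed_vector) \<Rightarrow> 'e \<Rightarrow> bool" where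
  "locally_affine_at f x \<longleftrightarrow>
     (\<exists>A b. bounded_linear A \<and> (\<forall>\<^sub>F y in nhds x. f y = A y + b))"

lemma locally_affine_atI:
  assumes "bounded_linear A" "\<forall>\<^sub>F y in nhds x. f y = A y + b"
  shows "locally_affine_at f x"
  using assms by (auto simp: locally_affine_at_def)

lemma locally_affine_at_linear: "bounded_linear f \<Longrightarrow> locally_affine_at f x"
  by (rule locally_affine_atI[where A = f and b = 0]) auto

lemma locally_affine_at_cong:
  assumes "locally_affine_at f x" "\<forall>\<^sub>F y in nhds x. g y = f y"
  shows "locally_affine_at g x"
proof -
  obtain A b where "bounded_linear A" "\<forall>\<^sub>F y in nhds x. f y = A y + b"
    using assms(1) by (auto simp: locally_affine_at_def)
  then show ?thesis
    by (intro locally_affine_atI[of A]) (auto intro: eventually_elim2[OF _ assms(2)])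
qed

lemma locally_affine_at_isCont:
  assumes "locally_affine_at f x"
  shows "isCont f x"
proof -
  obtain A b where A: "bounded_linear A" "\<forall>\<^sub>F y in nhds x. f y = A y + b"
    using assms by (auto simp: locally_affine_at_def)
  have "isCont (\<lambda>y. A y + b) x"
    using A(1) by (intro continuous_intros linear_continuous_at)
  then show ?thesis using isCont_cong[OF A(2)] by simp
qed

lemma locally_affine_at_tendsto:
  assumes "locally_affine_at f x"
  shows "(f \<longlongrightarrow> f x) (nhds x)"
  using locally_affine_at_isCont[OF assms] by (simp add: isCont_def tendsto_at_iff_tendsto_nhds)

lemma locally_affine_at_compose:
  assumes f: "locally_affine_at f x" and g: "locally_affine_at g (f x)"
  shows "locally_affine_at (\<lambda>y. g (f y)) x"
proof -
  obtain A b where A: "bounded_linear A" "\<forall>\<^sub>F y in nhds x. f y = A y + b"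
    using f by (auto simp: locally_affine_at_def)
  obtain B c where B: "bounded_linear B" "\<forall>\<^sub>F z in nhds (f x). g z = B z + c"
    using g by (auto simp: locally_affine_at_def)
  have "filterlim f (nhds (f x)) (nhds x)"
    using locally_affine_at_isCont[OF f] by (simp add: continuous_at isCont_def tendsto_at_iff_tendsto_nhds)
  then have "\<forall>\<^sub>F y in nhds x. g (f y) = B (f y) + c"
    using B(2) by (auto dest: filterlim_compose simp: filterlim_iff)
  with A(2) have "\<forall>\<^sub>F y in nhds x. g (f y) = B (A y) + (B b + c)"
    by eventually_elim (simp add: linear_add[OF bounded_linear.linear[OF B(1)]])
  then show ?thesis
    using bounded_linear_compose[OF B(1) A(1)] by (intro locally_affine_atI)
qed

lemma locally_affine_at_Pair:
  assumes "locally_affine_at f x" "locally_affine_at g x"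
  shows "locally_affine_at (\<lambda>y. (f y, g y)) x"
proof -
  obtain A b where A: "bounded_linear A" "\<forall>\<^sub>F y in nhds x. f y = A y + b"
    using assms(1) by (auto simp: locally_affine_at_def)
  obtain B c where B: "bounded_linear B" "\<forall>\<^sub>F z in nhds x. g z = B z + c"
    using assms(2) by (auto simp: locally_affine_at_def)
  have "\<forall>\<^sub>F y in nhds x. (f y, g y) = (A y, B y) + (b, c)"
    using A(2) B(2) by eventually_elim simp
  then show ?thesis
    using bounded_linear_Pair[OF A(1) B(1)] by (intro locally_affine_atI)
qed

lemma locally_affine_at_vec_lambda:
  fixes f :: "'e::real_normed_vector \<Rightarrow> 'n::finite \<Rightarrow> real"
  assumes "\<And>i. locally_affine_at (\<lambda>y. f y i) x"
  shows "locally_affine_at (\<lambda>y. \<chi> i. f y i) x"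
proof -
  have "\<forall>i. \<exists>A b. bounded_linear A \<and> (\<forall>\<^sub>F y in nhds x. f y i = A y + b)"
    using assms by (auto simp: locally_affine_at_def)
  then obtain A b where A: "\<And>i. bounded_linear (A i)" "\<And>i. \<forall>\<^sub>F y in nhds x. f y i = A i y + b i"
    by metis
  have "\<forall>\<^sub>F y in nhds x. \<forall>i. f y i = A i y + b i"
    using A(2) by (rule eventually_all_finite)
  then have "\<forall>\<^sub>F y in nhds x. (\<chi> i. f y i) = (\<chi> i. A i y) + (\<chi> i. b i)"
    by eventually_elim (simp add: vec_eq_iff)
  moreover have "bounded_linear (\<lambda>y. \<chi> i. A i y)"
  proof (subst bounded_linear_componentwise_iff, intro ballI)
    fix b :: "real ^ 'n" assume "b \<in> Basis"
    then obtain i where "b = axis i 1" by (auto simp: Basis_vec_def)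
    then show "bounded_linear (\<lambda>y. (\<chi> i. A i y) \<bullet> b)"
      using A(1) by (simp add: inner_axis)
  qed
  ultimately show ?thesis by (intro locally_affine_atI)
qed

lemma locally_affine_at_derivative:
  assumes "bounded_linear A" "\<forall>\<^sub>F y in nhds x. f y = A y + b"
  shows "(f has_derivative A) (at x)"
proof -
  have "((\<lambda>y. A y + b) has_derivative A) (at x)"
    using bounded_linear_imp_has_derivative[OF assms(1)] by (auto intro!: derivative_eq_intros)
  then show ?thesis
    using has_derivative_transform_eventually[of "\<lambda>y. A y + b" A x UNIV f]
      eventually_nhds_x_imp_x[OF assms(2)] eventually_mono[OF assms(2)]
    by (auto simp: eventually_at_filter)
qed

text \<open>The derivative of a locally affine map in a fixed direction is locally constant, hence again
  locally affine; this is what makes the induction on the order of differentiability work.\<close>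

lemma locally_affine_Ck_on:
  assumes "\<And>x. x \<in> S \<Longrightarrow> locally_affine_at f x"
  shows "Ck_on k S f"
  using assms
proof (induction k arbitrary: f)
  case 0
  then show ?case
    using locally_affine_at_isCont by (auto intro!: continuous_at_imp_continuous_on)
next
  case (Suc k)
  have "f differentiable (at x)" if "x \<in> S" for x
    using Suc.prems[OF that] locally_affine_at_derivative
    unfolding locally_affine_at_def differentiable_def by blast
  moreover have "locally_affine_at (\<lambda>x. frechet_derivative f (at x) v) x" if "x \<in> S" for x v
  proof -
    obtain A b where A: "bounded_linear A" "\<forall>\<^sub>F y in nhds x. f y = A y + b"
      using Suc.prems[OF \<open>x \<in> S\<close>] by (auto simp: locally_affine_at_def)
    from A(2) have "\<forall>\<^sub>F y in nhds x. \<forall>\<^sub>F z in nhds y. f z = A z + b"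
      by (simp add: eventually_eventually)
    then have "\<forall>\<^sub>F y in nhds x. frechet_derivative f (at y) v = 0 + A v"
      by eventually_elim
         (simp add: frechet_derivative_at[OF locally_affine_at_derivative[OF A(1)], symmetric])
    then show ?thesis
      by (intro locally_affine_atI[of "\<lambda>_. 0"]) auto
  qed
  ultimately show ?case using Suc.IH by auto
qed

corollary locally_affine_smooth_on:
  "(\<And>x. x \<in> S \<Longrightarrow> locally_affine_at f x) \<Longrightarrow> smooth_on S f"
  by (simp add: smooth_on_def locally_affine_Ck_on)

text \<open>A directional derivative of such a matrix has entries of the same kind, so all orders of
  differentiability follow by induction from the closure of the family under derivatives and
  multiples, and no higher derivative has to be computed.\<close>

lemma smooth_on_coordinate_matrix:
  fixes G :: "real ^ 'n::finite \<Rightarrow> real ^ 'n ^ 'n" and \<A> :: "(real \<Rightarrow> real) set"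
  assumes deriv: "\<And>f. f \<in> \<A> \<Longrightarrow> \<exists>f'\<in>\<A>. \<forall>s. (f has_real_derivative f' s) (at s)"
    and scale: "\<And>f a. f \<in> \<A> \<Longrightarrow> (\<lambda>s. a * f s) \<in> \<A>"
    and G: "\<And>i j. \<exists>f\<in>\<A>. \<forall>x. G x $ i $ j = f (x $ t)"
  shows "smooth_on S G"
proof -
  have "Ck_on k S G" if "\<And>i j. \<exists>f\<in>\<A>. \<forall>x. G x $ i $ j = f (x $ t)"
    for k and G :: "real ^ 'n \<Rightarrow> real ^ 'n ^ 'n"
    using that
  proof (induction k arbitrary: G)
    case (0 G)
    obtain f where f: "\<And>i j. f i j \<in> \<A>" "\<And>i j x. G x $ i $ j = f i j (x $ t)"
      using 0 by metis
    have "continuous_on S (\<lambda>x. \<chi> i j. f i j (x $ t))"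
    proof (intro continuous_on_vec_lambda)
      fix i j
      have "isCont (f i j) s" for s
        using deriv[OF f(1)] DERIV_isCont by blast
      then have "continuous_on UNIV (f i j)"
        by (simp add: continuous_at_imp_continuous_on)
      then show "continuous_on S (\<lambda>x. f i j (x $ t))"
        by (rule continuous_on_compose2) (auto intro: continuous_intros)
    qed
    moreover have "G = (\<lambda>x. \<chi> i j. f i j (x $ t))"
      by (auto simp: vec_eq_iff f(2))
    ultimately show ?case by simp
  next
    case (Suc k G)
    obtain f where f: "\<And>i j. f i j \<in> \<A>" "\<And>i j x. G x $ i $ j = f i j (x $ t)"
      using Suc.prems by metis
    obtain f' where f': "\<And>i j. f' i j \<in> \<A>"
        "\<And>i j s. (f i j has_real_derivative f' i j s) (at s)"
      using deriv[OF f(1)] by metis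
    have D: "(G has_derivative (\<lambda>v. \<chi> i j. f' i j (x $ t) * v $ t)) (at x)" for x
    proof -
      have "((\<lambda>y. y $ t) has_derivative (\<lambda>y. y $ t)) (at x)"
        by (rule bounded_linear_imp_has_derivative) (rule bounded_linear_vec_nth)
      then have "((\<lambda>y. f i j (y $ t)) has_derivative (\<lambda>v. f' i j (x $ t) * v $ t)) (at x)" for i j
        using has_derivative_compose[of "\<lambda>y. y $ t" "\<lambda>y. y $ t" x UNIV "f i j" "\<lambda>h. f' i j (x $ t) * h"]
          f'(2) by (simp add: has_field_derivative_def)
      then have "((\<lambda>y. \<chi> i j. f i j (y $ t)) has_derivative (\<lambda>v. \<chi> i j. f' i j (x $ t) * v $ t)) (at x)"
        by (subst has_derivative_componentwise_within) (auto simp: Basis_vec_def inner_axis)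
      moreover have "G = (\<lambda>x. \<chi> i j. f i j (x $ t))"
        by (auto simp: vec_eq_iff f(2))
      ultimately show ?thesis by simp
    qed
    have "Ck_on k S (\<lambda>x. frechet_derivative G (at x) v)" for v
    proof (rule Suc.IH)
      fix i j
      have "(\<lambda>s. v $ t * f' i j s) \<in> \<A>" using scale f'(1) by blast
      then show "\<exists>f\<in>\<A>. \<forall>x. frechet_derivative G (at x) v $ i $ j = f (x $ t)"
        unfolding frechet_derivative_at[OF D, symmetric]
        by (intro bexI[of _ "\<lambda>s. v $ t * f' i j s"]) (simp_all add: mult.commute)
    qed
    then show ?case using D by (auto simp: differentiable_def)
  qed
  then show ?thesis using G by (simp add: smooth_on_def)
qed

section \<open>Curvature of plane waves in Rosen coordinates\<close>

lemma pd_of_coordinate: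
  fixes x :: "real ^ 'n::finite"
  assumes "(f has_real_derivative D) (at (x $ t))"
  shows "pd m (\<lambda>y. f (y $ t)) x = (if m = t then D else 0)"
proof -
  have "((\<lambda>y. y $ t) has_derivative (\<lambda>y. y $ t)) (at x)"
    by (rule bounded_linear_imp_has_derivative) (rule bounded_linear_vec_nth)
  then have "((\<lambda>y. f (y $ t)) has_derivative (\<lambda>y. y $ t * D)) (at x)"
    using has_derivative_compose[of "\<lambda>y. y $ t" "\<lambda>y. y $ t" x UNIV f "\<lambda>h. D * h"] assms
    by (simp add: has_field_derivative_def mult.commute[of _ D])
  then show ?thesis
    unfolding pd_def by (simp add: frechet_derivative_at[symmetric] axis_def)
qed

lemma matrix_inv_eqI:
  fixes A B :: "real ^ 'n ^ 'n"
  assumes "A ** B = mat 1" "B ** A = mat 1"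
  shows "matrix_inv A = B"
proof -
  have "A ** matrix_inv A = mat 1 \<and> matrix_inv A ** A = mat 1"
    unfolding matrix_inv_def by (rule someI[of _ B]) (use assms in simp)
  then have "B ** A ** matrix_inv A = B"
    by (metis matrix_mul_assoc matrix_mul_rid)
  then show ?thesis by (simp add: assms)
qed

text \<open>The metric is \<open>2 \<gamma>\<^sub>t dt dr + \<Sum> \<gamma>\<^sub>i dw\<^sub>i\<^sup>2\<close> with all coefficients depending on \<open>t\<close> only, and \<open>\<beta>\<^sub>i\<close> is
  half the logarithmic derivative of \<open>\<gamma>\<^sub>i\<close>. The coefficient of \<open>dt dr\<close> is left arbitrary, which
  amounts to a free choice of the parameter \<open>t\<close>.\<close>

locale rosen_metric =
  fixes t r :: "'n::finite"
    and \<gamma> \<beta> \<beta>' :: "'n \<Rightarrow> real \<Rightarrow> real"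
  assumes tr: "t \<noteq> r"
    and \<gamma>_r: "\<gamma> r = \<gamma> t"
    and \<gamma>_nz: "\<gamma> i s \<noteq> 0"
    and \<gamma>_deriv: "(\<gamma> i has_real_derivative 2 * \<beta> i s * \<gamma> i s) (at s)"
    and \<beta>_deriv: "(\<beta> i has_real_derivative \<beta>' i s) (at s)"
begin

text \<open>Every row of the metric has a single nonzero entry, in the column \<open>cp i\<close>; therefore the inverse
  matrix and all contractions with the metric reduce to one term.\<close>

definition cp :: "'n \<Rightarrow> 'n" where
  "cp i = (if i = t then r else if i = r then t else i)"

definition G :: "real ^ 'n \<Rightarrow> real ^ 'n ^ 'n" where
  "G x = (\<chi> i j. if j = cp i then \<gamma> i (x $ t) else 0)"

definition \<Gamma> :: "'n \<Rightarrow> 'n \<Rightarrow> 'n \<Rightarrow> real \<Rightarrow> real" where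
  "\<Gamma> k i j s =
     (if k = t \<and> i = t \<and> j = t then 2 * \<beta> t s else 0) +
     (if k \<noteq> t \<and> k \<noteq> r \<and> i = t \<and> j = k then \<beta> k s else 0) +
     (if k \<noteq> t \<and> k \<noteq> r \<and> j = t \<and> i = k then \<beta> k s else 0) -
     (if k = r \<and> i \<noteq> t \<and> i \<noteq> r \<and> j = i then \<beta> i s * \<gamma> i s / \<gamma> t s else 0)"

text \<open>The tidal coefficient: \<open>R(\<partial>\<^sub>t, \<partial>\<^sub>i)\<partial>\<^sub>t\<close> equals \<open>tidal i\<close> times \<open>\<partial>\<^sub>i\<close>. When \<open>t\<close> is affine and
  \<open>\<gamma>\<^sub>i = \<epsilon> \<phi>\<^sup>2\<close>, it is \<open>\<phi>''/\<phi>\<close>.\<close>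

definition tidal :: "'n \<Rightarrow> real \<Rightarrow> real" where
  "tidal i s = \<beta>' i s + (\<beta> i s)\<^sup>2 - 2 * \<beta> t s * \<beta> i s"

lemma cp_cp [simp]: "cp (cp i) = i"
  using tr by (auto simp: cp_def)

lemma cp_simps [simp]: "cp t = r" "cp r = t" "i \<noteq> t \<Longrightarrow> i \<noteq> r \<Longrightarrow> cp i = i"
  using tr by (auto simp: cp_def)

lemma cp_eq_iff [simp]:
  "cp i = cp j \<longleftrightarrow> i = j" "cp i = t \<longleftrightarrow> i = r" "cp i = r \<longleftrightarrow> i = t"
  "t = cp i \<longleftrightarrow> i = r" "r = cp i \<longleftrightarrow> i = t"
  using tr by (auto simp: cp_def)

lemma \<gamma>_cp [simp]: "\<gamma> (cp i) = \<gamma> i"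
  using \<gamma>_r by (auto simp: cp_def)

lemma \<beta>_r: "\<beta> r = \<beta> t"
proof
  fix s
  have "2 * \<beta> r s * \<gamma> t s = 2 * \<beta> t s * \<gamma> t s"
    using DERIV_unique[OF \<gamma>_deriv[of r s, unfolded \<gamma>_r] \<gamma>_deriv[of t s]] .
  then show "\<beta> r s = \<beta> t s" using \<gamma>_nz[of t s] by simp
qed

lemma matrix_inv_G: "matrix_inv (G x) = (\<chi> i j. if j = cp i then 1 / \<gamma> i (x $ t) else 0)"
proof -
  have *: "(\<Sum>k\<in>UNIV. (if k = cp i then a else 0) * (if j = cp k then b k else 0)) =
      (if i = j then a * b (cp i) else 0)" for i j and a :: real and b :: "'n \<Rightarrow> real"
    by (subst sum.cong[OF refl, where h = "\<lambda>k. if k = cp i then (if i = j then a * b (cp i) else 0) else 0"])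
       (auto simp: sum.delta)
  have 1: "G x ** (\<chi> i j. if j = cp i then 1 / \<gamma> i (x $ t) else 0) = mat 1"
    using \<gamma>_nz by (auto simp: vec_eq_iff matrix_matrix_mult_def G_def mat_def *)
  have 2: "(\<chi> i j. if j = cp i then 1 / \<gamma> i (x $ t) else 0) ** G x = mat 1"
    using \<gamma>_nz by (auto simp: vec_eq_iff matrix_matrix_mult_def G_def mat_def *)
  show ?thesis by (rule matrix_inv_eqI[OF 1 2])
qed

lemma sum_cp: "(\<Sum>l\<in>UNIV. (if l = cp k then a else 0) * f l) = a * f (cp k)" for a :: real
  by (subst sum.cong[OF refl, where h = "\<lambda>l. if l = cp k then a * f (cp k) else 0"])
     (auto simp: sum.delta)

lemma pd_G: "pd m (\<lambda>y. G y $ i $ j) x =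
    (if m = t \<and> j = cp i then 2 * \<beta> i (x $ t) * \<gamma> i (x $ t) else 0)"
proof (cases "j = cp i")
  case True
  then show ?thesis
    using pd_of_coordinate[where t = t and m = m and x = x, OF \<gamma>_deriv[of i]] by (simp add: G_def)
next
  case False
  then show ?thesis
    using pd_of_coordinate[where f = "\<lambda>_. 0" and D = 0 and t = t and x = x and m = m] by (simp add: G_def)
qed

lemma christoffel_G: "christoffel G k i j = (\<lambda>x. \<Gamma> k i j (x $ t))"
proof
  fix x
  let ?g = "\<lambda>i. \<gamma> i (x $ t)" and ?b = "\<lambda>i. \<beta> i (x $ t)"
  have "christoffel G k i j x = (1 / ?g k * (
     (if i = t \<and> cp k = cp j then 2 * ?b j * ?g j else 0) +
     (if j = t \<and> cp k = cp i then 2 * ?b i * ?g i else 0) -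
     (if cp k = t \<and> j = cp i then 2 * ?b i * ?g i else 0))) / 2"
    unfolding christoffel_def matrix_inv_G pd_G by (simp add: sum_cp)
  also have "\<dots> = \<Gamma> k i j (x $ t)"
  proof -
    consider "k = t" | "k = r" | "k \<noteq> t" "k \<noteq> r" by blast
    then show ?thesis
    proof cases
      case 1
      then show ?thesis using tr \<gamma>_nz by (auto simp: \<Gamma>_def)
    next
      case 2
      then show ?thesis using tr \<gamma>_nz \<gamma>_r \<beta>_r
        by (auto simp: \<Gamma>_def)
    next
      case 3
      then show ?thesis using tr \<gamma>_nz by (auto simp: \<Gamma>_def)
    qed
  qed
  finally show "christoffel G k i j x = \<Gamma> k i j (x $ t)" .
qed

text \<open>The Christoffel symbols are sums of terms supported on one value of each index, so a sum over one
  index leaves four terms. This form and the next one are used for all contractions below.\<close>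

lemma sum_\<Gamma>_lower:
  "(\<Sum>m\<in>UNIV. \<Gamma> l i m s * A m) =
     (if l = t \<and> i = t then 2 * \<beta> t s * A t else 0) +
     (if l \<noteq> t \<and> l \<noteq> r \<and> i = t then \<beta> l s * A l else 0) +
     (if l \<noteq> t \<and> l \<noteq> r \<and> i = l then \<beta> l s * A t else 0) -
     (if l = r \<and> i \<noteq> t \<and> i \<noteq> r then \<beta> i s * \<gamma> i s / \<gamma> t s * A i else 0)"
proof -
  have "(\<Sum>m\<in>UNIV. \<Gamma> l i m s * A m) =
    (\<Sum>m\<in>UNIV. (if m = t then (if l = t \<and> i = t then 2 * \<beta> t s * A t else 0) else 0)
     + (if m = l then (if l \<noteq> t \<and> l \<noteq> r \<and> i = t then \<beta> l s * A l else 0) else 0)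
     + (if m = t then (if l \<noteq> t \<and> l \<noteq> r \<and> i = l then \<beta> l s * A t else 0) else 0)
     - (if m = i then (if l = r \<and> i \<noteq> t \<and> i \<noteq> r then \<beta> i s * \<gamma> i s / \<gamma> t s * A i else 0) else 0))"
    by (rule sum.cong) (auto simp: \<Gamma>_def algebra_simps)
  then show ?thesis by (simp add: sum.distrib sum_subtractf sum.delta)
qed

lemma sum_\<Gamma>_upper:
  "(\<Sum>k\<in>UNIV. \<Gamma> k i j s * A k) =
     (if i = t \<and> j = t then 2 * \<beta> t s * A t else 0) +
     (if j \<noteq> t \<and> j \<noteq> r \<and> i = t then \<beta> j s * A j else 0) +
     (if i \<noteq> t \<and> i \<noteq> r \<and> j = t then \<beta> i s * A i else 0) -
     (if i \<noteq> t \<and> i \<noteq> r \<and> j = i then \<beta> i s * \<gamma> i s / \<gamma> t s * A r else 0)"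
proof -
  have "(\<Sum>k\<in>UNIV. \<Gamma> k i j s * A k) =
    (\<Sum>k\<in>UNIV. (if k = t then (if i = t \<and> j = t then 2 * \<beta> t s * A t else 0) else 0)
     + (if k = j then (if j \<noteq> t \<and> j \<noteq> r \<and> i = t then \<beta> j s * A j else 0) else 0)
     + (if k = i then (if i \<noteq> t \<and> i \<noteq> r \<and> j = t then \<beta> i s * A i else 0) else 0)
     - (if k = r then (if i \<noteq> t \<and> i \<noteq> r \<and> j = i then \<beta> i s * \<gamma> i s / \<gamma> t s * A r else 0) else 0))"
    by (rule sum.cong) (auto simp: \<Gamma>_def algebra_simps)
  then show ?thesis by (simp add: sum.distrib sum_subtractf sum.delta)
qed

definition \<Gamma>' :: "'n \<Rightarrow> 'n \<Rightarrow> 'n \<Rightarrow> real \<Rightarrow> real" where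
  "\<Gamma>' k i j s =
     (if k = t \<and> i = t \<and> j = t then 2 * \<beta>' t s else 0) +
     (if k \<noteq> t \<and> k \<noteq> r \<and> i = t \<and> j = k then \<beta>' k s else 0) +
     (if k \<noteq> t \<and> k \<noteq> r \<and> j = t \<and> i = k then \<beta>' k s else 0) -
     (if k = r \<and> i \<noteq> t \<and> i \<noteq> r \<and> j = i
      then (\<beta>' i s + 2 * \<beta> i s * \<beta> i s - 2 * \<beta> t s * \<beta> i s) * \<gamma> i s / \<gamma> t s else 0)"

lemma \<Gamma>_deriv: "(\<Gamma> k i j has_real_derivative \<Gamma>' k i j s) (at s)"
proof -
  have if_deriv: "((\<lambda>s. if b then f s else 0) has_real_derivative (if b then d else 0)) (at s)"
    if "(f has_real_derivative d) (at s)" for b f d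
    using that by (cases b) auto
  have quot: "((\<lambda>s. \<beta> i s * \<gamma> i s / \<gamma> t s) has_real_derivative
      (\<beta>' i s + 2 * \<beta> i s * \<beta> i s - 2 * \<beta> t s * \<beta> i s) * \<gamma> i s / \<gamma> t s) (at s)"
    by (rule DERIV_cong[OF DERIV_divide[OF DERIV_mult[OF \<beta>_deriv \<gamma>_deriv] \<gamma>_deriv \<gamma>_nz]])
       (use \<gamma>_nz[of t s] in \<open>simp add: field_simps power2_eq_square\<close>)
  show ?thesis
    unfolding \<Gamma>_def \<Gamma>'_def
    by (intro DERIV_add DERIV_diff if_deriv quot \<beta>_deriv DERIV_cmult)
qed

text \<open>The components of the one-form \<open>dt\<close>, whose metric dual is a null vector field.\<close>

definition null :: "'n \<Rightarrow> real" where
  "null i = (if i = t then 1 else 0)"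

definition transverse :: "('n \<Rightarrow> real \<Rightarrow> real) \<Rightarrow> 'n \<Rightarrow> 'n \<Rightarrow> real \<Rightarrow> real" where
  "transverse c i j s = (if i = j \<and> i \<noteq> t \<and> i \<noteq> r then c i s else 0)"

text \<open>Up to sign the Kulkarni-Nomizu product of \<open>dt \<otimes> dt\<close> with the diagonal form \<open>c\<close> on the directions
  other than \<open>t\<close> and \<open>r\<close>. Both the curvature tensor and the Weyl tensor of a plane wave have this
  form.\<close>

definition curvature_shape :: "('n \<Rightarrow> real \<Rightarrow> real) \<Rightarrow> 'n \<Rightarrow> 'n \<Rightarrow> 'n \<Rightarrow> 'n \<Rightarrow> real \<Rightarrow> real" where
  "curvature_shape c i j k l s =
     null i * null k * transverse c j l s - null i * null l * transverse c j k s -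
     null j * null k * transverse c i l s + null j * null l * transverse c i k s"

lemmas curvature_shape_unfold = curvature_shape_def null_def transverse_def

lemma transverse_sym: "transverse c i j s = transverse c j i s"
  by (auto simp: transverse_def)

lemma curvature_shape_sym:
  "curvature_shape c i j k l s = - curvature_shape c j i k l s"
  "curvature_shape c i j k l s = curvature_shape c k l i j s"
  by (simp_all add: curvature_shape_def transverse_sym[of c k] transverse_sym[of c l])

lemma curvature_shape_cong:
  assumes "\<And>i. i \<noteq> t \<Longrightarrow> i \<noteq> r \<Longrightarrow> c i s = d i s"
  shows "curvature_shape c i j k l s = curvature_shape d i j k l s"
proof -
  have "transverse c i j s = transverse d i j s" for i j
    using assms by (auto simp: transverse_def)
  then show ?thesis by (simp add: curvature_shape_def)
qed

lemma curvature_shape_zero: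
  "(\<And>i. i \<noteq> t \<Longrightarrow> i \<noteq> r \<Longrightarrow> c i s = 0) \<Longrightarrow> curvature_shape c i j k l s = 0"
  by (subst curvature_shape_cong[where d = "\<lambda>_ _. 0"]) (simp_all add: curvature_shape_def transverse_def)

lemma curvature_shape_diagonal:
  "b \<noteq> t \<Longrightarrow> b \<noteq> r \<Longrightarrow> curvature_shape c t b t b s = c b s"
  by (simp add: curvature_shape_def null_def transverse_def)

lemma curv_up_eq:
  "curv_up G i j k l x =
     null i * \<Gamma>' l j k (x $ t) - null j * \<Gamma>' l i k (x $ t)
     + ((\<Sum>m\<in>UNIV. \<Gamma> l i m (x $ t) * \<Gamma> m j k (x $ t)) - (\<Sum>m\<in>UNIV. \<Gamma> l j m (x $ t) * \<Gamma> m i k (x $ t)))"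
proof -
  have pdG: "pd m (christoffel G a b c) x = null m * \<Gamma>' a b c (x $ t)" for m a b c
    unfolding christoffel_G null_def
    using pd_of_coordinate[where t = t and x = x and m = m, OF \<Gamma>_deriv[of a b c]] by simp
  show ?thesis
    unfolding curv_up_def pdG by (simp add: christoffel_G sum_subtractf)
qed

lemma curv_up_antisym: "curv_up G i j k l x = - curv_up G j i k l x"
  unfolding curv_up_eq by simp

lemma curv_up_G_t:
  assumes "j \<noteq> t"
  shows "curv_up G t j k l x =
     (if k = t \<and> l = j \<and> j \<noteq> r then tidal j (x $ t) else 0) -
     (if l = r \<and> k = j \<and> j \<noteq> r then \<gamma> j (x $ t) * tidal j (x $ t) / \<gamma> t (x $ t) else 0)"
proof -
  have "curv_up G t j k l x = \<Gamma>' l j k (x $ t) +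
     (if l = t then 2 * \<beta> t (x $ t) * \<Gamma> t j k (x $ t) else 0) +
     (if l \<noteq> t \<and> l \<noteq> r then \<beta> l (x $ t) * \<Gamma> l j k (x $ t) else 0) -
     (if l \<noteq> t \<and> l \<noteq> r \<and> j = l then \<beta> l (x $ t) * \<Gamma> t t k (x $ t) else 0) +
     (if l = r \<and> j \<noteq> r then \<beta> j (x $ t) * \<gamma> j (x $ t) / \<gamma> t (x $ t) * \<Gamma> j t k (x $ t) else 0)"
    unfolding curv_up_eq sum_\<Gamma>_lower using assms tr
    by (cases "l = t"; cases "l = r") (simp_all add: null_def)
  note eq = this
  consider "l = t" | "l = r" "j = r" | "l = r" "j \<noteq> r" | "l \<noteq> t" "l \<noteq> r" by blast
  then show ?thesis
  proof cases
    case 1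
    then show ?thesis unfolding eq using assms tr by (simp add: \<Gamma>_def \<Gamma>'_def)
  next
    case 2
    then show ?thesis unfolding eq using assms tr by (simp add: \<Gamma>_def \<Gamma>'_def)
  next
    case 3
    then show ?thesis
      unfolding eq using assms tr
      by (cases "k = j") (simp_all add: \<Gamma>_def \<Gamma>'_def tidal_def field_simps power2_eq_square \<gamma>_nz)
  next
    case 4
    then show ?thesis
      unfolding eq using assms tr
      by (cases "k = t"; cases "l = j") (simp_all add: \<Gamma>_def \<Gamma>'_def tidal_def power2_eq_square)
  qed
qed

text \<open>Nothing depends on a coordinate other than \<open>t\<close>, and the two quadratic terms are supported on
  \<open>i = j\<close>, where they cancel.\<close>

lemma curv_up_G_not_t:
  assumes "i \<noteq> t" "j \<noteq> t"
  shows "curv_up G i j k l x = 0"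
proof -
  have 1: "\<Gamma> t a k s = 0" if "a \<noteq> t" for a s
    using that tr by (simp add: \<Gamma>_def)
  have 2: "\<Gamma> a b k s = 0" if "a \<noteq> r" "a \<noteq> t" "b \<noteq> t" "a \<noteq> b" for a b s
    using that by (simp add: \<Gamma>_def)
  show ?thesis
  proof (cases "i = j")
    case False
    then show ?thesis
      unfolding curv_up_eq sum_\<Gamma>_lower using assms 1 2 tr by (simp add: null_def)
  qed (simp add: curv_up_eq)
qed

lemma curv_up_G:
  "curv_up G i j k l x =
     curvature_shape (\<lambda>i s. \<gamma> i s * tidal i s) i j k (cp l) (x $ t) / \<gamma> l (x $ t)"
proof -
  have *: "curv_up G t j k l x =
      curvature_shape (\<lambda>i s. \<gamma> i s * tidal i s) t j k (cp l) (x $ t) / \<gamma> l (x $ t)" if "j \<noteq> t" for j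
    unfolding curv_up_G_t[OF that] curvature_shape_unfold
    using that tr \<gamma>_nz by (cases "l = t"; cases "l = r"; auto simp: \<gamma>_r)
  consider "i = j" | "i = t" "j \<noteq> t" | "i \<noteq> t" "j = t" | "i \<noteq> t" "j \<noteq> t" by blast
  then show ?thesis
  proof cases
    case 1
    then show ?thesis using curv_up_antisym[of i i] by (simp add: curvature_shape_def)
  next
    case 2
    then show ?thesis using * by simp
  next
    case 3
    then show ?thesis
      unfolding curv_up_antisym[of i t] curvature_shape_sym(1)[of _ i t] 3(2) using *[OF 3(1)] by simp
  next
    case 4
    then show ?thesis
      using curv_up_G_not_t[OF 4] by (simp add: curvature_shape_def null_def)
  qed
qed

lemma curv_G: "curv G i j k l x = curvature_shape (\<lambda>i s. \<gamma> i s * tidal i s) i j k l (x $ t)"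
proof -
  have "curv G i j k l x =
      (\<Sum>m\<in>UNIV. (if m = cp l then \<gamma> l (x $ t) else 0) * curv_up G i j k m x)"
    unfolding curv_def G_def by simp
  also have "\<dots> = curvature_shape (\<lambda>i s. \<gamma> i s * tidal i s) i j k l (x $ t)"
    unfolding sum_cp by (simp add: curv_up_G \<gamma>_nz)
  finally show ?thesis .
qed

definition \<rho> :: "real \<Rightarrow> real" where
  "\<rho> s = - (\<Sum>i\<in>- {t, r}. tidal i s)"

lemma ricci_G: "ricci G j k x = (if j = t \<and> k = t then \<rho> (x $ t) else 0)"
proof -
  have "ricci G j k x =
      (\<Sum>i\<in>UNIV. if i \<in> - {t, r} then (if j = t \<and> k = t then - tidal i (x $ t) else 0) else 0)"
    unfolding ricci_def
  proof (rule sum.cong[OF refl])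
    fix i
    consider "i = t" | "i = r" | "i \<noteq> t" "i \<noteq> r" by blast
    then show "curv_up G i j k i x =
        (if i \<in> - {t, r} then (if j = t \<and> k = t then - tidal i (x $ t) else 0) else 0)"
    proof cases
      case 1
      then show ?thesis
        using tr by (cases "j = r") (simp_all add: curv_up_G curvature_shape_unfold)
    next
      case 2
      then show ?thesis
        using tr by (simp add: curv_up_G curvature_shape_unfold)
    next
      case 3
      then show ?thesis
        using tr by (simp add: curv_up_G curvature_shape_unfold \<gamma>_nz)
    qed
  qed
  also have "\<dots> = (\<Sum>i\<in>- {t, r}. (if j = t \<and> k = t then - tidal i (x $ t) else 0))"
    by (subst sum.inter_restrict[symmetric]) auto
  finally show ?thesis by (auto simp: \<rho>_def sum_negf)
qed

text \<open>The Ricci tensor is a multiple of \<open>dt \<otimes> dt\<close>, and \<open>dt\<close> is null.\<close>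

lemma scalar_curv_G: "scalar_curv G x = 0"
  unfolding scalar_curv_def matrix_inv_G ricci_G
  by (intro sum.neutral ballI) (use tr in \<open>simp add: cp_def\<close>)

lemma ricci_G_null: "ricci G j k x = \<rho> (x $ t) * (null j * null k)"
  by (simp add: ricci_G null_def)

lemma G_null:
  "G x $ i $ j = transverse \<gamma> i j (x $ t) +
     \<gamma> t (x $ t) * (null i * (if j = r then 1 else 0) + (if i = r then 1 else 0) * null j)"
  using tr \<gamma>_r by (cases "i = t"; cases "i = r") (auto simp: G_def null_def transverse_def)

lemma transverse_add:
  "transverse (\<lambda>i s. \<gamma> i s * (tidal i s + a s)) i j s =
     transverse (\<lambda>i s. \<gamma> i s * tidal i s) i j s + a s * transverse \<gamma> i j s"
  by (auto simp: transverse_def algebra_simps)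

text \<open>The parts \<open>dt dr\<close> of the metric contribute to the Kulkarni-Nomizu product with the Ricci tensor
  four terms that cancel; only the transverse part of the metric survives.\<close>

lemma weyl_G:
  "weyl G i j k l x =
     curvature_shape (\<lambda>i s. \<gamma> i s * (tidal i s + \<rho> s / (real CARD('n) - 2))) i j k l (x $ t)"
proof -
  let ?N = "real CARD('n) - 2"
  have "weyl G i j k l x = curvature_shape (\<lambda>i s. \<gamma> i s * tidal i s) i j k l (x $ t)
      - (G x $ i $ l * ricci G j k x - G x $ i $ k * ricci G j l x +
         G x $ j $ k * ricci G i l x - G x $ j $ l * ricci G i k x) / ?N"
    unfolding weyl_def Let_def scalar_curv_G curv_G by simp
  also have "\<dots> = curvature_shape (\<lambda>i s. \<gamma> i s * tidal i s) i j k l (x $ t)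
      + \<rho> (x $ t) / ?N * curvature_shape \<gamma> i j k l (x $ t)"
    unfolding ricci_G_null G_null curvature_shape_def
    by (simp add: algebra_simps add_divide_distrib diff_divide_distrib)
  also have "\<dots> = curvature_shape (\<lambda>i s. \<gamma> i s * (tidal i s + \<rho> s / ?N)) i j k l (x $ t)"
    unfolding curvature_shape_def transverse_add by (simp add: algebra_simps)
  finally show ?thesis .
qed

lemma sum_\<Gamma>_null:
  "(\<Sum>k\<in>UNIV. \<Gamma> k m i s * null k) = null m * (2 * \<beta> t s) * null i"
  unfolding sum_\<Gamma>_upper using tr by (cases "m = t"; cases "i = t") (simp_all add: null_def)

lemma sum_\<Gamma>_transverse:
  "(\<Sum>k\<in>UNIV. \<Gamma> k m i s * transverse c k j s) =
     null m * transverse (\<lambda>i s. \<beta> i s * c i s) i j s + null i * transverse (\<lambda>i s. \<beta> i s * c i s) m j s"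
  unfolding sum_\<Gamma>_upper using tr
  by (cases "m = t"; cases "i = t"; cases "m = r"; cases "i = r") (simp_all add: null_def transverse_def)

text \<open>One of the four correction terms in the covariant derivative of such a tensor; the other three
  arise from it by the symmetries of \<open>curvature_shape\<close>.\<close>

lemma sum_\<Gamma>_curvature_shape:
  fixes c defines "d \<equiv> \<lambda>i s. \<beta> i s * c i s"
  shows "(\<Sum>n\<in>UNIV. \<Gamma> n m i s * curvature_shape c n j k l s) =
     null m * null i * (2 * \<beta> t s) * (null k * transverse c j l s - null l * transverse c j k s)
     - null j * null k * (null m * transverse d i l s + null i * transverse d m l s)
     + null j * null l * (null m * transverse d i k s + null i * transverse d m k s)"
proof -
  have "(\<Sum>n\<in>UNIV. \<Gamma> n m i s * curvature_shape c n j k l s) =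
     (\<Sum>n\<in>UNIV. \<Gamma> n m i s * null n) * (null k * transverse c j l s - null l * transverse c j k s)
     - null j * null k * (\<Sum>n\<in>UNIV. \<Gamma> n m i s * transverse c n l s)
     + null j * null l * (\<Sum>n\<in>UNIV. \<Gamma> n m i s * transverse c n k s)"
    unfolding sum_distrib_left sum_distrib_right sum_subtractf[symmetric] sum.distrib[symmetric]
    by (rule sum.cong) (simp_all add: curvature_shape_def algebra_simps)
  then show ?thesis
    unfolding sum_\<Gamma>_null sum_\<Gamma>_transverse d_def by (simp add: algebra_simps)
qed

text \<open>The correction terms that turn a transverse index into \<open>t\<close> cancel in pairs by antisymmetry. What
  remains is the derivative along \<open>t\<close>, corrected by \<open>2 \<beta>\<^sub>t\<close> for each of the two factors \<open>dt\<close> and by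
  \<open>\<beta>\<^sub>i\<close> for each of the two transverse indices.\<close>

lemma cov_deriv4_curvature_shape:
  assumes c': "\<And>i. (c i has_real_derivative c' i) (at (x $ t))"
  shows "cov_deriv4 G (\<lambda>i j k l x. curvature_shape c i j k l (x $ t)) m i j k l x =
     null m * curvature_shape (\<lambda>i s. c' i - 4 * \<beta> t s * c i s - 2 * \<beta> i s * c i s) i j k l (x $ t)"
proof -
  let ?s = "x $ t" and ?c' = "\<lambda>i (_::real). c' i" and ?d = "\<lambda>i s. \<beta> i s * c i s"
  have "(transverse c i j has_real_derivative transverse ?c' i j ?s) (at ?s)" for i j
  proof -
    have "transverse c i j = (if i = j \<and> i \<noteq> t \<and> i \<noteq> r then c i else (\<lambda>_. 0))"
      by (auto simp: transverse_def)
    then show ?thesis using c' by (auto simp: transverse_def)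
  qed
  then have "(curvature_shape c i j k l has_real_derivative curvature_shape ?c' i j k l ?s) (at ?s)"
    unfolding curvature_shape_def by (intro DERIV_add DERIV_diff DERIV_cmult)
  then have pdT: "pd m (\<lambda>x. curvature_shape c i j k l (x $ t)) x = null m * curvature_shape ?c' i j k l ?s"
    using pd_of_coordinate[where t = t and m = m and x = x and f = "curvature_shape c i j k l"]
    by (simp add: null_def)
  have lin: "transverse (\<lambda>i s. c' i - 4 * \<beta> t s * c i s - 2 * \<beta> i s * c i s) i j ?s =
     transverse ?c' i j ?s - 4 * \<beta> t ?s * transverse c i j ?s - 2 * transverse ?d i j ?s" for i j
    by (auto simp: transverse_def)
  have sym: "curvature_shape c i n k l ?s = - curvature_shape c n i k l ?s"
    "curvature_shape c i j n l ?s = curvature_shape c n l i j ?s"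
    "curvature_shape c i j k n ?s = - curvature_shape c n k i j ?s" for i j k l n
    by (rule curvature_shape_sym, rule curvature_shape_sym, subst curvature_shape_sym(2),
        rule curvature_shape_sym)
  have "cov_deriv4 G (\<lambda>i j k l x. curvature_shape c i j k l (x $ t)) m i j k l x =
     null m * curvature_shape ?c' i j k l ?s -
     ((\<Sum>n\<in>UNIV. \<Gamma> n m i ?s * curvature_shape c n j k l ?s)
      - (\<Sum>n\<in>UNIV. \<Gamma> n m j ?s * curvature_shape c n i k l ?s)
      + (\<Sum>n\<in>UNIV. \<Gamma> n m k ?s * curvature_shape c n l i j ?s)
      - (\<Sum>n\<in>UNIV. \<Gamma> n m l ?s * curvature_shape c n k i j ?s))"
    unfolding cov_deriv4_def christoffel_G pdT sym(1)[of i _ k l] sym(2)[of i j _ l] sym(3)[of i j k]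
    by (simp add: sum.distrib sum_subtractf sum_negf algebra_simps)
  note eq = this[unfolded sum_\<Gamma>_curvature_shape]
  show ?thesis
    unfolding eq
    unfolding curvature_shape_def lin
      transverse_sym[of _ j i] transverse_sym[of _ k i] transverse_sym[of _ l i]
      transverse_sym[of _ k j] transverse_sym[of _ l j] transverse_sym[of _ l k]
    by (simp add: algebra_simps)
qed

lemma cov_deriv2_ricci_G:
  assumes "(\<rho> has_real_derivative \<rho>') (at (x $ t))"
  shows "cov_deriv2 G (ricci G) m i j x =
     (if m = t \<and> i = t \<and> j = t then \<rho>' - 4 * \<beta> t (x $ t) * \<rho> (x $ t) else 0)"
proof -
  have "(\<lambda>x. ricci G i j x) = (\<lambda>x. (if i = t \<and> j = t then \<rho> else (\<lambda>_. 0)) (x $ t))"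
    by (auto simp: ricci_G)
  then have "pd m (ricci G i j) x = (if m = t then (if i = t \<and> j = t then \<rho>' else 0) else 0)"
    using pd_of_coordinate[where f = "if i = t \<and> j = t then \<rho> else (\<lambda>_. 0)"
        and D = "if i = t \<and> j = t then \<rho>' else 0" and t = t and x = x and m = m] assms by auto
  moreover have "(\<Sum>s\<in>UNIV. christoffel G s m i x * ricci G s j x + christoffel G s m j x * ricci G i s x)
     = (\<Sum>s\<in>UNIV. \<Gamma> s m i (x $ t) * (if s = t \<and> j = t then \<rho> (x $ t) else 0)) +
       (\<Sum>s\<in>UNIV. \<Gamma> s m j (x $ t) * (if i = t \<and> s = t then \<rho> (x $ t) else 0))"
    by (simp add: christoffel_G ricci_G sum.distrib)
  ultimately show ?thesis
    unfolding cov_deriv2_def sum_\<Gamma>_upper using tr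
    by (cases "m = t"; cases "i = t"; cases "j = t") simp_all
qed

end

section \<open>The golden lattice\<close>

text \<open>The golden ratio and its conjugate are the roots of \<open>x\<^sup>2 = x + 1\<close>. The exponent \<open>\<mu>\<close> is
  chosen such that \<open>exp \<mu>\<close> and \<open>exp (- \<mu>)\<close> are the squares of these two numbers.\<close>

definition gold :: real where "gold = (1 + sqrt 5) / 2"
definition gold' :: real where "gold' = (1 - sqrt 5) / 2"
definition \<mu> :: real where "\<mu> = 2 * ln gold"

lemma gold_pos: "gold > 1"
  unfolding gold_def using real_sqrt_gt_1_iff[of 5] by simp

lemma gold'_neg: "gold' < 0"
  unfolding gold'_def using real_sqrt_gt_1_iff[of 5] by simp

lemma gold_sum: "gold + gold' = 1" and gold_diff: "gold - gold' = sqrt 5"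
  and gold_prod: "gold * gold' = -1"
  by (simp_all add: gold_def gold'_def field_simps)

lemma gold_square: "gold * gold = gold + 1" "gold' * gold' = gold' + 1"
  by (simp_all add: gold_def gold'_def field_simps)

lemma \<mu>_pos: "\<mu> > 0"
  using gold_pos by (simp add: \<mu>_def)

lemma exp_\<mu>: "exp \<mu> = gold + 1" "exp (- \<mu>) = gold' + 1"
proof -
  have "exp \<mu> = gold * gold"
    unfolding \<mu>_def mult_2 exp_add using gold_pos by simp
  then show 1: "exp \<mu> = gold + 1"
    by (simp only: gold_square)
  have "(gold + 1) * (gold' + 1) = gold * gold' + (gold + gold') + 1"
    by (simp add: algebra_simps)
  then have "(gold + 1) * (gold' + 1) = 1"
    by (simp only: gold_sum gold_prod)
  then show "exp (- \<mu>) = gold' + 1"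
    unfolding exp_minus 1 by (rule inverse_unique)
qed

text \<open>The involution \<open>pr\<close> pairs each index with \<open>\<kappa> = 1\<close> with one with \<open>\<kappa> = - 1\<close>; on the coordinates with
  \<open>\<kappa> = 1\<close> and \<open>\<kappa> = - 1\<close> the linear part of the monodromy acts by \<open>exp (- \<mu>)\<close> and \<open>exp \<mu>\<close>. It fixes the
  remaining coordinates, among them \<open>t\<close> and \<open>r\<close>.\<close>

locale golden_lattice =
  fixes t r :: "'n::finite" and \<kappa> :: "'n \<Rightarrow> real" and pr :: "'n \<Rightarrow> 'n"
  assumes tr: "t \<noteq> r" and \<kappa>_t: "\<kappa> t = 0" and \<kappa>_r: "\<kappa> r = 0"
    and \<kappa>_range: "\<kappa> i \<in> {-1, 0, 1}"
    and pr_pr [simp]: "pr (pr i) = i"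
    and \<kappa>_pr: "\<kappa> (pr i) = - \<kappa> i"
    and pr_fixed: "\<kappa> i = 0 \<Longrightarrow> pr i = i"
begin

definition flow :: "real \<Rightarrow> real ^ 'n \<Rightarrow> real ^ 'n" where
  "flow s x = (\<chi> i. exp (- (s * \<mu> * \<kappa> i)) * x $ i)"

text \<open>Coordinates with respect to a basis of the lattice. In a pair of directions \<open>i\<close>, \<open>pr i\<close> the basis
  consists of the images of the golden ratio and its conjugate under the two real embeddings of
  their ring. The difference of the two numbers is \<open>\<surd>5\<close>, so for
  \<open>pr i = i\<close> the formula gives back the coordinate \<open>i\<close>.\<close>

definition coord :: "'n \<Rightarrow> real ^ 'n \<Rightarrow> real" where
  "coord i x = (gold * x $ i - gold' * x $ pr i) / sqrt 5"

definition from_coords :: "real ^ 'n \<Rightarrow> real ^ 'n" where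
  "from_coords y = (\<chi> i. gold * y $ i + gold' * y $ pr i)"

text \<open>The group generated by the lattice translations with fixed \<open>t\<close> and by \<open>x \<mapsto> flow 1 x + e\<^sub>t\<close> takes
  \<open>x\<close> to \<open>u\<close> if and only if \<open>k = u\<^sub>t - x\<^sub>t\<close> is an integer and \<open>u - flow k x\<close> is integral in the other
  lattice coordinates. Since \<open>coord t\<close> of this difference is \<open>k\<close>, the first condition is the case
  \<open>i = t\<close> of the second, and the relation is a closed condition on the pair \<open>(x, u)\<close>.\<close>

definition rel :: "real ^ 'n \<Rightarrow> real ^ 'n \<Rightarrow> bool" where
  "rel x u \<longleftrightarrow> (\<forall>i. coord i (u - flow (u $ t - x $ t) x) \<in> \<int>)"

definition cls :: "real ^ 'n \<Rightarrow> (real ^ 'n) set" where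
  "cls x = {u. rel x u}"

lemma linear_flow: "linear (flow s)"
  by (rule linearI) (auto simp: flow_def vec_eq_iff algebra_simps)

lemma bounded_linear_flow: "bounded_linear (flow s)"
  using linear_flow linear_conv_bounded_linear by blast

lemma linear_coord: "linear (coord i)"
  by (rule linearI) (auto simp: coord_def algebra_simps diff_divide_distrib add_divide_distrib)

lemma bounded_linear_coord: "bounded_linear (coord i)"
  using linear_coord linear_conv_bounded_linear by blast

lemma linear_from_coords: "linear from_coords"
  by (rule linearI) (auto simp: from_coords_def vec_eq_iff algebra_simps)

lemma bounded_linear_from_coords: "bounded_linear from_coords"
  using linear_from_coords linear_conv_bounded_linear by blast

lemmas coord_add = linear_add[OF linear_coord] and coord_diff = linear_diff[OF linear_coord]
  and coord_minus = linear_neg[OF linear_coord]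
lemmas flow_diff = linear_diff[OF linear_flow]

lemma flow_flow: "flow a (flow b x) = flow (a + b) x"
  by (simp add: flow_def vec_eq_iff algebra_simps flip: exp_add)

lemma flow_0 [simp]: "flow 0 x = x"
  by (simp add: flow_def vec_eq_iff)

lemma flow_t [simp]: "flow s x $ t = x $ t"
  by (simp add: flow_def \<kappa>_t)

lemma coord_fixed: "\<kappa> i = 0 \<Longrightarrow> coord i x = x $ i"
  by (simp add: coord_def pr_fixed gold_diff flip: left_diff_distrib)

lemma coord_t [simp]: "coord t x = x $ t"
  by (simp add: coord_fixed \<kappa>_t)

lemma coord_from_coords [simp]: "coord i (from_coords y) = y $ i"
proof -
  have "coord i (from_coords y) = (gold * gold - gold' * gold') * y $ i / sqrt 5"
    by (simp add: coord_def from_coords_def algebra_simps)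
  also have "gold * gold - gold' * gold' = sqrt 5"
    using gold_square gold_diff by simp
  finally show ?thesis by simp
qed

lemma from_coords_coord [simp]: "from_coords (\<chi> i. coord i x) = x"
proof -
  have "gold * gold - gold' * gold' = sqrt 5"
    using gold_square gold_diff by simp
  moreover have "gold * coord i x + gold' * coord (pr i) x =
      (gold * gold - gold' * gold') * x $ i / sqrt 5" for i
    by (simp add: coord_def field_simps)
  ultimately have "gold * coord i x + gold' * coord (pr i) x = x $ i" for i
    by simp
  then show ?thesis by (simp add: from_coords_def vec_eq_iff)
qed

lemma coord_eqI:
  assumes "\<And>i. coord i x = coord i y"
  shows "x = y"
proof -
  have "from_coords (\<chi> i. coord i x) = from_coords (\<chi> i. coord i y)"
    by (simp add: assms)
  then show ?thesis by simp
qed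

text \<open>The square of the golden ratio is a unit of its ring, so multiplication by it and by its inverse is
  given by integer matrices in the lattice basis.\<close>

lemma coord_flow_unit:
  "coord i (flow 1 x) = (if \<kappa> i = 1 then coord (pr i) x
     else if \<kappa> i = - 1 then 3 * coord i x - coord (pr i) x else coord i x)"
  "coord i (flow (- 1) x) = (if \<kappa> i = - 1 then coord (pr i) x
     else if \<kappa> i = 1 then 3 * coord i x - coord (pr i) x else coord i x)"
proof -
  have "gold * (gold' + 1) = - gold'" "gold' * (gold + 1) = - gold"
    "gold * (gold + 1) = 3 * gold + gold'" "gold' * (gold' + 1) = 3 * gold' + gold"
    using gold_sum gold_prod gold_square by (simp_all add: algebra_simps)
  then have *: "gold * ((gold' + 1) * a) = - gold' * a" "gold' * ((gold + 1) * a) = - gold * a"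
    "gold * ((gold + 1) * a) = (3 * gold + gold') * a"
    "gold' * ((gold' + 1) * a) = (3 * gold' + gold) * a" for a
    by (simp_all flip: mult.assoc)
  have **: "((3 * gold + gold') * a - (3 * gold' + gold) * b) / sqrt 5 =
      3 * ((gold * a - gold' * b) / sqrt 5) - (gold * b - gold' * a) / sqrt 5" for a b
    by (simp add: field_simps)
  consider "\<kappa> i = 1" | "\<kappa> i = - 1" | "\<kappa> i = 0" using \<kappa>_range by auto
  note cases = this
  from cases show "coord i (flow 1 x) = (if \<kappa> i = 1 then coord (pr i) x
     else if \<kappa> i = - 1 then 3 * coord i x - coord (pr i) x else coord i x)"
    by cases (simp_all add: coord_def flow_def \<kappa>_pr pr_fixed exp_\<mu> * **)
  from cases show "coord i (flow (- 1) x) = (if \<kappa> i = - 1 then coord (pr i) x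
     else if \<kappa> i = 1 then 3 * coord i x - coord (pr i) x else coord i x)"
    by cases (simp_all add: coord_def flow_def \<kappa>_pr pr_fixed exp_\<mu> * **)
qed

lemma coord_flow_Ints:
  assumes "k \<in> \<int>" and "\<And>i. coord i z \<in> \<int>"
  shows "coord i (flow k z) \<in> \<int>"
proof -
  have step: "\<forall>i. coord i (flow 1 z) \<in> \<int>" "\<forall>i. coord i (flow (- 1) z) \<in> \<int>"
    if "\<forall>i. coord i z \<in> \<int>" for z
    using that by (auto simp: coord_flow_unit intro!: Ints_diff Ints_mult)
  have "\<forall>i. coord i (flow (real n) z) \<in> \<int> \<and> coord i (flow (- real n) z) \<in> \<int>" for n
  proof (induction n)
    case (Suc n)
    have "flow (real (Suc n)) z = flow 1 (flow (real n) z)"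
      "flow (- real (Suc n)) z = flow (- 1) (flow (- real n) z)"
      by (simp_all add: flow_flow algebra_simps)
    then show ?case using step[of "flow (real n) z"] step[of "flow (- real n) z"] Suc by simp
  qed (use assms in simp)
  moreover obtain m where "k = of_int m" using \<open>k \<in> \<int>\<close> by (auto elim: Ints_cases)
  ultimately show ?thesis
    by (cases m rule: int_cases2) auto
qed

lemma rel_shift_Ints:
  assumes "rel x u" shows "u $ t - x $ t \<in> \<int>"
  using assms[unfolded rel_def, rule_format, of t] by simp

lemma rel_refl: "rel x x"
  by (simp add: rel_def linear_0[OF linear_coord])

lemma rel_sym: assumes "rel x u" shows "rel u x"
  unfolding rel_def
proof
  fix i
  let ?k = "u $ t - x $ t"
  have "x - flow (x $ t - u $ t) u = - flow (- ?k) (u - flow ?k x)"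
    by (simp add: flow_diff flow_flow)
  then have "coord i (x - flow (x $ t - u $ t) u) = - coord i (flow (- ?k) (u - flow ?k x))"
    by (simp add: coord_minus)
  also have "\<dots> \<in> \<int>"
    using assms rel_shift_Ints[OF assms] unfolding rel_def
    by (intro Ints_minus coord_flow_Ints) (auto simp: Ints_minus)
  finally show "coord i (x - flow (x $ t - u $ t) u) \<in> \<int>" .
qed

lemma rel_trans: assumes "rel x u" "rel u w" shows "rel x w"
  unfolding rel_def
proof
  fix i
  let ?k = "u $ t - x $ t" and ?l = "w $ t - u $ t"
  have "w - flow (w $ t - x $ t) x = (w - flow ?l u) + flow ?l (u - flow ?k x)"
    by (simp add: flow_diff flow_flow)
  then have "coord i (w - flow (w $ t - x $ t) x)
      = coord i (w - flow ?l u) + coord i (flow ?l (u - flow ?k x))"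
    by (simp only: coord_add)
  also have "\<dots> \<in> \<int>"
    using assms rel_shift_Ints[OF assms(2)] unfolding rel_def
    by (intro Ints_add coord_flow_Ints) auto
  finally show "coord i (w - flow (w $ t - x $ t) x) \<in> \<int>" .
qed

lemma cls_eq_iff: "cls x = cls u \<longleftrightarrow> rel x u"
  unfolding cls_def using rel_refl rel_sym rel_trans by blast

text \<open>The affine map \<open>y \<mapsto> u + flow (u\<^sub>t - x\<^sub>t) (y - x)\<close> is the deck transformation that takes \<open>x\<close> to \<open>u\<close>.\<close>

lemma cls_translate:
  assumes "cls x = cls u"
  shows "cls (u + flow (u $ t - x $ t) (y - x)) = cls y"
proof -
  have "rel x u" using assms by (simp add: cls_eq_iff)
  then have "rel y (u + flow (u $ t - x $ t) (y - x))"
    by (simp add: rel_def flow_diff algebra_simps)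
  then show ?thesis using cls_eq_iff by blast
qed

lemma abs_coord_le_norm: "\<bar>coord i z\<bar> \<le> norm z"
proof -
  have "\<bar>gold * z $ i - gold' * z $ pr i\<bar> \<le> gold * norm z + (- gold') * norm z"
    using gold_pos gold'_neg component_le_norm_cart[of z i] component_le_norm_cart[of z "pr i"]
    by (intro order_trans[OF abs_triangle_ineq4] add_mono) (auto simp: abs_mult intro!: mult_left_mono)
  also have "\<dots> = sqrt 5 * norm z" by (simp flip: gold_diff add: algebra_simps)
  finally show ?thesis by (simp add: coord_def field_simps)
qed

text \<open>Lattice coordinates are bounded by the norm, and an integer of absolute value less than \<open>1\<close>
  vanishes; the difference of the \<open>t\<close> coordinates has to be treated first.\<close>

lemma cls_inj_on_small:
  assumes "cls x = cls y" "dist x y < 1"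
  shows "x = y"
proof -
  have small: "a = 0" if "a \<in> \<int>" "\<bar>a\<bar> < 1" for a :: real
    using that by (auto elim!: Ints_cases)
  have rel: "rel x y" using assms(1) cls_eq_iff by blast
  have less: "\<bar>coord i (y - x)\<bar> < 1" for i
    using abs_coord_le_norm[of i "y - x"] assms(2) by (simp add: dist_norm norm_minus_commute)
  then have "y $ t - x $ t = 0"
    using rel_shift_Ints[OF rel] less[of t] small[of "y $ t - x $ t"] by simp
  with rel have "coord i (y - x) \<in> \<int>" for i
    by (simp add: rel_def)
  with less have "coord i (y - x) = 0" for i using small by blast
  then show ?thesis using coord_eqI[of "y - x" 0] by (simp add: linear_0[OF linear_coord])
qed

lemma continuous_on_coord [continuous_intros]:
  "continuous_on S f \<Longrightarrow> continuous_on S (\<lambda>x. coord i (f x))"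
  using bounded_linear.continuous_on[OF bounded_linear_coord] .

lemma continuous_on_flow [continuous_intros]:
  "continuous_on S s \<Longrightarrow> continuous_on S f \<Longrightarrow> continuous_on S (\<lambda>x. flow (s x) (f x))"
  unfolding flow_def by (intro continuous_intros)

section \<open>The quotient manifold\<close>

definition qtop :: "(real ^ 'n) set topology" where
  "qtop = topology (\<lambda>U. U \<subseteq> range cls \<and> open (cls -` U))"

lemma openin_qtop: "openin qtop U \<longleftrightarrow> U \<subseteq> range cls \<and> open (cls -` U)"
proof -
  have "istopology (\<lambda>U. U \<subseteq> range cls \<and> open (cls -` U))"
    unfolding istopology_def by (auto simp: vimage_Union)
  then show ?thesis unfolding qtop_def by (simp add: topology_inverse')
qed

lemma topspace_qtop: "topspace qtop = range cls"
proof
  show "topspace qtop \<subseteq> range cls"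
    using openin_topspace[of qtop] unfolding openin_qtop by blast
  have "cls -` range cls = UNIV" by auto
  then have "openin qtop (range cls)" unfolding openin_qtop by simp
  then show "range cls \<subseteq> topspace qtop" by (rule openin_subset)
qed

lemma continuous_map_cls: "continuous_map euclidean qtop cls"
  by (auto simp: continuous_map_def topspace_qtop openin_qtop vimage_def)

lemma open_image_cls:
  assumes "open U" shows "openin qtop (cls ` U)"
proof -
  have "open (cls -` (cls ` U))"
  proof (subst open_subopen, intro ballI)
    fix y assume "y \<in> cls -` (cls ` U)"
    then obtain u where u: "u \<in> U" "cls y = cls u" by auto
    let ?g = "\<lambda>z. u + flow (u $ t - y $ t) (z - y)"
    have "open (?g -` U)"
      using assms by (intro open_vimage continuous_intros)
    moreover have "y \<in> ?g -` U" using u by (simp add: linear_0[OF linear_flow])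
    moreover have "?g -` U \<subseteq> cls -` (cls ` U)"
    proof
      fix z assume "z \<in> ?g -` U"
      then have "cls (?g z) \<in> cls ` U" by simp
      then show "z \<in> cls -` (cls ` U)" using cls_translate[OF u(2)] by simp
    qed
    ultimately show "\<exists>T. open T \<and> y \<in> T \<and> T \<subseteq> cls -` (cls ` U)" by blast
  qed
  then show ?thesis by (auto simp: openin_qtop)
qed

lemma open_map_cls: "open_map euclidean qtop cls"
  by (simp add: open_map_def open_image_cls)

lemma quotient_map_cls: "quotient_map euclidean qtop cls"
  using continuous_map_cls open_map_cls
  by (intro continuous_open_imp_quotient_map) (auto simp: topspace_qtop)

text \<open>The relation is the preimage of the closed set of integers under continuous functions. As the
  quotient map is open, this is what separates points of the quotient.\<close>

lemma closed_rel: "closed {p. rel (fst p) (snd p)}"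
proof -
  have "{p. rel (fst p) (snd p)} =
    (\<Inter>i. (\<lambda>p. coord i (snd p - flow (snd p $ t - fst p $ t) (fst p))) -` \<int>)"
    by (auto simp: rel_def)
  also have "closed \<dots>"
    by (intro closed_INT ballI closed_vimage closed_Ints continuous_intros)
  finally show ?thesis .
qed

lemma Hausdorff_qtop: "Hausdorff_space qtop"
  unfolding Hausdorff_space_def
proof (intro allI impI, elim conjE)
  fix a b assume ab: "a \<in> topspace qtop" "b \<in> topspace qtop" "a \<noteq> b"
  then obtain x y where xy: "a = cls x" "b = cls y" by (auto simp: topspace_qtop)
  have "open (- {p. rel (fst p) (snd p)})" using closed_rel by (simp add: open_Compl)
  moreover have "(x, y) \<in> - {p. rel (fst p) (snd p)}" using ab xy cls_eq_iff by auto
  ultimately obtain U V where UV: "open U" "open V" "(x, y) \<in> U \<times> V"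
      "U \<times> V \<subseteq> - {p. rel (fst p) (snd p)}"
    by (rule open_prod_elim)
  have "disjnt (cls ` U) (cls ` V)"
    using UV(4) cls_eq_iff unfolding disjnt_iff by fastforce
  then show "\<exists>U V. openin qtop U \<and> openin qtop V \<and> a \<in> U \<and> b \<in> V \<and> disjnt U V"
    using UV open_image_cls xy by blast
qed

lemma second_countable_qtop: "second_countable qtop"
proof (rule second_countable_open_map_image)
  show "second_countable (euclidean :: (real ^ 'n) topology)"
  proof -
    obtain B :: "(real ^ 'n) set set" where B: "countable B" "topological_basis B"
      using ex_countable_basis by blast
    have "\<exists>V\<in>B. x \<in> V \<and> V \<subseteq> U" if "open U" "x \<in> U" for U x
      using topological_basisE[OF B(2) that] by metis
    then show ?thesis
      unfolding second_countable_def using B topological_basis_open[OF B(2)]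
      by (intro exI[of _ B]) simp
  qed
qed (use continuous_map_cls open_map_cls in \<open>auto simp: topspace_qtop\<close>)

text \<open>Shift \<open>t\<close> into the unit interval by a power of the monodromy, then reduce the other lattice
  coordinates modulo \<open>1\<close>.\<close>

lemma cls_meets_cube: "\<exists>y. cls y = cls x \<and> (\<forall>i. coord i y \<in> {0..1})"
proof -
  define k where "k = - real_of_int \<lfloor>x $ t\<rfloor>"
  define z where "z = flow k x"
  define y where "y = from_coords (\<chi> i. frac (coord i z))"
  have "coord t y = frac (coord t z)"
    unfolding y_def coord_from_coords by simp
  then have yt: "y $ t = x $ t + k"
    by (simp add: z_def k_def frac_def)
  have "coord i (y - flow (y $ t - x $ t) x) \<in> \<int>" for i
    unfolding yt by (simp add: coord_diff z_def[symmetric]) (simp add: y_def frac_def)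
  then have "rel x y" by (simp add: rel_def)
  moreover have "coord i y \<in> {0..1}" for i
    by (simp add: y_def frac_ge_0 less_imp_le[OF frac_lt_1])
  ultimately show ?thesis using cls_eq_iff rel_sym by blast
qed

lemma compact_qtop: "compact_space qtop"
proof -
  have "compact (cbox (0 :: real ^ 'n) (\<chi> i. 1))" by simp
  then have "compact (from_coords ` cbox 0 (\<chi> i. 1))"
    by (rule compact_continuous_image[rotated])
       (use bounded_linear_from_coords linear_continuous_on in blast)
  then have "compactin qtop (cls ` from_coords ` cbox 0 (\<chi> i. 1))"
    by (intro image_compactin[OF _ continuous_map_cls]) simp
  moreover have "cls ` from_coords ` cbox 0 (\<chi> i. 1) = range cls"
  proof (intro equalityI subsetI)
    fix a assume "a \<in> range cls"
    then obtain y where y: "a = cls y" "\<forall>i. coord i y \<in> {0..1}"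
      using cls_meets_cube by (metis rangeE)
    then have "(\<chi> i. coord i y) \<in> cbox 0 (\<chi> i. 1)"
      by (simp add: mem_box_cart)
    then have "y \<in> from_coords ` cbox 0 (\<chi> i. 1)"
      by (metis from_coords_coord image_eqI)
    then show "a \<in> cls ` from_coords ` cbox 0 (\<chi> i. 1)" using y by blast
  qed auto
  ultimately show ?thesis by (simp add: compact_space_def topspace_qtop)
qed

definition M :: "((real ^ 'n) set, real ^ 'n) manifold" where
  "M = \<lparr>mtop = qtop, charts = {(cls ` U, inv_into U cls) | U. open U \<and> inj_on cls U}\<rparr>"

lemma charts_ME:
  assumes "c \<in> charts M"
  obtains U where "open U" "inj_on cls U" "c = (cls ` U, inv_into U cls)"
  using assms by (auto simp: M_def)

lemma chart_img_M: "inj_on cls U \<Longrightarrow> chart_img (cls ` U, inv_into U cls) = U"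
  by (auto simp: chart_img_def image_image inv_into_f_f)

lemma inv_into_inv_into:
  assumes "inj_on f U" "W \<subseteq> U" "x \<in> W"
  shows "inv_into (f ` W) (inv_into U f) x = f x"
proof -
  have "inj_on (inv_into U f) (f ` W)"
    using assms by (meson image_mono inj_on_inv_into)
  moreover have "inv_into U f (f x) = x" using assms by (auto intro: inv_into_f_f)
  ultimately show ?thesis
    using inv_into_f_f[of "inv_into U f" "f ` W" "f x"] assms(3) by auto
qed

lemma chart_inv_M: "inj_on cls U \<Longrightarrow> x \<in> U \<Longrightarrow> chart_inv (cls ` U, inv_into U cls) x = cls x"
  by (simp add: chart_inv_def inv_into_inv_into)

text \<open>Near \<open>y\<close> the chart follows the one deck transformation that moves \<open>F y\<close> into \<open>U\<close>.\<close>

lemma inv_into_cls_eventually: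
  assumes U: "open U" "inj_on cls U" and F: "(F \<longlongrightarrow> F y) (nhds y)"
    and u: "u \<in> U" "cls (F y) = cls u"
  shows "\<forall>\<^sub>F z in nhds y. inv_into U cls (cls (F z)) = u + flow (u $ t - F y $ t) (F z - F y)"
proof -
  let ?g = "\<lambda>x. u + flow (u $ t - F y $ t) (x - F y)"
  have "((\<lambda>z. ?g (F z)) \<longlongrightarrow> ?g (F y)) (nhds y)"
    by (intro tendsto_add tendsto_diff tendsto_const bounded_linear.tendsto[OF bounded_linear_flow] F)
  then have "\<forall>\<^sub>F z in nhds y. ?g (F z) \<in> U"
    by (rule topological_tendstoD) (simp_all add: U(1) u(1) linear_0[OF linear_flow])
  then show ?thesis
  proof eventually_elim
    case (elim z)
    have "cls (F z) = cls (?g (F z))" using cls_translate[OF u(2)] by simp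
    then show ?case using inv_into_f_f[OF U(2) elim] by simp
  qed
qed

lemma locally_affine_into_chart:
  assumes U: "open U" "inj_on cls U" and F: "locally_affine_at F y" and "cls (F y) \<in> cls ` U"
  shows "locally_affine_at (\<lambda>z. inv_into U cls (cls (F z))) y"
proof -
  obtain u where u: "u \<in> U" "cls (F y) = cls u" using assms(4) by auto
  let ?k = "u $ t - F y $ t"
  have g: "locally_affine_at (\<lambda>x. u + flow ?k (x - F y)) x" for x
    by (rule locally_affine_atI[where A = "flow ?k" and b = "u - flow ?k (F y)"])
       (simp_all add: flow_diff bounded_linear_flow)
  show ?thesis
    by (rule locally_affine_at_cong[OF locally_affine_at_compose[OF F g]
          inv_into_cls_eventually[OF U locally_affine_at_tendsto[OF F] u]])
qed

lemma transition_eventually: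
  assumes "open U" "inj_on cls U" "open V" "inj_on cls V" "x \<in> U" "u \<in> V" "cls x = cls u"
  shows "\<forall>\<^sub>F z in nhds x. transition (cls ` U, inv_into U cls) (cls ` V, inv_into V cls) z =
     u + flow (u $ t - x $ t) (z - x)"
proof -
  have "\<forall>\<^sub>F z in nhds x. inv_into V cls (cls z) = u + flow (u $ t - x $ t) (z - x)"
    using inv_into_cls_eventually[OF assms(3,4), of "\<lambda>z. z" x] assms by (simp add: tendsto_ident_at filterlim_ident)
  moreover have "\<forall>\<^sub>F z in nhds x. z \<in> U" using assms by (simp add: eventually_nhds_in_open)
  ultimately show ?thesis
    by eventually_elim (simp add: transition_def chart_inv_M assms)
qed

lemma transition_M:
  assumes "open U" "inj_on cls U" "open V" "inj_on cls V" "x \<in> U" "cls x \<in> cls ` V"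
  shows "locally_affine_at (transition (cls ` U, inv_into U cls) (cls ` V, inv_into V cls)) x"
proof -
  obtain u where u: "u \<in> V" "cls x = cls u" using assms(6) by auto
  have "\<forall>\<^sub>F z in nhds x. transition (cls ` U, inv_into U cls) (cls ` V, inv_into V cls) z =
     flow (u $ t - x $ t) z + (u - flow (u $ t - x $ t) x)"
    using transition_eventually[OF assms(1-5) u] by eventually_elim (simp add: flow_diff)
  then show ?thesis
    by (rule locally_affine_atI[OF bounded_linear_flow])
qed

lemma chart_homeomorphic:
  assumes "open U" "inj_on cls U"
  shows "homeomorphic_map (subtopology qtop (cls ` U)) (top_of_set U) (inv_into U cls)"
proof -
  have top: "topspace (subtopology qtop (cls ` U)) = cls ` U"
    by (auto simp: topspace_qtop)
  have "homeomorphic_maps (subtopology qtop (cls ` U)) (top_of_set U) (inv_into U cls) cls"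
    unfolding homeomorphic_maps_def
  proof (intro conjI)
    show "continuous_map (subtopology qtop (cls ` U)) (top_of_set U) (inv_into U cls)"
      unfolding continuous_map_def top
    proof (intro conjI allI impI)
      show "inv_into U cls \<in> cls ` U \<rightarrow> topspace (top_of_set U)"
        by (auto intro: inv_into_into)
      fix W assume "openin (top_of_set U) W"
      then have W: "open W" "W \<subseteq> U" using \<open>open U\<close> openin_open_eq by blast+
      have "{x \<in> cls ` U. inv_into U cls x \<in> W} = cls ` W"
        using W(2) assms(2) by (auto simp: inv_into_f_f)
      then show "openin (subtopology qtop (cls ` U)) {x \<in> cls ` U. inv_into U cls x \<in> W}"
        using open_image_cls[OF W(1)] W(2)
        by (auto simp: openin_subtopology intro!: exI[of _ "cls ` W"])
    qed
    show "continuous_map (top_of_set U) (subtopology qtop (cls ` U)) cls"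
      using continuous_map_from_subtopology[OF continuous_map_cls]
      by (auto simp: continuous_map_in_subtopology)
  qed (use assms in \<open>auto simp: inv_into_f_f\<close>)
  then show ?thesis by (rule homeomorphic_maps_imp_map)
qed

lemma inj_on_cls_ball: "inj_on cls (ball x (1/2))"
  using dist_triangle_half_r[of x _ 1] by (intro inj_onI cls_inj_on_small) (auto simp: dist_commute)

lemma smooth_manifold_M: "smooth_manifold M"
  unfolding smooth_manifold_def
proof (intro conjI ballI)
  show "Hausdorff_space (mtop M)" "second_countable (mtop M)"
    using Hausdorff_qtop second_countable_qtop by (simp_all add: M_def)
  show "(\<Union>c\<in>charts M. fst c) = topspace (mtop M)"
  proof (intro equalityI subsetI)
    fix a assume "a \<in> topspace (mtop M)"
    then obtain x where "a = cls x" by (auto simp: M_def topspace_qtop)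
    moreover have "(cls ` ball x (1/2), inv_into (ball x (1/2)) cls) \<in> charts M"
      using inj_on_cls_ball[of x] by (auto simp: M_def)
    moreover have "cls x \<in> cls ` ball x (1/2)" by simp
    ultimately show "a \<in> (\<Union>c\<in>charts M. fst c)" by (metis UN_I fst_conv)
  next
    fix a assume "a \<in> (\<Union>c\<in>charts M. fst c)"
    then show "a \<in> topspace (mtop M)" by (auto simp: M_def topspace_qtop)
  qed
next
  fix c assume "c \<in> charts M"
  then obtain U where U: "open U" "inj_on cls U" "c = (cls ` U, inv_into U cls)"
    by (rule charts_ME)
  show "openin (mtop M) (fst c)" using U open_image_cls by (simp add: M_def)
  show "open (chart_img c)" using U chart_img_M by simp
  show "homeomorphic_map (subtopology (mtop M) (fst c)) (top_of_set (chart_img c)) (snd c)"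
    using chart_homeomorphic[OF U(1,2)] chart_img_M[OF U(2)] by (simp add: M_def U(3))
  fix d assume "d \<in> charts M"
  then obtain V where V: "open V" "inj_on cls V" "d = (cls ` V, inv_into V cls)"
    by (rule charts_ME)
  show "smooth_on (snd c ` (fst c \<inter> fst d)) (transition c d)"
  proof (rule locally_affine_smooth_on)
    fix x assume "x \<in> snd c ` (fst c \<inter> fst d)"
    then obtain a where "a \<in> cls ` U" "a \<in> cls ` V" "x = inv_into U cls a"
      using U V by auto
    then have "x \<in> U" "cls x \<in> cls ` V"
      by (simp_all add: f_inv_into_f inv_into_into)
    then show "locally_affine_at (transition c d) x" using transition_M U V by simp
  qed
qed

end

section \<open>Circles and tori by angles\<close>

lemma cis_eq_cis_iff: "cis a = cis b \<longleftrightarrow> (\<exists>m::int. a = b + 2 * pi * m)"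
  using sin_cos_eq_iff[of a b] by (auto simp: complex_eq_iff)

lemma cis_2pi_eq_iff: "cis (2 * pi * a) = cis (2 * pi * b) \<longleftrightarrow> a - b \<in> \<int>"
proof -
  have "cis (2 * pi * a) = cis (2 * pi * b) \<longleftrightarrow> (\<exists>m::int. 2 * pi * a = 2 * pi * (b + m))"
    unfolding cis_eq_cis_iff by (simp add: distrib_left)
  also have "\<dots> \<longleftrightarrow> (\<exists>m::int. a = b + m)"
    by (simp only: mult_cancel_left) simp
  also have "\<dots> \<longleftrightarrow> (\<exists>m::int. a - b = m)"
    by (simp add: algebra_simps)
  finally show ?thesis by (auto elim: Ints_cases)
qed

lemma inj_on_cis: "inj_on cis {a<..<a + 2 * pi}"
proof (rule inj_onI)
  fix x y assume xy: "x \<in> {a<..<a + 2 * pi}" "y \<in> {a<..<a + 2 * pi}" "cis x = cis y"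
  then obtain m :: int where m: "x = y + 2 * pi * m" by (auto simp: cis_eq_cis_iff)
  with xy have "\<bar>2 * pi * m\<bar> < 2 * pi * 1" by auto
  then have "\<bar>real_of_int m\<bar> < 1" by (simp add: abs_mult)
  then show "x = y" using m by simp
qed

lemma mtop_circle: "mtop circle = top_of_set (sphere 0 1)"
  by (simp add: circle_def)

lemma cis_Arg_unit: "norm z = 1 \<Longrightarrow> cis (Arg z) = z"
  using cis_Arg[of z] by (cases "z = 0") (simp_all add: sgn_div_norm)

lemma range_cis: "range cis = sphere 0 1"
proof (intro equalityI subsetI)
  fix z :: complex assume "z \<in> sphere 0 1"
  then have "z = cis (Arg z)" by (simp add: cis_Arg_unit)
  then show "z \<in> range cis" by blast
qed auto

lemma continuous_map_cis: "continuous_map euclidean (mtop circle) cis"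
  by (auto simp: mtop_circle continuous_map_in_subtopology intro!: continuous_intros)

text \<open>Near \<open>cis \<theta>\<close> the argument is recovered continuously from the principal branch of the logarithm of
  the quotient by \<open>cis \<theta>\<close>.\<close>

lemma open_image_cis:
  assumes "open S"
  shows "openin (mtop circle) (cis ` S)"
proof (subst openin_subopen, intro ballI)
  fix w assume "w \<in> cis ` S"
  then obtain \<theta> where \<theta>: "\<theta> \<in> S" "w = cis \<theta>" by auto
  let ?W = "(\<lambda>z. z / cis \<theta>) -` (- \<real>\<^sub>\<le>\<^sub>0)"
  let ?g = "\<lambda>z. \<theta> + Im (Ln (z / cis \<theta>))"
  have W: "open ?W"
    by (intro open_vimage) (auto intro!: continuous_intros)
  have "continuous_on ?W ?g"
    by (intro continuous_intros) auto
  then have "open (?W \<inter> ?g -` S)"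
    using W assms continuous_on_open_vimage by (metis Int_commute)
  moreover have "w \<in> ?W \<inter> ?g -` S"
    using \<theta> by simp
  moreover have "z \<in> cis ` S" if "z \<in> sphere 0 1" "z \<in> ?W \<inter> ?g -` S" for z
  proof -
    let ?u = "z / cis \<theta>"
    have u: "norm ?u = 1" using that by (simp add: norm_divide)
    then have "?u \<noteq> 0" by auto
    then have "cis (Im (Ln ?u)) = ?u"
      using u by (simp add: cis_Arg_unit flip: Arg_eq_Im_Ln)
    then have "z = cis (?g z)" by (simp add: cis_mult[symmetric])
    then show ?thesis using that by blast
  qed
  ultimately show "\<exists>T. openin (mtop circle) T \<and> w \<in> T \<and> T \<subseteq> cis ` S"
    using \<theta> by (intro exI[of _ "sphere 0 1 \<inter> (?W \<inter> ?g -` S)"])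
       (auto simp: mtop_circle openin_subtopology)
qed

definition angles :: "real ^ 'm \<Rightarrow> 'm::finite \<Rightarrow> complex" where
  "angles v = (\<lambda>i. cis (v $ i))"

lemma mtop_torus: "mtop torus = product_topology (\<lambda>_. mtop circle) UNIV"
  by (simp add: torus_def)

lemma topspace_torus: "topspace (mtop torus) = (UNIV \<rightarrow>\<^sub>E sphere 0 1)"
  by (simp add: mtop_torus mtop_circle)

lemma continuous_map_angles:
  "continuous_map (euclidean :: (real ^ 'm::finite) topology) (mtop torus) angles"
  unfolding mtop_torus
proof (subst continuous_map_componentwise_UNIV, intro allI)
  fix i :: 'm
  have "continuous_map euclidean (mtop circle) (cis \<circ> (\<lambda>v. v $ i))"
    by (rule continuous_map_compose[OF _ continuous_map_cis]) (auto intro!: continuous_intros)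
  then show "continuous_map euclidean (mtop circle) (\<lambda>v. angles v i)"
    by (simp add: angles_def o_def)
qed

lemma open_image_angles:
  assumes "open S"
  shows "openin (mtop torus) (angles ` S)"
proof (subst openin_subopen, intro ballI)
  fix w assume "w \<in> angles ` S"
  then obtain v where v: "v \<in> S" "w = angles v" by auto
  obtain A where A: "\<And>i. open (A i)" "\<And>i. v $ i \<in> A i" "\<And>u. (\<forall>i. u $ i \<in> A i) \<Longrightarrow> u \<in> S"
    using assms v(1) unfolding open_vec_def by metis
  have "openin (mtop torus) (\<Pi>\<^sub>E i\<in>UNIV. cis ` A i)"
    unfolding mtop_torus using A(1) open_image_cis by (simp add: openin_PiE)
  moreover have "w \<in> (\<Pi>\<^sub>E i\<in>UNIV. cis ` A i)"
    using A(2) v(2) by (auto simp: angles_def)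
  moreover have "(\<Pi>\<^sub>E i\<in>UNIV. cis ` A i) \<subseteq> angles ` S"
  proof
    fix z assume z: "z \<in> (\<Pi>\<^sub>E i\<in>UNIV. cis ` A i)"
    then have "\<forall>i. \<exists>x\<in>A i. z i = cis x" by (auto simp: PiE_iff)
    then obtain u where u: "\<And>i. u i \<in> A i" "\<And>i. z i = cis (u i)" by metis
    then have "z = angles (\<chi> i. u i)" by (auto simp: angles_def)
    moreover have "(\<chi> i. u i) \<in> S" using A(3) u by simp
    ultimately show "z \<in> angles ` S" by blast
  qed
  ultimately show "\<exists>T. openin (mtop torus) T \<and> w \<in> T \<and> T \<subseteq> angles ` S" by blast
qed

lemma range_angles: "range angles = topspace (mtop torus)"
proof (intro equalityI subsetI)
  fix z :: "'m::finite \<Rightarrow> complex" assume "z \<in> topspace (mtop torus)"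
  then have "z i \<in> range cis" for i by (simp add: topspace_torus PiE_iff range_cis)
  then have "\<forall>i. \<exists>x. z i = cis x" by blast
  then obtain u where "\<And>i. z i = cis (u i)" by metis
  then have "z = angles (\<chi> i. u i)" by (auto simp: angles_def)
  then show "z \<in> range angles" by blast
qed (auto simp: topspace_torus angles_def)

lemma open_image_map_prod:
  fixes f :: "'a::topological_space \<Rightarrow> 'c" and g :: "'b::topological_space \<Rightarrow> 'd"
  assumes "\<And>S. open S \<Longrightarrow> openin X (f ` S)" "\<And>S. open S \<Longrightarrow> openin Y (g ` S)" and "open S"
  shows "openin (prod_topology X Y) (map_prod f g ` S)"
proof (subst openin_subopen, intro ballI)
  fix w assume "w \<in> map_prod f g ` S"
  then obtain p where p: "p \<in> S" "w = map_prod f g p" by auto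
  obtain A B where AB: "open A" "open B" "p \<in> A \<times> B" "A \<times> B \<subseteq> S"
    using open_prod_elim[OF \<open>open S\<close> p(1)] .
  have "openin (prod_topology X Y) (f ` A \<times> g ` B)"
    using assms(1,2) AB by (simp add: openin_prod_Times_iff)
  moreover have "w \<in> f ` A \<times> g ` B" using p(2) AB(3) by auto
  moreover have "f ` A \<times> g ` B \<subseteq> map_prod f g ` S"
    using AB(4) by force
  ultimately show "\<exists>T. openin (prod_topology X Y) T \<and> w \<in> T \<and> T \<subseteq> map_prod f g ` S" by blast
qed

text \<open>Two quotient maps with the same fibres have homeomorphic targets: the induced maps are continuous
  because their composites with the quotient maps are.\<close>

lemma homeomorphic_maps_of_quotient_maps:
  assumes f: "quotient_map X A f" and g: "quotient_map X B g"
    and h: "\<And>x. x \<in> topspace X \<Longrightarrow> h (f x) = g x"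
    and h': "\<And>x. x \<in> topspace X \<Longrightarrow> h' (g x) = f x"
  shows "homeomorphic_maps A B h h'"
proof -
  have hf: "continuous_map X B (h \<circ> f)"
    using quotient_imp_continuous_map[OF g] h by (auto intro: continuous_map_eq)
  have hg: "continuous_map X A (h' \<circ> g)"
    using quotient_imp_continuous_map[OF f] h' by (auto intro: continuous_map_eq)
  have "topspace A = f ` topspace X" "topspace B = g ` topspace X"
    using f g quotient_imp_surjective_map by blast+
  then show ?thesis
    unfolding homeomorphic_maps_def
    using continuous_compose_quotient_map[OF f hf] continuous_compose_quotient_map[OF g hg] h h'
    by auto
qed

lemma locally_affine_into_circle_chart:
  assumes F: "locally_affine_at F y" and y: "cis (F y) \<in> cis ` {a<..<a + 2 * pi}"
  shows "locally_affine_at (\<lambda>z. inv_into {a<..<a + 2 * pi} cis (cis (F z))) y"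
proof -
  let ?I = "{a<..<a + 2 * pi}"
  obtain \<theta> where \<theta>: "\<theta> \<in> ?I" "cis (F y) = cis \<theta>" using y by auto
  let ?G = "\<lambda>z. F z + (\<theta> - F y)"
  have G: "locally_affine_at ?G y"
  proof -
    obtain A b where "bounded_linear A" "\<forall>\<^sub>F z in nhds y. F z = A z + b"
      using F by (auto simp: locally_affine_at_def)
    then show ?thesis
      by (intro locally_affine_atI[where A = A and b = "b + (\<theta> - F y)"])
         (auto elim: eventually_mono)
  qed
  have "\<forall>\<^sub>F z in nhds y. ?G z \<in> ?I"
    using locally_affine_at_tendsto[OF G] by (rule topological_tendstoD) (use \<theta> in auto)
  then have "\<forall>\<^sub>F z in nhds y. inv_into ?I cis (cis (F z)) = ?G z"
  proof eventually_elim
    case (elim z)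
    have "cis (?G z) = cis (F z)"
      using \<theta>(2) by (simp add: cis_mult[symmetric] cis_divide[symmetric])
    then show ?case using inv_into_f_f[OF inj_on_cis elim] by simp
  qed
  then show ?thesis by (rule locally_affine_at_cong[OF G])
qed

context golden_lattice
begin

text \<open>The bundle projection. The coordinate \<open>t\<close> of a representative is determined up to integers, so the
  choice is immaterial.\<close>

definition proj :: "(real ^ 'n) set \<Rightarrow> complex" where
  "proj a = cis (2 * pi * (SOME x. cls x = a) $ t)"

lemma proj_cls [simp]: "proj (cls x) = cis (2 * pi * x $ t)"
proof -
  have "cls (SOME u. cls u = cls x) = cls x"
    by (rule someI_ex[of "\<lambda>u. cls u = cls x"]) blast
  then show ?thesis
    unfolding proj_def cis_2pi_eq_iff cls_eq_iff using rel_sym rel_shift_Ints by blast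
qed

lemma continuous_map_proj: "continuous_map qtop (mtop circle) proj"
proof -
  have "continuous_map euclidean (mtop circle) (cis \<circ> (\<lambda>x. 2 * pi * x $ t))"
    by (rule continuous_map_compose[OF _ continuous_map_cis]) (auto intro!: continuous_intros)
  moreover have "cis \<circ> (\<lambda>x. 2 * pi * x $ t) = proj \<circ> cls" by auto
  ultimately show ?thesis
    using continuous_compose_quotient_map[OF quotient_map_cls] by simp
qed

end

section \<open>Fibration over the circle\<close>

lemma charts_circleE:
  assumes "c \<in> charts circle"
  obtains a where "c = (cis ` {a<..<a + 2 * pi}, inv_into {a<..<a + 2 * pi} cis)"
  using assms by (auto simp: circle_def)

lemma charts_torusE:
  assumes "d \<in> charts torus"
  obtains b where "d = (\<Pi>\<^sub>E i\<in>UNIV. cis ` {b i<..<b i + 2 * pi},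
      \<lambda>z. \<chi> i. inv_into {b i<..<b i + 2 * pi} cis (z i))"
proof -
  obtain c where c: "d = (Pi\<^sub>E UNIV (\<lambda>i. fst (c i)), \<lambda>z. \<chi> i. snd (c i) (z i))"
      "\<And>i. c i \<in> charts circle"
    using assms by (auto simp: torus_def)
  have "\<forall>i. \<exists>a. c i = (cis ` {a<..<a + 2 * pi}, inv_into {a<..<a + 2 * pi} cis)"
    using c(2) charts_circleE by metis
  then obtain b where "\<And>i. c i = (cis ` {b i<..<b i + 2 * pi}, inv_into {b i<..<b i + 2 * pi} cis)"
    by metis
  then show thesis using that[of b] c(1) by simp
qed

text \<open>The map \<open>e\<close> numbers the coordinates of the fibre.\<close>

locale golden_fibration = golden_lattice t r \<kappa> pr
  for t r :: "'n::finite" and \<kappa> pr +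
  fixes e :: "'m::finite \<Rightarrow> 'n"
  assumes bij_e: "bij_betw e UNIV (- {t})"
begin

definition strip :: "real \<Rightarrow> (real ^ 'n) set" where
  "strip a = {x. x $ t \<in> {a - 1/2<..<a + 1/2}}"

definition arc :: "real \<Rightarrow> complex set" where
  "arc a = cis ` {2 * pi * (a - 1/2)<..<2 * pi * (a + 1/2)}"

definition angle_coords :: "real ^ 'n \<Rightarrow> real \<times> (real ^ 'm)" where
  "angle_coords x = (2 * pi * x $ t, \<chi> i. 2 * pi * coord (e i) x)"

definition from_angles :: "real \<times> (real ^ 'm) \<Rightarrow> real ^ 'n" where
  "from_angles p =
     from_coords (\<chi> i. (if i = t then fst p else snd p $ inv_into UNIV e i) / (2 * pi))"

definition strip_angles :: "real ^ 'n \<Rightarrow> complex \<times> ('m \<Rightarrow> complex)" where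
  "strip_angles x = map_prod cis angles (angle_coords x)"

lemma linear_angle_coords: "linear angle_coords"
  by (rule linearI)
     (auto simp: angle_coords_def vec_eq_iff coord_add linear_scale[OF linear_coord] algebra_simps)

lemma linear_from_angles: "linear from_angles"
proof -
  have "linear (\<lambda>p. \<chi> i. (if i = t then fst p else snd p $ inv_into UNIV e i) / (2 * pi)
      :: real ^ 'n)"
    by (rule linearI) (auto simp: vec_eq_iff add_divide_distrib)
  then have "linear (from_coords \<circ>
      (\<lambda>p. \<chi> i. (if i = t then fst p else snd p $ inv_into UNIV e i) / (2 * pi)))"
    by (rule linear_compose[OF _ linear_from_coords])
  then show ?thesis by (simp add: from_angles_def[abs_def] o_def)
qed

lemma bounded_linear_angle_coords: "bounded_linear angle_coords"
  using linear_angle_coords linear_conv_bounded_linear by blast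

lemma bounded_linear_from_angles: "bounded_linear from_angles"
  using linear_from_angles linear_conv_bounded_linear by blast

lemma e_not_t [simp]: "e i \<noteq> t"
  using bij_e by (auto simp: bij_betw_def)

lemma inv_e [simp]: "inv_into UNIV e (e i) = i" "k \<noteq> t \<Longrightarrow> e (inv_into UNIV e k) = k"
  using bij_e by (auto simp: bij_betw_def inv_into_f_f f_inv_into_f)

lemma coord_from_angles: "coord (e i) (from_angles p) = snd p $ i / (2 * pi)"
  by (simp add: from_angles_def)

lemma from_angles_t: "from_angles p $ t = fst p / (2 * pi)"
proof -
  have "coord t (from_angles p) = fst p / (2 * pi)"
    unfolding from_angles_def coord_from_coords by simp
  then show ?thesis by simp
qed

lemma angle_coords_from_angles [simp]: "angle_coords (from_angles p) = p"
  by (simp add: angle_coords_def coord_from_angles from_angles_t prod_eq_iff vec_eq_iff)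

lemma from_angles_angle_coords [simp]: "from_angles (angle_coords x) = x"
proof (rule coord_eqI)
  fix i
  show "coord i (from_angles (angle_coords x)) = coord i x"
  proof (cases "i = t")
    case True
    then show ?thesis using from_angles_t[of "angle_coords x"] by (simp add: angle_coords_def)
  next
    case False
    then show ?thesis
      using coord_from_angles[of "inv_into UNIV e i" "angle_coords x"] by (simp add: angle_coords_def)
  qed
qed

text \<open>In a strip of width \<open>1\<close> no two points are related by a nontrivial shift of \<open>t\<close>; there the
  equivalence relation is congruence modulo the lattice, which the angles detect.\<close>

lemma cls_eq_iff_strip_angles_eq:
  assumes "x \<in> strip a" "y \<in> strip a"
  shows "cls x = cls y \<longleftrightarrow> strip_angles x = strip_angles y"
proof -
  have small: "y $ t = x $ t" if "y $ t - x $ t \<in> \<int>"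
  proof -
    from that obtain m :: int where m: "y $ t - x $ t = m" by (auto elim: Ints_cases)
    moreover have "\<bar>y $ t - x $ t\<bar> < 1" using assms unfolding strip_def by auto
    ultimately have "m = 0" by linarith
    then show ?thesis using m by simp
  qed
  have "strip_angles x = strip_angles y \<longleftrightarrow> x $ t - y $ t \<in> \<int> \<and> (\<forall>i. coord (e i) x - coord (e i) y \<in> \<int>)"
    by (simp add: strip_angles_def angle_coords_def angles_def fun_eq_iff cis_2pi_eq_iff)
  also have "\<dots> \<longleftrightarrow> y $ t - x $ t \<in> \<int> \<and> (\<forall>i. coord (e i) (y - x) \<in> \<int>)"
    by (metis Ints_minus coord_diff minus_diff_eq)
  also have "\<dots> \<longleftrightarrow> y $ t - x $ t \<in> \<int> \<and> (\<forall>i. coord i (y - x) \<in> \<int>)"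
    by (metis coord_t e_not_t inv_e(2) vector_minus_component)
  also have "\<dots> \<longleftrightarrow> rel x y"
    using small rel_shift_Ints[of x y] by (auto simp: rel_def)
  finally show ?thesis using cls_eq_iff by blast
qed

lemma open_strip: "open (strip a)"
  unfolding strip_def by (rule open_vimage[unfolded vimage_def]) (auto intro!: continuous_intros)

lemma cis_in_arc_iff:
  "cis \<theta> \<in> arc a \<longleftrightarrow> (\<exists>m::int. \<theta> + 2 * pi * m \<in> {2 * pi * (a - 1/2)<..<2 * pi * (a + 1/2)})"
proof
  assume "cis \<theta> \<in> arc a"
  then obtain \<phi> where \<phi>: "\<phi> \<in> {2 * pi * (a - 1/2)<..<2 * pi * (a + 1/2)}" "cis \<phi> = cis \<theta>"
    unfolding arc_def by force
  then obtain m :: int where "\<phi> = \<theta> + 2 * pi * m"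
    unfolding cis_eq_cis_iff by blast
  with \<phi>(1) show "\<exists>m::int. \<theta> + 2 * pi * m \<in> {2 * pi * (a - 1/2)<..<2 * pi * (a + 1/2)}" by blast
next
  assume "\<exists>m::int. \<theta> + 2 * pi * m \<in> {2 * pi * (a - 1/2)<..<2 * pi * (a + 1/2)}"
  then obtain m :: int where m: "\<theta> + 2 * pi * m \<in> {2 * pi * (a - 1/2)<..<2 * pi * (a + 1/2)}"
    by blast
  have "cis (\<theta> + 2 * pi * m) = cis \<theta>"
    unfolding cis_eq_cis_iff by blast
  then show "cis \<theta> \<in> arc a"
    unfolding arc_def using imageI[OF m, of cis] by simp
qed

lemma strip_iff: "x \<in> strip a \<longleftrightarrow> 2 * pi * x $ t \<in> {2 * pi * (a - 1/2)<..<2 * pi * (a + 1/2)}"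
  unfolding strip_def by (simp only: mem_Collect_eq greaterThanLessThan_iff mult_less_cancel_left_pos) simp

lemma proj_arc_eq: "topspace qtop \<inter> proj -` arc a = cls ` strip a"
proof (intro equalityI subsetI)
  fix y assume y: "y \<in> topspace qtop \<inter> proj -` arc a"
  then obtain x where x: "y = cls x" by (auto simp: topspace_qtop)
  with y obtain m :: int where m: "2 * pi * x $ t + 2 * pi * m \<in> {2 * pi * (a - 1/2)<..<2 * pi * (a + 1/2)}"
    by (auto simp: cis_in_arc_iff)
  \<comment> \<open>The power of the monodromy that moves \<open>x\<close> into the strip.\<close>
  define u where "u = flow m x + axis t (real_of_int m)"
  have ut: "u $ t = x $ t + m" by (simp add: u_def axis_def)
  have "coord i (axis t (real_of_int m)) \<in> \<int>" for i
  proof (cases "i = t")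
    case False
    then have "pr i \<noteq> t" using pr_fixed[OF \<kappa>_t] pr_pr by metis
    with False show ?thesis by (simp add: coord_def axis_def)
  qed (simp add: axis_def)
  then have "rel x u" by (simp add: rel_def ut) (simp add: u_def)
  moreover have "u \<in> strip a" unfolding strip_iff ut using m by (simp add: distrib_left)
  ultimately show "y \<in> cls ` strip a" using x cls_eq_iff by blast
next
  fix y assume "y \<in> cls ` strip a"
  then show "y \<in> topspace qtop \<inter> proj -` arc a"
    by (auto simp: topspace_qtop strip_iff arc_def)
qed

text \<open>Both the part of the manifold over an arc and the product of the arc with a torus are quotients of
  the strip with the same fibres. The two mutually inverse maps between them are therefore defined
  through representatives in the strip.\<close>

definition trivialization :: "real \<Rightarrow> (real ^ 'n) set \<Rightarrow> complex \<times> ('m \<Rightarrow> complex)" where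
  "trivialization a y = strip_angles (SOME x. x \<in> strip a \<and> cls x = y)"

definition trivialization_inv :: "real \<Rightarrow> complex \<times> ('m \<Rightarrow> complex) \<Rightarrow> (real ^ 'n) set" where
  "trivialization_inv a p = cls (SOME x. x \<in> strip a \<and> strip_angles x = p)"

lemma trivialization_cls: "x \<in> strip a \<Longrightarrow> trivialization a (cls x) = strip_angles x"
  unfolding trivialization_def using someI[of "\<lambda>u. u \<in> strip a \<and> cls u = cls x" x] cls_eq_iff_strip_angles_eq by blast

lemma trivialization_inv_strip_angles: "x \<in> strip a \<Longrightarrow> trivialization_inv a (strip_angles x) = cls x"
  unfolding trivialization_inv_def using someI[of "\<lambda>u. u \<in> strip a \<and> strip_angles u = strip_angles x" x] cls_eq_iff_strip_angles_eq by blast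

abbreviation over_arc :: "real \<Rightarrow> ((real ^ 'n) set, real ^ 'n) manifold" where
  "over_arc a \<equiv> open_submanifold M (cls ` strip a)"

abbreviation arc_torus :: "real \<Rightarrow> (complex \<times> ('m \<Rightarrow> complex), real \<times> (real ^ 'm)) manifold" where
  "arc_torus a \<equiv> prod_manifold (open_submanifold circle (arc a)) torus"

lemma mtop_over_arc: "mtop (over_arc a) = subtopology qtop (cls ` strip a)"
  by (simp add: open_submanifold_def M_def)

lemma mtop_arc_torus: "mtop (arc_torus a) =
    subtopology (prod_topology (mtop circle) (mtop torus)) (arc a \<times> topspace (mtop torus))"
  by (simp add: prod_manifold_def open_submanifold_def prod_topology_subtopology)

lemma quotient_map_strip_over_arc: "quotient_map (top_of_set (strip a)) (mtop (over_arc a)) cls"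
  unfolding mtop_over_arc
proof (rule continuous_open_imp_quotient_map)
  show "continuous_map (top_of_set (strip a)) (subtopology qtop (cls ` strip a)) cls"
    using continuous_map_from_subtopology[OF continuous_map_cls]
    by (auto simp: continuous_map_in_subtopology)
  show "open_map (top_of_set (strip a)) (subtopology qtop (cls ` strip a)) cls"
    unfolding open_map_def
  proof (intro allI impI)
    fix S assume "openin (top_of_set (strip a)) S"
    then have S: "open S" "S \<subseteq> strip a" using open_strip openin_open_eq by blast+
    then show "openin (subtopology qtop (cls ` strip a)) (cls ` S)"
      using open_image_cls by (auto simp: openin_subtopology intro!: exI[of _ "cls ` S"])
  qed
qed (auto simp: topspace_qtop)

lemma quotient_map_strip_arc_torus: "quotient_map (top_of_set (strip a)) (mtop (arc_torus a)) strip_angles"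
proof (rule continuous_open_imp_quotient_map)
  have "continuous_map euclidean (prod_topology (mtop circle) (mtop torus)) strip_angles"
  proof -
    have "continuous_map euclidean (mtop circle) (cis \<circ> (\<lambda>x. 2 * pi * x $ t))"
      by (rule continuous_map_compose[OF _ continuous_map_cis]) (auto intro!: continuous_intros)
    moreover have "continuous_map euclidean (mtop torus) (angles \<circ> (\<lambda>x. \<chi> i. 2 * pi * coord (e i) x))"
      by (rule continuous_map_compose[OF _ continuous_map_angles]) (auto intro!: continuous_intros)
    ultimately show ?thesis
      by (simp add: continuous_map_pairwise strip_angles_def[abs_def] angle_coords_def o_def)
  qed
  then show "continuous_map (top_of_set (strip a)) (mtop (arc_torus a)) strip_angles"
    unfolding mtop_arc_torus continuous_map_in_subtopology
    using range_angles
    by (auto simp: continuous_map_from_subtopology strip_angles_def angle_coords_def strip_iff arc_def)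
  show "open_map (top_of_set (strip a)) (mtop (arc_torus a)) strip_angles"
    unfolding open_map_def
  proof (intro allI impI)
    fix S assume "openin (top_of_set (strip a)) S"
    then have S: "open S" "S \<subseteq> strip a" using open_strip openin_open_eq by blast+
    have "angle_coords ` S = from_angles -` S"
      by (auto simp: image_iff) (metis angle_coords_from_angles)
    also have "open \<dots>"
      using S(1) bounded_linear_from_angles by (intro open_vimage linear_continuous_on)
    finally have "openin (prod_topology (mtop circle) (mtop torus)) (map_prod cis angles ` angle_coords ` S)"
      using open_image_cis open_image_angles by (intro open_image_map_prod)
    moreover have "map_prod cis angles ` angle_coords ` S = strip_angles ` S"
      by (simp add: strip_angles_def[abs_def] image_image)
    moreover have "strip_angles ` S \<subseteq> arc a \<times> topspace (mtop torus)"
      using S(2) range_angles by (auto simp: strip_angles_def angle_coords_def strip_iff arc_def)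
    ultimately show "openin (mtop (arc_torus a)) (strip_angles ` S)"
      unfolding mtop_arc_torus by (auto simp: openin_subtopology intro!: exI[of _ "strip_angles ` S"])
  qed
  show "strip_angles ` topspace (top_of_set (strip a)) = topspace (mtop (arc_torus a))"
  proof (intro equalityI subsetI)
    fix p assume "p \<in> topspace (mtop (arc_torus a))"
    then have "fst p \<in> arc a" "snd p \<in> range angles"
      unfolding mtop_arc_torus range_angles by auto
    then obtain \<theta> v where *: "\<theta> \<in> {2 * pi * (a - 1/2)<..<2 * pi * (a + 1/2)}" "p = (cis \<theta>, angles v)"
      by (auto simp: arc_def prod_eq_iff)
    then have "from_angles (\<theta>, v) \<in> strip a" by (simp add: strip_iff from_angles_t)
    moreover have "strip_angles (from_angles (\<theta>, v)) = p" using * by (simp add: strip_angles_def)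
    ultimately show "p \<in> strip_angles ` topspace (top_of_set (strip a))" by force
  next
    fix p assume "p \<in> strip_angles ` topspace (top_of_set (strip a))"
    then show "p \<in> topspace (mtop (arc_torus a))"
      unfolding mtop_arc_torus using range_angles range_cis
      by (auto simp: strip_angles_def angle_coords_def strip_iff arc_def mtop_circle)
  qed
qed

lemma homeomorphic_maps_trivialization: "homeomorphic_maps (mtop (over_arc a)) (mtop (arc_torus a)) (trivialization a) (trivialization_inv a)"
  by (rule homeomorphic_maps_of_quotient_maps[OF quotient_map_strip_over_arc quotient_map_strip_arc_torus])
     (auto simp: trivialization_cls trivialization_inv_strip_angles)

lemma charts_over_arcE:
  assumes "c \<in> charts (over_arc a)"
  obtains U where "open U" "inj_on cls U"
    "c = (cls ` U \<inter> cls ` strip a, inv_into U cls)"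
  using assms by (auto simp: open_submanifold_def M_def)

lemma chart_inv_over_arc:
  assumes "inj_on cls U" "x \<in> U" "cls x \<in> cls ` strip a"
  shows "chart_inv (cls ` U \<inter> cls ` strip a, inv_into U cls) x = cls x"
proof -
  have "cls ` U \<inter> cls ` strip a = cls ` (U \<inter> cls -` (cls ` strip a))" by auto
  then show ?thesis
    unfolding chart_inv_def using assms by (simp add: inv_into_inv_into)
qed

text \<open>The image of the chart \<open>angle_chart a a0 b\<close>, on which \<open>map_prod cis angles\<close> is its inverse.\<close>

definition angle_box :: "real \<Rightarrow> real \<Rightarrow> ('m \<Rightarrow> real) \<Rightarrow> (real \<times> (real ^ 'm)) set" where
  "angle_box a a0 b = {p. fst p \<in> {a0<..<a0 + 2 * pi} \<and> cis (fst p) \<in> arc a \<and>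
     (\<forall>i. snd p $ i \<in> {b i<..<b i + 2 * pi})}"

definition angle_chart ::
  "real \<Rightarrow> real \<Rightarrow> ('m \<Rightarrow> real) \<Rightarrow> (complex \<times> ('m \<Rightarrow> complex), real \<times> (real ^ 'm)) chart" where
  "angle_chart a a0 b =
     ((cis ` {a0<..<a0 + 2 * pi} \<inter> arc a) \<times> (\<Pi>\<^sub>E i\<in>UNIV. cis ` {b i<..<b i + 2 * pi}),
      map_prod (inv_into {a0<..<a0 + 2 * pi} cis)
        (\<lambda>z. \<chi> i. inv_into {b i<..<b i + 2 * pi} cis (z i)))"

lemma charts_arc_torusE:
  assumes "d \<in> charts (arc_torus a)"
  obtains a0 b where "d = angle_chart a a0 b"
proof -
  obtain c d' where "d = (fst c \<times> fst d', map_prod (snd c) (snd d'))"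
      and c: "c \<in> charts (open_submanifold circle (arc a))" and d': "d' \<in> charts torus"
    using assms by (auto simp: prod_manifold_def)
  moreover obtain c0 where "c0 \<in> charts circle" "c = (fst c0 \<inter> arc a, snd c0)"
    using c by (auto simp: open_submanifold_def)
  moreover obtain a0 where "c0 = (cis ` {a0<..<a0 + 2 * pi}, inv_into {a0<..<a0 + 2 * pi} cis)"
    using \<open>c0 \<in> charts circle\<close> by (rule charts_circleE)
  moreover obtain b where "d' = (\<Pi>\<^sub>E i\<in>UNIV. cis ` {b i<..<b i + 2 * pi},
      \<lambda>z. \<chi> i. inv_into {b i<..<b i + 2 * pi} cis (z i))"
    using d' by (rule charts_torusE)
  ultimately show thesis using that by (simp add: angle_chart_def)
qed

lemma angle_chart_box:
  assumes "p \<in> angle_box a a0 b"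
  shows "map_prod cis angles p \<in> fst (angle_chart a a0 b)"
    and "snd (angle_chart a a0 b) (map_prod cis angles p) = p"
proof -
  show "map_prod cis angles p \<in> fst (angle_chart a a0 b)"
    using assms by (cases p) (auto simp: angle_box_def angle_chart_def angles_def)
  show "snd (angle_chart a a0 b) (map_prod cis angles p) = p"
    using assms inv_into_f_f[OF inj_on_cis]
    by (cases p) (auto simp: angle_box_def angle_chart_def angles_def vec_eq_iff)
qed

lemma angle_chart_cover:
  assumes "q \<in> fst (angle_chart a a0 b)"
  obtains p where "p \<in> angle_box a a0 b" "q = map_prod cis angles p"
proof -
  obtain z w where q: "q = (z, w)" by (cases q)
  obtain \<theta> where \<theta>: "\<theta> \<in> {a0<..<a0 + 2 * pi}" "z = cis \<theta>" "z \<in> arc a"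
    using assms q by (auto simp: angle_chart_def)
  have "\<forall>i. \<exists>x\<in>{b i<..<b i + 2 * pi}. w i = cis x"
    using assms q by (auto simp: angle_chart_def PiE_iff)
  then obtain v where v: "\<And>i. v i \<in> {b i<..<b i + 2 * pi}" "\<And>i. w i = cis (v i)" by metis
  have "(\<theta>, \<chi> i. v i) \<in> angle_box a a0 b" using \<theta> v(1) by (simp add: angle_box_def)
  moreover have "q = map_prod cis angles (\<theta>, \<chi> i. v i)"
    using q \<theta>(2) v(2) by (auto simp: angles_def)
  ultimately show thesis by (rule that)
qed

lemma chart_inv_angle_chart:
  assumes "p \<in> angle_box a a0 b"
  shows "chart_inv (angle_chart a a0 b) p = map_prod cis angles p"
proof -
  have "inj_on (snd (angle_chart a a0 b)) (fst (angle_chart a a0 b))"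
    by (rule inj_onI) (metis angle_chart_cover angle_chart_box(2))
  then show ?thesis
    unfolding chart_inv_def using angle_chart_box[OF assms] inv_into_f_f by metis
qed

lemma open_angle_box: "open (angle_box a a0 b)"
proof -
  have "open (cis -` arc a)"
  proof -
    have "cis -` arc a = (\<Union>m::int. (\<lambda>\<theta>. \<theta> + 2 * pi * m) -` {2 * pi * (a - 1/2)<..<2 * pi * (a + 1/2)})"
      by (auto simp: cis_in_arc_iff)
    also have "open \<dots>"
      by (intro open_UN ballI open_vimage continuous_intros open_greaterThanLessThan)
    finally show ?thesis .
  qed
  moreover have "angle_box a a0 b = fst -` ({a0<..<a0 + 2 * pi} \<inter> cis -` arc a) \<inter>
      (\<Inter>i. (\<lambda>p. snd p $ i) -` {b i<..<b i + 2 * pi})"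
    by (auto simp: angle_box_def)
  ultimately show ?thesis
    by (auto intro!: open_Int open_INT open_vimage continuous_intros)
qed

lemma locally_affine_angle_chart:
  assumes F: "locally_affine_at F x" and x: "map_prod cis angles (F x) \<in> fst (angle_chart a a0 b)"
  shows "locally_affine_at (\<lambda>z. snd (angle_chart a a0 b) (map_prod cis angles (F z))) x"
proof -
  have 1: "locally_affine_at (\<lambda>z. fst (F z)) x"
    by (rule locally_affine_at_compose[OF F locally_affine_at_linear[OF bounded_linear_fst]])
  have 2: "locally_affine_at (\<lambda>z. snd (F z) $ i) x" for i
    by (rule locally_affine_at_compose[OF F locally_affine_at_linear])
       (rule bounded_linear_compose[OF bounded_linear_vec_nth bounded_linear_snd])
  have 3: "cis (fst (F x)) \<in> cis ` {a0<..<a0 + 2 * pi}"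
    "cis (snd (F x) $ i) \<in> cis ` {b i<..<b i + 2 * pi}" for i
    using x by (auto simp: angle_chart_def map_prod_def case_prod_unfold angles_def PiE_iff)
  have "locally_affine_at (\<lambda>z. (inv_into {a0<..<a0 + 2 * pi} cis (cis (fst (F z))),
      \<chi> i. inv_into {b i<..<b i + 2 * pi} cis (cis (snd (F z) $ i)))) x"
    by (intro locally_affine_at_Pair locally_affine_at_vec_lambda locally_affine_into_circle_chart 1 2 3)
  then show ?thesis
    by (simp add: angle_chart_def map_prod_def case_prod_unfold angles_def)
qed

lemma smooth_map_trivialization: "smooth_map (over_arc a) (arc_torus a) (trivialization a)"
  unfolding smooth_map_def
proof (intro conjI ballI)
  show "continuous_map (mtop (over_arc a)) (mtop (arc_torus a)) (trivialization a)"
    using homeomorphic_maps_trivialization by (auto simp: homeomorphic_maps_def)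
  fix c d assume c: "c \<in> charts (over_arc a)" and d: "d \<in> charts (arc_torus a)"
  obtain U where U: "open U" "inj_on cls U" "c = (cls ` U \<inter> cls ` strip a, inv_into U cls)"
    using c by (rule charts_over_arcE)
  obtain a0 b where d: "d = angle_chart a a0 b" using d by (rule charts_arc_torusE)
  show "smooth_on (snd c ` (fst c \<inter> trivialization a -` fst d)) (snd d \<circ> trivialization a \<circ> chart_inv c)"
  proof (rule locally_affine_smooth_on)
    fix x assume "x \<in> snd c ` (fst c \<inter> trivialization a -` fst d)"
    then obtain y where "y \<in> fst c" "trivialization a y \<in> fst d" "x = snd c y" by blast
    then have y: "y \<in> cls ` U" "y \<in> cls ` strip a" "trivialization a y \<in> fst d" "x = inv_into U cls y"
      using U(3) by simp_all
    then have x: "x \<in> U" "cls x = y" by (simp_all add: f_inv_into_f inv_into_into)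
    obtain s where s: "s \<in> strip a" "cls x = cls s" using y(2) x(2) by auto
    \<comment> \<open>The deck transformation that moves \<open>x\<close> into the strip.\<close>
    let ?G = "\<lambda>z. s + flow (s $ t - x $ t) (z - x)"
    have G: "locally_affine_at ?G x"
      by (rule locally_affine_atI[where A = "flow (s $ t - x $ t)" and b = "s - flow (s $ t - x $ t) x"])
         (simp_all add: flow_diff bounded_linear_flow)
    have Gx: "?G x = s" by (simp add: linear_0[OF linear_flow])
    have "\<forall>\<^sub>F z in nhds x. ?G z \<in> strip a"
      using locally_affine_at_tendsto[OF G]
      by (rule topological_tendstoD) (use open_strip Gx s(1) in simp_all)
    moreover have "\<forall>\<^sub>F z in nhds x. z \<in> U"
      using U(1) x(1) by (rule eventually_nhds_in_open)
    ultimately have eq: "\<forall>\<^sub>F z in nhds x. (snd d \<circ> trivialization a \<circ> chart_inv c) z =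
        snd (angle_chart a a0 b) (map_prod cis angles (angle_coords (?G z)))"
    proof eventually_elim
      case (elim z)
      have "cls z = cls (?G z)" using cls_translate[OF s(2)] by simp
      moreover have "cls z \<in> cls ` strip a" using elim(1) \<open>cls z = cls (?G z)\<close> by auto
      ultimately show ?case
        using elim U(2) d trivialization_cls[OF elim(1)] by (simp add: U(3) chart_inv_over_arc strip_angles_def)
    qed
    have "locally_affine_at (\<lambda>z. angle_coords (?G z)) x"
      by (rule locally_affine_at_compose[OF G locally_affine_at_linear[OF bounded_linear_angle_coords]])
    moreover have "map_prod cis angles (angle_coords (?G x)) \<in> fst (angle_chart a a0 b)"
      using y(3) x(2) s trivialization_cls[OF s(1)] d by (simp only: Gx strip_angles_def)
    ultimately show "locally_affine_at (snd d \<circ> trivialization a \<circ> chart_inv c) x"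
      using locally_affine_angle_chart eq by (intro locally_affine_at_cong[OF _ eq])
  qed
qed

lemma smooth_map_trivialization_inv: "smooth_map (arc_torus a) (over_arc a) (trivialization_inv a)"
  unfolding smooth_map_def
proof (intro conjI ballI)
  show "continuous_map (mtop (arc_torus a)) (mtop (over_arc a)) (trivialization_inv a)"
    using homeomorphic_maps_trivialization by (auto simp: homeomorphic_maps_def)
  fix c d assume d: "d \<in> charts (arc_torus a)" and c: "c \<in> charts (over_arc a)"
  obtain U where U: "open U" "inj_on cls U" "c = (cls ` U \<inter> cls ` strip a, inv_into U cls)"
    using c by (rule charts_over_arcE)
  obtain a0 b where d: "d = angle_chart a a0 b" using d by (rule charts_arc_torusE)
  show "smooth_on (snd d ` (fst d \<inter> trivialization_inv a -` fst c)) (snd c \<circ> trivialization_inv a \<circ> chart_inv d)"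
  proof (rule locally_affine_smooth_on)
    fix x assume "x \<in> snd d ` (fst d \<inter> trivialization_inv a -` fst c)"
    then obtain w where w: "w \<in> fst d" "trivialization_inv a w \<in> fst c" "x = snd d w" by auto
    obtain p where "p \<in> angle_box a a0 b" "w = map_prod cis angles p"
      using w(1) unfolding d by (rule angle_chart_cover)
    then have x: "x \<in> angle_box a a0 b" and wx: "w = map_prod cis angles x"
      using w(3) angle_chart_box(2) d by simp_all
    then obtain m :: int where m: "fst x + 2 * pi * m \<in> {2 * pi * (a - 1/2)<..<2 * pi * (a + 1/2)}"
      by (auto simp: angle_box_def cis_in_arc_iff)
    \<comment> \<open>Adjust the angle of the base by full turns such that the point lies in the strip.\<close>
    let ?S = "\<lambda>z :: real \<times> (real ^ 'm). z + (2 * pi * m, 0)"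
    let ?G = "\<lambda>z. from_angles (?S z)"
    have S: "locally_affine_at ?S x"
      by (rule locally_affine_atI[where A = "\<lambda>z. z"]) (auto simp: bounded_linear_ident)
    have G: "locally_affine_at ?G x"
      by (rule locally_affine_at_compose[OF S locally_affine_at_linear[OF bounded_linear_from_angles]])
    have Gx: "?G x \<in> strip a" using m by (simp add: strip_iff from_angles_t)
    have h: "trivialization_inv a (map_prod cis angles z) = cls (?G z)" if "?G z \<in> strip a" for z
    proof -
      have "cis (fst z + 2 * pi * m) = cis (fst z)" unfolding cis_eq_cis_iff by blast
      then have "strip_angles (?G z) = map_prod cis angles z"
        by (simp add: strip_angles_def map_prod_def case_prod_unfold)
      then show ?thesis using trivialization_inv_strip_angles[OF that] by simp
    qed
    have "\<forall>\<^sub>F z in nhds x. ?G z \<in> strip a"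
      using locally_affine_at_tendsto[OF G]
      by (rule topological_tendstoD) (use open_strip Gx in simp_all)
    moreover have "\<forall>\<^sub>F z in nhds x. z \<in> angle_box a a0 b"
      using open_angle_box x by (rule eventually_nhds_in_open)
    ultimately have eq: "\<forall>\<^sub>F z in nhds x. (snd c \<circ> trivialization_inv a \<circ> chart_inv d) z =
        inv_into U cls (cls (?G z))"
      by eventually_elim (simp add: d chart_inv_angle_chart h U(3))
    have "cls (?G x) \<in> cls ` U"
      using w(2) h[OF Gx] wx U(3) by simp
    then show "locally_affine_at (snd c \<circ> trivialization_inv a \<circ> chart_inv d) x"
      using locally_affine_into_chart[OF U(1,2) G] by (intro locally_affine_at_cong[OF _ eq])
  qed
qed

lemma smooth_map_proj: "smooth_map M circle proj"
  unfolding smooth_map_def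
proof (intro conjI ballI)
  show "continuous_map (mtop M) (mtop circle) proj"
    using continuous_map_proj by (simp add: M_def)
  fix c d assume c: "c \<in> charts M" and d: "d \<in> charts circle"
  obtain U where U: "open U" "inj_on cls U" "c = (cls ` U, inv_into U cls)"
    using c by (rule charts_ME)
  obtain a where d: "d = (cis ` {a<..<a + 2 * pi}, inv_into {a<..<a + 2 * pi} cis)"
    using d by (rule charts_circleE)
  show "smooth_on (snd c ` (fst c \<inter> proj -` fst d)) (snd d \<circ> proj \<circ> chart_inv c)"
  proof (rule locally_affine_smooth_on)
    fix x assume "x \<in> snd c ` (fst c \<inter> proj -` fst d)"
    then obtain y where y: "y \<in> cls ` U" "proj y \<in> cis ` {a<..<a + 2 * pi}" "x = inv_into U cls y"
      using U(3) d by auto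
    then have x: "x \<in> U" "cls x = y" by (simp_all add: f_inv_into_f inv_into_into)
    have "\<forall>\<^sub>F z in nhds x. z \<in> U"
      using U(1) x(1) by (rule eventually_nhds_in_open)
    then have eq: "\<forall>\<^sub>F z in nhds x. (snd d \<circ> proj \<circ> chart_inv c) z =
        inv_into {a<..<a + 2 * pi} cis (cis (2 * pi * z $ t))"
      by eventually_elim (simp add: U chart_inv_M d)
    have "proj y = cis (2 * pi * x $ t)" using x(2) proj_cls by blast
    have "locally_affine_at (\<lambda>z. 2 * pi * z $ t) x"
      by (rule locally_affine_at_linear)
         (rule bounded_linear_compose[OF bounded_linear_mult_right bounded_linear_vec_nth])
    moreover have "cis (2 * pi * x $ t) \<in> cis ` {a<..<a + 2 * pi}"
      using y(2) \<open>proj y = cis (2 * pi * x $ t)\<close> by simp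
    ultimately show "locally_affine_at (snd d \<circ> proj \<circ> chart_inv c) x"
      using locally_affine_into_circle_chart by (intro locally_affine_at_cong[OF _ eq])
  qed
qed

lemma smooth_bundle_M: "smooth_bundle M circle (torus :: ('m \<Rightarrow> complex, real ^ 'm) manifold) proj"
  unfolding smooth_bundle_def
proof (intro conjI ballI)
  show "smooth_map M circle proj" by (rule smooth_map_proj)
  fix b assume "b \<in> topspace (mtop circle)"
  then have "b \<in> range cis" by (simp add: mtop_circle range_cis)
  then obtain \<theta> where "b = cis \<theta>" by auto
  define a where "a = \<theta> / (2 * pi)"
  have b: "b = cis (2 * pi * a)" by (simp add: a_def \<open>b = cis \<theta>\<close>)
  have W: "topspace (mtop M) \<inter> proj -` arc a = cls ` strip a"
    using proj_arc_eq by (simp add: M_def)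
  show "\<exists>U. openin (mtop circle) U \<and> b \<in> U \<and>
      (\<exists>h. diffeomorphism (open_submanifold M (topspace (mtop M) \<inter> proj -` U))
             (prod_manifold (open_submanifold circle U)
               (torus :: ('m \<Rightarrow> complex, real ^ 'm) manifold)) h \<and>
           (\<forall>x\<in>topspace (mtop M) \<inter> proj -` U. fst (h x) = proj x))"
  proof (intro exI[of _ "arc a"] conjI exI[of _ "trivialization a"])
    show "openin (mtop circle) (arc a)" unfolding arc_def by (rule open_image_cis) simp
    show "b \<in> arc a" unfolding arc_def b by (rule imageI) (simp add: field_simps)
    show "diffeomorphism (open_submanifold M (topspace (mtop M) \<inter> proj -` arc a)) (arc_torus a) (trivialization a)"
      unfolding diffeomorphism_def W
      using homeomorphic_maps_trivialization smooth_map_trivialization smooth_map_trivialization_inv by blast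
    show "\<forall>x\<in>topspace (mtop M) \<inter> proj -` arc a. fst (trivialization a x) = proj x"
      unfolding W by (auto simp: trivialization_cls strip_angles_def angle_coords_def)
  qed
qed

lemma torus_bundle_M: "diffeomorphic_to_torus_bundle TYPE('m) M"
  unfolding diffeomorphic_to_torus_bundle_def
proof (intro exI conjI)
  show "smooth_manifold M" by (rule smooth_manifold_M)
  show "smooth_bundle M circle (torus :: ('m \<Rightarrow> complex, real ^ 'm) manifold) proj"
    by (rule smooth_bundle_M)
  have "smooth_map M M id"
    using smooth_manifold_M unfolding smooth_map_def smooth_manifold_def transition_def
    by (simp add: continuous_map_id)
  then show "diffeomorphism M M id"
    unfolding diffeomorphism_def homeomorphic_maps_def
    by (intro exI[of _ id]) (simp add: continuous_map_id)
qed

end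

section \<open>No open map from a torus\<close>

lemma continuous_Ints_valued_constant:
  fixes f :: "'a::real_normed_vector \<Rightarrow> real"
  assumes "continuous_on UNIV f" "\<And>x. f x \<in> \<int>"
  shows "f x = f y"
proof -
  have "f constant_on UNIV"
  proof (rule continuous_discrete_range_constant)
    fix x
    have "1 \<le> norm (f y - f x)" if "f y \<noteq> f x" for y
      using that assms(2)[of x] assms(2)[of y] by (auto elim!: Ints_cases)
    then show "\<exists>e>0. \<forall>y. y \<in> UNIV \<and> f y \<noteq> f x \<longrightarrow> e \<le> norm (f y - f x)"
      by (intro exI[of _ 1]) auto
  qed (use assms in auto)
  then show ?thesis by (auto simp: constant_on_def)
qed

text \<open>A continuous logarithm exists because the domain is contractible, and it is purely imaginary.\<close>

lemma continuous_angle_lift: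
  fixes f :: "real ^ 'k::finite \<Rightarrow> complex"
  assumes "continuous_on UNIV f" "\<And>x. norm (f x) = 1"
  obtains g where "continuous_on UNIV g" "\<And>x. f x = cis (2 * pi * g x)"
proof -
  have "f x \<noteq> 0" for x using assms(2)[of x] by auto
  then obtain g where g: "continuous_on UNIV g" "\<And>x. f x = exp (g x)"
    using continuous_logarithm_on_contractible[OF assms(1)] contractible_UNIV by auto
  have "Re (g x) = 0" for x using assms(2)[of x] by (simp add: g(2))
  then have "f x = cis (Im (g x))" for x
    unfolding g(2) by (subst exp_eq_polar) simp
  then have "f x = cis (2 * pi * (Im (g x) / (2 * pi)))" for x
    by simp
  moreover have "continuous_on UNIV (\<lambda>x. Im (g x) / (2 * pi))"
    using g(1) by (intro continuous_on_divide continuous_on_Im continuous_on_const) auto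
  ultimately show thesis using that by blast
qed

definition torus_periods :: "(real ^ 'k) set" where
  "torus_periods = {v. \<forall>i. v $ i / (2 * pi) \<in> \<int>}"

lemma angles_add_period: "v \<in> torus_periods \<Longrightarrow> angles (x + v) = angles x"
proof -
  assume "v \<in> torus_periods"
  then have "cis (2 * pi * ((x $ i + v $ i) / (2 * pi))) = cis (2 * pi * (x $ i / (2 * pi)))" for i
    unfolding cis_2pi_eq_iff by (simp add: torus_periods_def add_divide_distrib)
  then show ?thesis by (simp add: angles_def fun_eq_iff)
qed

text \<open>All values are attained on the compact cube of side \<open>2 \<pi>\<close>.\<close>

lemma periodic_attains_max:
  fixes u :: "real ^ 'k::finite \<Rightarrow> real"
  assumes "continuous_on UNIV u" and per: "\<And>x v. v \<in> torus_periods \<Longrightarrow> u (x + v) = u x"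
  obtains x where "\<And>y. u y \<le> u x"
proof -
  let ?C = "cbox 0 (\<chi> i. 2 * pi) :: (real ^ 'k) set"
  have "(0 :: real ^ 'k) \<in> ?C" by (simp add: mem_box_cart)
  then obtain x where x: "\<And>y. y \<in> ?C \<Longrightarrow> u y \<le> u x"
    using continuous_attains_sup[OF compact_cbox, of 0 "\<chi> i. 2 * pi" u]
      continuous_on_subset[OF assms(1) subset_UNIV] by blast
  have "u y \<le> u x" for y
  proof -
    \<comment> \<open>The period that moves \<open>y\<close> into the cube.\<close>
    define v where "v = (\<chi> i. 2 * pi * of_int (- \<lfloor>y $ i / (2 * pi)\<rfloor>))"
    have "v \<in> torus_periods" by (simp add: torus_periods_def v_def)
    moreover have "y + v \<in> ?C"
    proof -
      have "y $ i + v $ i = 2 * pi * frac (y $ i / (2 * pi))" for i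
        by (simp add: v_def frac_def field_simps)
      then show ?thesis
        by (simp add: mem_box_cart frac_ge_0 less_imp_le[OF frac_lt_1])
    qed
    ultimately show ?thesis using x per by metis
  qed
  then show thesis by (rule that)
qed

lemma covering_projection_imp_open_map:
  assumes "covering_projection X Y p"
  shows "open_map X Y p"
  unfolding open_map_def
proof (intro allI impI)
  fix S assume S: "openin X S"
  show "openin Y (p ` S)"
  proof (subst openin_subopen, intro ballI)
    fix y assume "y \<in> p ` S"
    then obtain x where x: "x \<in> S" "y = p x" by auto
    then have xX: "x \<in> topspace X" using S openin_subset by blast
    then have "y \<in> topspace Y" using assms x by (auto simp: covering_projection_def)
    then obtain T \<V> where T: "y \<in> T" "openin Y T" "\<Union>\<V> = topspace X \<inter> p -` T"
        "\<forall>V\<in>\<V>. openin X V"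
        "\<forall>V\<in>\<V>. homeomorphic_map (subtopology X V) (subtopology Y T) p"
      using assms unfolding covering_projection_def by metis
    then obtain V where V: "V \<in> \<V>" "x \<in> V" using xX x by (metis IntI UnionE vimageI)
    have "openin (subtopology X V) (S \<inter> V)"
      using S by (auto simp: openin_subtopology)
    then have "openin (subtopology Y T) (p ` (S \<inter> V))"
      using T(5) V(1) homeomorphic_imp_open_map by (metis open_map_def)
    then have "openin Y (p ` (S \<inter> V))"
      using T(2) by (rule openin_trans_full)
    then show "\<exists>T. openin Y T \<and> y \<in> T \<and> T \<subseteq> p ` S"
      using x V by blast
  qed
qed

context golden_lattice
begin

text \<open>Angles can be lifted to real functions on a contractible domain. First lift the angle of the
  bundle projection to a function \<open>\<tau>\<close>. Representatives with \<open>t = \<tau> x\<close> are then unique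
  modulo the lattice, so the angles of their lattice coordinates are well-defined continuous
  functions of \<open>x\<close>; they are lifted in the same way.\<close>

lemma lift_through_cls:
  fixes c :: "real ^ 'k::finite \<Rightarrow> (real ^ 'n) set"
  assumes c: "continuous_map euclidean qtop c"
  obtains F where "continuous_on UNIV F" "\<And>x. cls (F x) = c x"
proof -
  have "continuous_map euclidean (mtop circle) (proj \<circ> c)"
    using continuous_map_compose[OF c continuous_map_proj] .
  then have "continuous_on UNIV (proj \<circ> c)" "\<And>x. norm ((proj \<circ> c) x) = 1"
    by (auto simp: mtop_circle continuous_map_in_subtopology)
  from continuous_angle_lift[OF this] obtain \<tau>
    where \<tau>: "continuous_on UNIV \<tau>" "\<And>x. (proj \<circ> c) x = cis (2 * pi * \<tau> x)"
    by metis
  have \<tau>_Ints: "\<tau> x - u $ t \<in> \<int>" if "cls u = c x" for u x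
    using proj_cls[of u] \<tau>(2)[of x] that by (simp flip: cis_2pi_eq_iff)
  define w where "w i x = (let u = SOME u. cls u = c x in cis (2 * pi * coord i (flow (\<tau> x - u $ t) u)))"
    for i x
  have rep: "\<exists>u. cls u = c x" for x
  proof -
    have "c x \<in> topspace qtop" using c by (auto simp: continuous_map_def)
    then show ?thesis unfolding topspace_qtop by (metis rangeE)
  qed
  have w: "w i x = cis (2 * pi * coord i (flow (\<tau> x - u $ t) u))" if u: "cls u = c x" for i u x
  proof -
    define u' where "u' = (SOME u. cls u = c x)"
    have u': "cls u' = c x" unfolding u'_def using rep by (rule someI_ex)
    have "rel u' u" using u u' cls_eq_iff by metis
    then have "coord i (flow (\<tau> x - u $ t) (u - flow (u $ t - u' $ t) u')) \<in> \<int>"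
      using \<tau>_Ints[OF u] by (intro coord_flow_Ints) (auto simp: rel_def)
    then have "coord i (flow (\<tau> x - u $ t) u) - coord i (flow (\<tau> x - u' $ t) u') \<in> \<int>"
      by (simp add: flow_diff flow_flow coord_diff)
    then have "cis (2 * pi * coord i (flow (\<tau> x - u $ t) u)) =
        cis (2 * pi * coord i (flow (\<tau> x - u' $ t) u'))"
      unfolding cis_2pi_eq_iff .
    then show ?thesis by (simp add: w_def Let_def u'_def[symmetric])
  qed
  have "continuous_on UNIV (w i)" for i
  proof (rule continuous_at_imp_continuous_on, intro ballI)
    fix x0
    obtain u0 where u0: "cls u0 = c x0" using rep by blast
    let ?B = "ball u0 (1/2)"
    let ?N = "c -` cls ` ?B"
    let ?s = "\<lambda>x. inv_into ?B cls (c x)"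
    have N: "open ?N"
      using openin_continuous_map_preimage[OF c open_image_cls[OF open_ball]] by (simp add: vimage_def)
    have "continuous_map (top_of_set ?N) (subtopology qtop (cls ` ?B)) c"
      using continuous_map_from_subtopology[OF c] by (auto simp: continuous_map_in_subtopology)
    then have "continuous_map (top_of_set ?N) (top_of_set ?B) (inv_into ?B cls \<circ> c)"
      by (rule continuous_map_compose)
         (use chart_homeomorphic[OF open_ball inj_on_cls_ball] homeomorphic_imp_continuous_map in blast)
    then have s: "continuous_on ?N ?s"
      by (simp add: continuous_map_in_subtopology o_def)
    have "continuous_on ?N (\<lambda>x. cis (2 * pi * coord i (flow (\<tau> x - ?s x $ t) (?s x))))"
      using s continuous_on_subset[OF \<tau>(1) subset_UNIV] by (intro continuous_intros)
    then have "continuous_on ?N (w i)"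
    proof (rule continuous_on_eq)
      fix x assume "x \<in> ?N"
      then have "cls (?s x) = c x" by (auto simp: f_inv_into_f)
      then show "cis (2 * pi * coord i (flow (\<tau> x - ?s x $ t) (?s x))) = w i x"
        using w by simp
    qed
    moreover have "x0 \<in> ?N" using u0 by (auto intro!: image_eqI[of _ _ u0])
    ultimately show "isCont (w i) x0"
      using N continuous_on_eq_continuous_at by blast
  qed
  note w_cont = this
  have w_norm: "norm (w i x) = 1" for i x
  proof -
    obtain u where "cls u = c x" using rep by blast
    then show ?thesis using w by simp
  qed
  have "\<exists>g. continuous_on UNIV g \<and> (\<forall>x. w i x = cis (2 * pi * g x))" for i
    by (rule continuous_angle_lift[OF w_cont w_norm]) (intro exI conjI allI)
  then have "\<exists>y. \<forall>i. continuous_on UNIV (y i) \<and> (\<forall>x. w i x = cis (2 * pi * y i x))"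
    by (intro choice allI)
  then obtain y where y: "\<And>i. continuous_on UNIV (y i)" "\<And>i x. w i x = cis (2 * pi * y i x)"
    by blast
  define F where "F x = from_coords (\<chi> i. if i = t then \<tau> x else y i x)" for x
  have Ft: "F x $ t = \<tau> x" for x
    using coord_from_coords[of t "\<chi> i. if i = t then \<tau> x else y i x"] by (simp add: F_def[symmetric])
  have "continuous_on UNIV (\<lambda>x. \<chi> i. if i = t then \<tau> x else y i x)"
  proof (rule continuous_on_vec_lambda)
    fix i show "continuous_on UNIV (\<lambda>x. if i = t then \<tau> x else y i x)"
      using y(1) \<tau>(1) by (cases "i = t") auto
  qed
  then have "continuous_on UNIV F"
    unfolding F_def[abs_def] by (rule bounded_linear.continuous_on[OF bounded_linear_from_coords])
  moreover have "cls (F x) = c x" for x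
  proof -
    obtain u where u: "cls u = c x" using rep by blast
    have "coord i (F x - flow (\<tau> x - u $ t) u) \<in> \<int>" for i
    proof (cases "i = t")
      case True
      then show ?thesis using \<tau>_Ints[OF u] by (simp add: Ft)
    next
      case False
      then have "coord i (F x) = y i x" unfolding F_def coord_from_coords by simp
      then show ?thesis
        using w[OF u, of i] y(2)[of i x] by (simp add: coord_diff cis_2pi_eq_iff)
    qed
    then have "rel u (F x)" by (simp add: rel_def Ft)
    then show ?thesis using u cls_eq_iff by metis
  qed
  ultimately show thesis by (rule that)
qed

text \<open>The quotient map is injective on balls of radius \<open>1/2\<close>, so there the image of the lift coincides
  with the preimage of an open set.\<close>

lemma lift_of_open_map_open_range:
  fixes c :: "real ^ 'k::finite \<Rightarrow> (real ^ 'n) set"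
  assumes "open_map euclidean qtop c" "continuous_on UNIV F" "\<And>x. cls (F x) = c x"
  shows "open (range F)"
proof (subst open_subopen, intro ballI)
  fix z assume "z \<in> range F"
  then obtain x where x: "z = F x" by auto
  let ?B = "ball z (1/2)"
  let ?V = "F -` ?B"
  have V: "open ?V" using assms(2) by (intro open_vimage) auto
  have "open (cls -` (c ` ?V))"
    using assms(1) V by (auto simp: open_map_def openin_qtop)
  then have "open (?B \<inter> cls -` (c ` ?V))" by blast
  moreover have "z \<in> ?B \<inter> cls -` (c ` ?V)"
    using x assms(3) by (auto intro!: image_eqI[of _ _ x])
  moreover have "?B \<inter> cls -` (c ` ?V) \<subseteq> range F"
  proof
    fix a assume a: "a \<in> ?B \<inter> cls -` (c ` ?V)"
    then obtain y where y: "F y \<in> ?B" "cls a = cls (F y)" using assms(3) by auto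
    then have "a = F y" using inj_on_cls_ball[of z] a by (auto dest: inj_onD)
    then show "a \<in> range F" by blast
  qed
  ultimately show "\<exists>T. open T \<and> z \<in> T \<and> T \<subseteq> range F" by blast
qed

text \<open>The two lifts \<open>x \<mapsto> F (x + v)\<close> and \<open>F\<close> of the same map differ at each \<open>x\<close> by a deck transformation,
  whose parameters are integers depending continuously on \<open>x\<close>, hence constant.\<close>

lemma lift_period:
  fixes F :: "real ^ 'k::finite \<Rightarrow> real ^ 'n"
  assumes F: "continuous_on UNIV F" and v: "\<And>x. cls (F (x + v)) = cls (F x)"
  obtains b where "\<And>x. F (x + v) = flow (b $ t) (F x) + b"
proof -
  have Fv: "continuous_on UNIV (\<lambda>x. F (x + v))"
    by (rule continuous_on_compose2[OF F]) (auto intro!: continuous_intros)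
  have rel: "rel (F x) (F (x + v))" for x using v cls_eq_iff by metis
  define k where "k = F (0 + v) $ t - F 0 $ t"
  have k: "F (x + v) $ t - F x $ t = k" for x
    unfolding k_def
    by (rule continuous_Ints_valued_constant[of "\<lambda>x. F (x + v) $ t - F x $ t"])
       (use rel rel_shift_Ints in \<open>auto intro!: continuous_intros F Fv\<close>)
  define b where "b = F (0 + v) - flow k (F 0)"
  have b: "F (x + v) - flow k (F x) = b" for x
  proof (rule coord_eqI)
    fix i
    have "coord i (F (x + v) - flow k (F x)) \<in> \<int>" for x
      using rel[of x] unfolding rel_def k by blast
    then show "coord i (F (x + v) - flow k (F x)) = coord i b"
      unfolding b_def
      by (intro continuous_Ints_valued_constant[of "\<lambda>x. coord i (F (x + v) - flow k (F x))"])
         (auto intro!: continuous_intros F Fv)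
  qed
  have "b $ t = k" unfolding b_def using k[of 0] by simp
  then show thesis using that[of b] b by (metis diff_add_cancel add.commute)
qed

text \<open>A periodic function attains its maximum, but the image of \<open>F\<close> contains a ball around the point
  where it does, and \<open>H\<close> increases in the direction \<open>a\<close>.\<close>

lemma no_periodic_height:
  fixes F :: "real ^ 'k::finite \<Rightarrow> real ^ 'n"
  assumes F: "continuous_on UNIV F" "open (range F)" and H: "continuous_on UNIV H"
    and inc: "\<And>z s. s > 0 \<Longrightarrow> H (z + s *\<^sub>R axis a 1) > (H z :: real)"
    and per: "\<And>x v. v \<in> torus_periods \<Longrightarrow> H (F (x + v)) = H (F x)"
  shows False
proof -
  have "continuous_on UNIV (\<lambda>x. H (F x))"
    by (rule continuous_on_compose2[OF H F(1)]) auto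
  then obtain x where x: "\<And>y. H (F y) \<le> H (F x)"
    using periodic_attains_max[of "\<lambda>x. H (F x)"] per by blast
  obtain \<epsilon> where \<epsilon>: "\<epsilon> > 0" "ball (F x) \<epsilon> \<subseteq> range F"
    using F(2) open_contains_ball by blast
  have "F x + (\<epsilon> / 2) *\<^sub>R axis a 1 \<in> ball (F x) \<epsilon>"
    using \<epsilon>(1) by (simp add: dist_norm)
  then obtain y where "F y = F x + (\<epsilon> / 2) *\<^sub>R axis a 1" using \<epsilon>(2) by (metis image_iff subsetD)
  then show False using x[of y] inc[of "\<epsilon> / 2" "F x"] \<epsilon>(1) by simp
qed

text \<open>Only the action of the deck transformations on the coordinates \<open>t\<close> and \<open>a\<close> matters. They are
  affine in \<open>a\<close>, and one that shifts \<open>t\<close> has a unique fixed value \<open>c\<close> of the coordinate \<open>a\<close>,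
  because its linear part \<open>q\<close> differs from \<open>1\<close>. The deck transformations of the periods commute,
  so all of them fix \<open>c\<close>, and the multiplication of \<open>w\<^sub>a - c\<close> by \<open>q\<close> is compensated by the shift of
  \<open>t\<close> in the exponential factor.\<close>

lemma no_open_map_from_torus:
  assumes a: "\<kappa> a \<noteq> 0"
    and p: "continuous_map (mtop (torus :: ('k::finite \<Rightarrow> complex, real ^ 'k) manifold)) qtop p"
    and p_open: "open_map (mtop (torus :: ('k \<Rightarrow> complex, real ^ 'k) manifold)) qtop p"
  shows False
proof -
  let ?c = "p \<circ> (angles :: real ^ 'k \<Rightarrow> _)"
  have "continuous_map euclidean qtop ?c"
    using continuous_map_compose[OF continuous_map_angles p] .
  then obtain F where F: "continuous_on UNIV F" "\<And>x. cls (F x) = ?c x"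
    using lift_through_cls by blast
  have "open_map euclidean (mtop torus) (angles :: real ^ 'k \<Rightarrow> _)"
    by (auto simp: open_map_def intro: open_image_angles)
  then have "open_map euclidean qtop ?c" using p_open by (rule open_map_compose)
  then have openF: "open (range F)" using lift_of_open_map_open_range F by blast
  have "\<exists>b. \<forall>x. F (x + v) = flow (b $ t) (F x) + b" if "v \<in> torus_periods" for v
    using lift_period[OF F(1), of v] F(2) angles_add_period[OF that] by (metis comp_apply)
  then obtain b where b: "\<And>v x. v \<in> torus_periods \<Longrightarrow> F (x + v) = flow (b v $ t) (F x) + b v"
    by metis
  show False
  proof (cases "\<forall>v\<in>torus_periods. b v $ t = 0")
    case True
    show False
      by (rule no_periodic_height[OF F(1) openF, of "\<lambda>z. z $ t" t])
         (use True b in \<open>auto intro!: continuous_intros simp: axis_def\<close>)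
  next
    case False
    then obtain v0 where v0: "v0 \<in> torus_periods" "b v0 $ t \<noteq> 0" by blast
    define q where "q v = exp (- (b v $ t * \<mu> * \<kappa> a))" for v
    have Fa: "F (x + v) $ a = q v * F x $ a + b v $ a" if "v \<in> torus_periods" for v x
      by (simp add: b[OF that] flow_def q_def)
    have q0: "q v0 \<noteq> 1" using v0(2) a \<mu>_pos by (simp add: q_def)
    \<comment> \<open>The fixed value of \<open>w \<mapsto> q v0 * w + b v0 $ a\<close>.\<close>
    define c where "c = b v0 $ a / (1 - q v0)"
    have bc: "b v $ a = c * (1 - q v)" if v: "v \<in> torus_periods" for v
    proof -
      \<comment> \<open>The periods \<open>v\<close> and \<open>v0\<close> commute; compare their effects on \<open>F 0\<close> in both orders.\<close>
      have "q v0 * (q v * F 0 $ a + b v $ a) + b v0 $ a = F ((0 + v) + v0) $ a"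
        unfolding Fa[OF v0(1)] Fa[OF v] ..
      also have "(0 + v) + v0 = (0 + v0) + v" by simp
      also have "F ((0 + v0) + v) $ a = q v * (q v0 * F 0 $ a + b v0 $ a) + b v $ a"
        unfolding Fa[OF v0(1)] Fa[OF v] ..
      finally have "b v $ a * (1 - q v0) = b v0 $ a * (1 - q v)" by (simp add: algebra_simps)
      then show ?thesis using q0 by (simp add: c_def field_simps)
    qed
    let ?H = "\<lambda>z :: real ^ 'n. (z $ a - c) * exp (\<mu> * \<kappa> a * z $ t)"
    have "a \<noteq> t" using a \<kappa>_t by auto
    show False
    proof (rule no_periodic_height[OF F(1) openF, of ?H a])
      fix z :: "real ^ 'n" and s :: real assume "s > 0"
      then show "?H (z + s *\<^sub>R axis a 1) > ?H z"
        using \<open>a \<noteq> t\<close> by (simp add: axis_def)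
    next
      fix x v :: "real ^ 'k" assume v: "v \<in> torus_periods"
      have "F (x + v) $ t = F x $ t + b v $ t" by (simp add: b[OF v])
      then have "exp (\<mu> * \<kappa> a * F (x + v) $ t) = exp (\<mu> * \<kappa> a * F x $ t) / q v"
        by (simp add: q_def exp_minus exp_add algebra_simps divide_inverse)
      moreover have "F (x + v) $ a - c = q v * (F x $ a - c)"
        unfolding Fa[OF v] bc[OF v] by (simp add: algebra_simps)
      moreover have "q v \<noteq> 0" by (simp add: q_def)
      ultimately show "?H (F (x + v)) = ?H (F x)" by simp
    qed (intro continuous_intros)
  qed
qed

end

section \<open>Profile functions\<close>

text \<open>The profile \<open>\<psi>\<close> has period \<open>1\<close>, the period of the monodromy, and \<open>\<sigma> = \<mu>\<^sup>2 - \<psi>''/\<psi>\<close> is the square of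
  the conformal factor. The constant \<open>offset\<close> is large enough to make \<open>\<psi>\<close> and \<open>\<sigma>\<close> positive;
  \<open>\<sigma>1\<close> and \<open>\<sigma>2\<close> are the first two derivatives of \<open>\<sigma>\<close>, \<open>\<alpha>\<close> is half the logarithmic derivative of
  \<open>\<surd>\<sigma>\<close>, and \<open>\<alpha>1\<close> is the derivative of \<open>\<alpha>\<close>.\<close>

definition \<omega> :: real where "\<omega> = 2 * pi"

definition offset :: real where "offset = 2 + \<omega>\<^sup>2 / \<mu>\<^sup>2"

definition \<psi> :: "real \<Rightarrow> real" where
  "\<psi> s = offset + cos (\<omega> * s)"

definition \<sigma> :: "real \<Rightarrow> real" where
  "\<sigma> s = \<mu>\<^sup>2 + \<omega>\<^sup>2 * cos (\<omega> * s) / \<psi> s"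

definition \<sigma>1 :: "real \<Rightarrow> real" where
  "\<sigma>1 s = - (\<omega> ^ 3 * offset) * sin (\<omega> * s) / (\<psi> s)\<^sup>2"

definition \<sigma>2 :: "real \<Rightarrow> real" where
  "\<sigma>2 s = - (\<omega> ^ 4 * offset) * (cos (\<omega> * s) * \<psi> s + 2 * (sin (\<omega> * s))\<^sup>2) / (\<psi> s) ^ 3"

definition \<alpha> :: "real \<Rightarrow> real" where
  "\<alpha> s = \<sigma>1 s / (4 * \<sigma> s)"

definition \<alpha>1 :: "real \<Rightarrow> real" where
  "\<alpha>1 s = (\<sigma>2 s * \<sigma> s - (\<sigma>1 s)\<^sup>2) / (4 * (\<sigma> s)\<^sup>2)"

lemma \<omega>_pos: "\<omega> > 0" by (simp add: \<omega>_def)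

lemma offset_gt: "offset > 1 + \<omega>\<^sup>2 / \<mu>\<^sup>2" "offset > 1"
  by (simp_all add: offset_def add_pos_nonneg)

lemma \<psi>_pos: "\<psi> s > \<omega>\<^sup>2 / \<mu>\<^sup>2" "\<psi> s > 0"
proof -
  show 1: "\<psi> s > \<omega>\<^sup>2 / \<mu>\<^sup>2" using offset_gt(1) cos_ge_minus_one[of "\<omega> * s"] unfolding \<psi>_def by linarith
  show "\<psi> s > 0" by (rule le_less_trans[OF _ 1]) simp
qed

lemma \<sigma>_pos: "\<sigma> s > 0"
proof -
  have "\<omega>\<^sup>2 < \<mu>\<^sup>2 * \<psi> s" using \<psi>_pos(1)[of s] \<mu>_pos by (simp add: field_simps)
  moreover have "\<omega>\<^sup>2 * (- 1) \<le> \<omega>\<^sup>2 * cos (\<omega> * s)" by (intro mult_left_mono) auto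
  ultimately have "0 < \<mu>\<^sup>2 * \<psi> s + \<omega>\<^sup>2 * cos (\<omega> * s)" by linarith
  then have "0 < (\<mu>\<^sup>2 * \<psi> s + \<omega>\<^sup>2 * cos (\<omega> * s)) / \<psi> s" using \<psi>_pos(2) by simp
  also have "\<dots> = \<sigma> s" using \<psi>_pos(2)[of s] by (simp add: \<sigma>_def field_simps)
  finally show ?thesis .
qed

lemma \<psi>_deriv: "(\<psi> has_real_derivative - (\<omega> * sin (\<omega> * s))) (at s)"
  unfolding \<psi>_def[abs_def] by (auto intro!: derivative_eq_intros)

lemma \<sigma>_deriv: "(\<sigma> has_real_derivative \<sigma>1 s) (at s)"
proof -
  have "(\<sigma> has_real_derivative (\<omega>\<^sup>2 * (- (\<omega> * sin (\<omega> * s))) * \<psi> s - \<omega>\<^sup>2 * cos (\<omega> * s) * (- (\<omega> * sin (\<omega> * s))))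
      / (\<psi> s * \<psi> s)) (at s)"
    unfolding \<sigma>_def[abs_def] using \<psi>_pos(2)[of s]
    by (auto intro!: derivative_eq_intros \<psi>_deriv)
  also have "\<omega>\<^sup>2 * (- (\<omega> * sin (\<omega> * s))) * \<psi> s - \<omega>\<^sup>2 * cos (\<omega> * s) * (- (\<omega> * sin (\<omega> * s)))
      = - (\<omega> ^ 3 * offset) * sin (\<omega> * s)"
    by (simp add: \<psi>_def power2_eq_square power3_eq_cube algebra_simps)
  finally show ?thesis by (simp add: \<sigma>1_def power2_eq_square)
qed

lemma \<sigma>1_deriv: "(\<sigma>1 has_real_derivative \<sigma>2 s) (at s)"
proof -
  have 1: "((\<lambda>s. - (\<omega> ^ 3 * offset) * sin (\<omega> * s)) has_real_derivative
      - (\<omega> ^ 3 * offset) * (cos (\<omega> * s) * \<omega>)) (at s)"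
    by (auto intro!: derivative_eq_intros)
  have 2: "((\<lambda>s. (\<psi> s)\<^sup>2) has_real_derivative 2 * \<psi> s * (- (\<omega> * sin (\<omega> * s)))) (at s)"
    by (auto intro!: derivative_eq_intros \<psi>_deriv)
  show ?thesis
    unfolding \<sigma>1_def[abs_def]
    by (rule DERIV_cong[OF DERIV_divide[OF 1 2]])
       (use \<psi>_pos(2)[of s] in \<open>simp_all add: \<sigma>2_def field_simps eval_nat_numeral\<close>)
qed

lemma \<alpha>_deriv: "(\<alpha> has_real_derivative \<alpha>1 s) (at s)"
  unfolding \<alpha>_def[abs_def] \<alpha>1_def using \<sigma>_pos[of s]
  by (auto intro!: derivative_eq_intros \<sigma>_deriv \<sigma>1_deriv simp: power2_eq_square field_simps)

lemma periodic:
  assumes "k \<in> \<int>"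
  shows "\<psi> (s + k) = \<psi> s" "\<sigma> (s + k) = \<sigma> s"
proof -
  obtain m :: int where "k = m" using assms by (auto elim: Ints_cases)
  then have "cis (\<omega> * (s + k)) = cis (\<omega> * s)"
    unfolding cis_eq_cis_iff \<omega>_def by (auto simp: algebra_simps intro!: exI[of _ m])
  then have "cos (\<omega> * (s + k)) = cos (\<omega> * s)" by (metis cis.simps(1))
  then show "\<psi> (s + k) = \<psi> s" "\<sigma> (s + k) = \<sigma> s" by (simp_all add: \<psi>_def \<sigma>_def)
qed

text \<open>A differential algebra that contains all coefficients of the metric and of its curvature. Membership
  in it gives smoothness, and the existence of the derivatives of the tidal coefficients.\<close>

inductive_set wave_functions :: "(real \<Rightarrow> real) set" where
  const: "(\<lambda>_. a) \<in> wave_functions"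
| sin: "(\<lambda>s. sin (\<omega> * s)) \<in> wave_functions"
| cos: "(\<lambda>s. cos (\<omega> * s)) \<in> wave_functions"
| exp: "(\<lambda>s. exp (a * s)) \<in> wave_functions"
| inverse_\<psi>: "(\<lambda>s. inverse (\<psi> s)) \<in> wave_functions"
| sqrt_\<sigma>: "(\<lambda>s. sqrt (\<sigma> s)) \<in> wave_functions"
| inverse_sqrt_\<sigma>: "(\<lambda>s. inverse (sqrt (\<sigma> s))) \<in> wave_functions"
| add: "f \<in> wave_functions \<Longrightarrow> g \<in> wave_functions \<Longrightarrow> (\<lambda>s. f s + g s) \<in> wave_functions"
| mult: "f \<in> wave_functions \<Longrightarrow> g \<in> wave_functions \<Longrightarrow> (\<lambda>s. f s * g s) \<in> wave_functions"

lemma wave_diff: "f \<in> wave_functions \<Longrightarrow> g \<in> wave_functions \<Longrightarrow> (\<lambda>s. f s - g s) \<in> wave_functions"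
  using wave_functions.add[OF _ wave_functions.mult[OF wave_functions.const[of "-1"]], of f g] by simp

lemma wave_power: "f \<in> wave_functions \<Longrightarrow> (\<lambda>s. f s ^ n) \<in> wave_functions"
  by (induction n) (auto intro: wave_functions.const wave_functions.mult)

lemma wave_\<psi>: "\<psi> \<in> wave_functions"
  unfolding \<psi>_def[abs_def] by (intro wave_functions.intros)

lemma wave_\<sigma>: "\<sigma> \<in> wave_functions" "\<sigma>1 \<in> wave_functions" "\<sigma>2 \<in> wave_functions"
  unfolding \<sigma>_def[abs_def] \<sigma>1_def[abs_def] \<sigma>2_def[abs_def] divide_inverse power_inverse[symmetric]
  by (intro wave_functions.intros wave_power wave_\<psi>)+

lemma wave_inverse_\<sigma>: "(\<lambda>s. inverse (\<sigma> s)) \<in> wave_functions"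
proof -
  have "(\<lambda>s. inverse (sqrt (\<sigma> s)) * inverse (sqrt (\<sigma> s))) \<in> wave_functions"
    by (intro wave_functions.intros)
  then show ?thesis
    using \<sigma>_pos by (simp add: less_imp_le flip: inverse_mult_distrib)
qed

lemma wave_\<alpha>: "\<alpha> \<in> wave_functions" "\<alpha>1 \<in> wave_functions"
  unfolding \<alpha>_def[abs_def] \<alpha>1_def[abs_def] divide_inverse power_inverse[symmetric] inverse_mult_distrib
  by (intro wave_functions.mult wave_diff wave_power wave_\<sigma> wave_functions.const wave_inverse_\<sigma>)+

lemma sqrt_\<sigma>_deriv: "((\<lambda>s. sqrt (\<sigma> s)) has_real_derivative \<sigma>1 s * (1/2) * inverse (sqrt (\<sigma> s))) (at s)"
  by (rule DERIV_cong[OF DERIV_chain2[OF DERIV_real_sqrt[OF \<sigma>_pos] \<sigma>_deriv]]) simp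

lemma wave_functions_deriv:
  assumes "f \<in> wave_functions"
  shows "\<exists>f'\<in>wave_functions. \<forall>s. (f has_real_derivative f' s) (at s)"
  using assms
proof induction
  case (const a)
  show ?case by (intro bexI[of _ "\<lambda>_. 0"] wave_functions.const) auto
next
  case sin
  show ?case
  proof (rule bexI)
    show "\<forall>s. ((\<lambda>s. sin (\<omega> * s)) has_real_derivative \<omega> * cos (\<omega> * s)) (at s)"
      by (auto intro!: derivative_eq_intros)
    show "(\<lambda>s. \<omega> * cos (\<omega> * s)) \<in> wave_functions"
      by (intro wave_functions.intros)
  qed
next
  case cos
  show ?case
  proof (rule bexI)
    show "\<forall>s. ((\<lambda>s. cos (\<omega> * s)) has_real_derivative - \<omega> * sin (\<omega> * s)) (at s)"
      by (auto intro!: derivative_eq_intros)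
    show "(\<lambda>s. - \<omega> * sin (\<omega> * s)) \<in> wave_functions"
      by (intro wave_functions.intros)
  qed
next
  case (exp a)
  show ?case
  proof (rule bexI)
    show "\<forall>s. ((\<lambda>s. exp (a * s)) has_real_derivative a * exp (a * s)) (at s)"
      by (auto intro!: derivative_eq_intros)
    show "(\<lambda>s. a * exp (a * s)) \<in> wave_functions"
      by (intro wave_functions.intros)
  qed
next
  case inverse_\<psi>
  show ?case
  proof (rule bexI)
    show "\<forall>s. ((\<lambda>s. inverse (\<psi> s)) has_real_derivative \<omega> * sin (\<omega> * s) * (inverse (\<psi> s) * inverse (\<psi> s))) (at s)"
      proof
      fix s
      have "\<psi> s \<noteq> 0" using \<psi>_pos(2)[of s] by simp
      then show "((\<lambda>s. inverse (\<psi> s)) has_real_derivative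
          \<omega> * sin (\<omega> * s) * (inverse (\<psi> s) * inverse (\<psi> s))) (at s)"
        by (rule DERIV_cong[OF DERIV_inverse'[OF \<psi>_deriv]]) simp
    qed
    show "(\<lambda>s. \<omega> * sin (\<omega> * s) * (inverse (\<psi> s) * inverse (\<psi> s))) \<in> wave_functions"
      by (intro wave_functions.intros)
  qed
next
  case sqrt_\<sigma>
  show ?case
  proof (rule bexI)
    show "\<forall>s. ((\<lambda>s. sqrt (\<sigma> s)) has_real_derivative \<sigma>1 s * (1/2) * inverse (sqrt (\<sigma> s))) (at s)"
      using sqrt_\<sigma>_deriv by simp
    show "(\<lambda>s. \<sigma>1 s * (1/2) * inverse (sqrt (\<sigma> s))) \<in> wave_functions"
      by (intro wave_functions.intros wave_\<sigma>)
  qed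
next
  case inverse_sqrt_\<sigma>
  show ?case
  proof (rule bexI)
    show "\<forall>s. ((\<lambda>s. inverse (sqrt (\<sigma> s))) has_real_derivative (- 1) * (\<sigma>1 s * (1/2) * inverse (sqrt (\<sigma> s))) * (inverse (sqrt (\<sigma> s)) * inverse (sqrt (\<sigma> s)))) (at s)"
      proof
      fix s
      have "sqrt (\<sigma> s) \<noteq> 0" using \<sigma>_pos[of s] by simp
      then show "((\<lambda>s. inverse (sqrt (\<sigma> s))) has_real_derivative
          (- 1) * (\<sigma>1 s * (1/2) * inverse (sqrt (\<sigma> s))) * (inverse (sqrt (\<sigma> s)) * inverse (sqrt (\<sigma> s)))) (at s)"
        by (rule DERIV_cong[OF DERIV_inverse'[OF sqrt_\<sigma>_deriv]]) (simp add: mult_ac)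
    qed
    show "(\<lambda>s. (- 1) * (\<sigma>1 s * (1/2) * inverse (sqrt (\<sigma> s))) * (inverse (sqrt (\<sigma> s)) * inverse (sqrt (\<sigma> s)))) \<in> wave_functions"
      by (intro wave_functions.intros wave_\<sigma>)
  qed
next
  case (add f g)
  then obtain f' g' where "f' \<in> wave_functions" "g' \<in> wave_functions"
    "\<forall>s. (f has_real_derivative f' s) (at s)" "\<forall>s. (g has_real_derivative g' s) (at s)" by blast
  then show ?case
    by (intro bexI[of _ "\<lambda>s. f' s + g' s"] wave_functions.add) (auto intro!: DERIV_add)
next
  case (mult f g)
  then obtain f' g' where "f' \<in> wave_functions" "g' \<in> wave_functions"
    "\<forall>s. (f has_real_derivative f' s) (at s)" "\<forall>s. (g has_real_derivative g' s) (at s)" by blast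
  then show ?case
    using mult by (intro bexI[of _ "\<lambda>s. f' s * g s + g' s * f s"] wave_functions.add wave_functions.mult)
      (auto intro!: DERIV_mult)
qed

text \<open>By the hypothesis the quotient of \<open>\<alpha>1 - \<alpha>\<^sup>2 + \<mu>\<^sup>2 - \<sigma>\<close> by \<open>\<sigma>\<close> has derivative zero. But at the two
  critical points \<open>0\<close> and \<open>1/2\<close> of \<open>\<psi>\<close> its signs differ, as both \<open>\<sigma>2\<close> and
  \<open>\<mu>\<^sup>2 - \<sigma> = \<psi>''/\<psi>\<close> are negative at the first and positive at the second.\<close>

lemma ratio_not_constant:
  assumes "\<And>s. ((\<lambda>s. \<alpha>1 s - (\<alpha> s)\<^sup>2 + \<mu>\<^sup>2 - \<sigma> s) has_real_derivative
      4 * \<alpha> s * (\<alpha>1 s - (\<alpha> s)\<^sup>2 + \<mu>\<^sup>2 - \<sigma> s)) (at s)"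
  shows False
proof -
  let ?e = "\<lambda>s. \<alpha>1 s - (\<alpha> s)\<^sup>2 + \<mu>\<^sup>2 - \<sigma> s"
  have "((\<lambda>s. ?e s / \<sigma> s) has_real_derivative 0) (at s)" for s
    by (rule DERIV_cong[OF DERIV_divide[OF assms \<sigma>_deriv]])
       (use \<sigma>_pos[of s] in \<open>simp_all add: \<alpha>_def\<close>)
  then have "?e 0 / \<sigma> 0 = ?e (1/2) / \<sigma> (1/2)"
    by (rule DERIV_isconst_all[rule_format, of "\<lambda>s. ?e s / \<sigma> s"])
  moreover have "?e 0 < 0"
  proof -
    have "\<alpha> 0 = 0" by (simp add: \<alpha>_def \<sigma>1_def)
    moreover have "\<sigma>2 0 < 0"
      using \<psi>_pos(2)[of 0] offset_gt(2) \<omega>_pos by (simp add: \<sigma>2_def divide_pos_pos)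
    then have "\<alpha>1 0 < 0"
      using \<sigma>_pos[of 0] by (simp add: \<alpha>1_def \<sigma>1_def mult_neg_pos divide_neg_pos)
    moreover have "\<mu>\<^sup>2 - \<sigma> 0 < 0"
      using \<psi>_pos(2)[of 0] \<omega>_pos by (simp add: \<sigma>_def)
    ultimately show ?thesis by simp
  qed
  moreover have "?e (1/2) > 0"
  proof -
    have cs: "cos (\<omega> * (1/2)) = -1" "sin (\<omega> * (1/2)) = 0" by (simp_all add: \<omega>_def)
    have "\<alpha> (1/2) = 0" unfolding \<alpha>_def \<sigma>1_def cs by simp
    moreover have "\<sigma>2 (1/2) > 0"
      unfolding \<sigma>2_def cs using \<psi>_pos(2)[of "1/2"] offset_gt(2) \<omega>_pos by (simp add: divide_pos_pos)
    then have "\<alpha>1 (1/2) > 0"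
      unfolding \<alpha>1_def \<sigma>1_def cs using \<sigma>_pos[of "1/2"] by simp
    moreover have "\<mu>\<^sup>2 - \<sigma> (1/2) > 0"
      unfolding \<sigma>_def cs using \<psi>_pos(2)[of "1/2"] \<omega>_pos by simp
    ultimately show ?thesis by simp
  qed
  ultimately show False
    using \<sigma>_pos[of 0] \<sigma>_pos[of "1/2"] by (metis divide_neg_pos divide_pos_pos less_asym)
qed

section \<open>The metric\<close>

lemma diagonal_matrix_mult:
  fixes A :: "real ^ 'n ^ 'n"
  shows "(\<chi> i j. if i = j then f i else 0) ** A = (\<chi> i j. f i * A $ i $ j)"
    and "A ** (\<chi> i j. if i = j then f i else 0) = (\<chi> i j. A $ i $ j * f j)"
  by (auto simp: matrix_matrix_mult_def vec_eq_iff if_distrib if_distribR sum.delta cong: if_cong)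

text \<open>Besides \<open>t\<close> and \<open>r\<close> there are \<open>j\<close> indices of each of the kinds \<open>\<kappa> = 1\<close>, \<open>\<kappa> = - 1\<close> and \<open>\<kappa> = 0\<close>; this
  follows from the dimension and the number for \<open>\<kappa> = 0\<close>.\<close>

locale ecs_model = golden_lattice t r \<kappa> pr
  for t r :: "'n::finite" and \<kappa> pr +
  fixes \<epsilon> :: "'n \<Rightarrow> real" and j :: nat
  assumes \<epsilon>: "\<epsilon> i = 1 \<or> \<epsilon> i = - 1"
    and dim: "CARD('n) = 3 * j + 2" and j_pos: "1 \<le> j"
    and card_\<kappa>_0: "card {i. i \<noteq> t \<and> i \<noteq> r \<and> \<kappa> i = 0} = j"
begin

text \<open>The coefficients \<open>\<epsilon>\<^sub>i P \<psi>\<^sub>i\<^sup>2\<close> of the metric, with \<open>P = \<surd>\<sigma>\<close> and with \<open>\<psi>\<^sub>i = \<psi>\<close> or \<open>\<psi>\<^sub>i = exp (\<mu> \<kappa>\<^sub>i s)\<close>;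
  \<open>\<beta>\<close> below is half their logarithmic derivative and \<open>\<beta>1\<close> the derivative of \<open>\<beta>\<close>.\<close>

definition \<gamma> :: "'n \<Rightarrow> real \<Rightarrow> real" where
  "\<gamma> i s = (if i = t \<or> i = r then sqrt (\<sigma> s)
     else if \<kappa> i = 0 then \<epsilon> i * (sqrt (\<sigma> s) * (\<psi> s)\<^sup>2)
     else \<epsilon> i * (sqrt (\<sigma> s) * exp (2 * \<mu> * \<kappa> i * s)))"

definition \<beta> :: "'n \<Rightarrow> real \<Rightarrow> real" where
  "\<beta> i s = \<alpha> s + (if i = t \<or> i = r then 0
     else if \<kappa> i = 0 then - (\<omega> * sin (\<omega> * s)) / \<psi> s else \<mu> * \<kappa> i)"

definition \<beta>1 :: "'n \<Rightarrow> real \<Rightarrow> real" where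
  "\<beta>1 i s = \<alpha>1 s + (if i = t \<or> i = r then 0
     else if \<kappa> i = 0 then \<mu>\<^sup>2 - \<sigma> s - (\<omega> * sin (\<omega> * s) / \<psi> s)\<^sup>2 else 0)"

lemma sqrt_\<sigma>_deriv': "((\<lambda>s. sqrt (\<sigma> s)) has_real_derivative 2 * \<alpha> s * sqrt (\<sigma> s)) (at s)"
proof (rule DERIV_cong[OF sqrt_\<sigma>_deriv])
  have "\<sigma>1 s * (1/2) * inverse (sqrt (\<sigma> s)) = \<sigma>1 s * sqrt (\<sigma> s) / (2 * (sqrt (\<sigma> s) * sqrt (\<sigma> s)))"
    using \<sigma>_pos[of s] by (simp add: field_simps)
  also have "\<dots> = 2 * \<alpha> s * sqrt (\<sigma> s)"
    using \<sigma>_pos[of s] by (simp add: \<alpha>_def)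
  finally show "\<sigma>1 s * (1/2) * inverse (sqrt (\<sigma> s)) = 2 * \<alpha> s * sqrt (\<sigma> s)" .
qed

lemma \<gamma>_nz: "\<gamma> i s \<noteq> 0"
  using \<sigma>_pos[of s] \<psi>_pos(2)[of s] \<epsilon>[of i] by (auto simp: \<gamma>_def)

lemma \<gamma>_deriv: "(\<gamma> i has_real_derivative 2 * \<beta> i s * \<gamma> i s) (at s)"
proof -
  have 1: "((\<lambda>s. \<epsilon> i * (sqrt (\<sigma> s) * (\<psi> s)\<^sup>2)) has_real_derivative
      2 * (\<alpha> s + - (\<omega> * sin (\<omega> * s)) / \<psi> s) * (\<epsilon> i * (sqrt (\<sigma> s) * (\<psi> s)\<^sup>2))) (at s)"
  proof (rule DERIV_cong[OF DERIV_cmult[OF DERIV_mult[OF sqrt_\<sigma>_deriv']]])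
    show "((\<lambda>s. (\<psi> s)\<^sup>2) has_real_derivative 2 * \<psi> s * (- (\<omega> * sin (\<omega> * s)))) (at s)"
      by (auto intro!: derivative_eq_intros \<psi>_deriv)
  qed (use \<psi>_pos(2)[of s] in \<open>simp add: field_simps power2_eq_square\<close>)
  have 2: "((\<lambda>s. \<epsilon> i * (sqrt (\<sigma> s) * exp (2 * \<mu> * \<kappa> i * s))) has_real_derivative
      2 * (\<alpha> s + \<mu> * \<kappa> i) * (\<epsilon> i * (sqrt (\<sigma> s) * exp (2 * \<mu> * \<kappa> i * s)))) (at s)"
  proof (rule DERIV_cong[OF DERIV_cmult[OF DERIV_mult[OF sqrt_\<sigma>_deriv']]])
    show "((\<lambda>s. exp (2 * \<mu> * \<kappa> i * s)) has_real_derivative exp (2 * \<mu> * \<kappa> i * s) * (2 * \<mu> * \<kappa> i)) (at s)"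
      by (auto intro!: derivative_eq_intros)
  qed (simp add: algebra_simps)
  have "\<gamma> i = (if i = t \<or> i = r then (\<lambda>s. sqrt (\<sigma> s))
     else if \<kappa> i = 0 then (\<lambda>s. \<epsilon> i * (sqrt (\<sigma> s) * (\<psi> s)\<^sup>2))
     else (\<lambda>s. \<epsilon> i * (sqrt (\<sigma> s) * exp (2 * \<mu> * \<kappa> i * s))))"
    by (auto simp: \<gamma>_def)
  then show ?thesis
    using sqrt_\<sigma>_deriv'[of s] 1 2 by (simp add: \<beta>_def)
qed

lemma \<beta>_deriv: "(\<beta> i has_real_derivative \<beta>1 i s) (at s)"
proof -
  have nz: "\<psi> s \<noteq> 0" using \<psi>_pos(2)[of s] by simp
  have n: "((\<lambda>s. - (\<omega> * sin (\<omega> * s))) has_real_derivative - (\<omega>\<^sup>2 * cos (\<omega> * s))) (at s)"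
    by (auto intro!: derivative_eq_intros simp: power2_eq_square)
  have 1: "((\<lambda>s. - (\<omega> * sin (\<omega> * s)) / \<psi> s) has_real_derivative
      \<mu>\<^sup>2 - \<sigma> s - (\<omega> * sin (\<omega> * s) / \<psi> s)\<^sup>2) (at s)"
    by (rule DERIV_cong[OF DERIV_divide[OF n \<psi>_deriv nz]])
       (use nz in \<open>simp add: \<sigma>_def field_simps power2_eq_square\<close>)
  have "\<beta> i = (if i = t \<or> i = r then \<alpha>
     else if \<kappa> i = 0 then (\<lambda>s. \<alpha> s + - (\<omega> * sin (\<omega> * s)) / \<psi> s) else (\<lambda>s. \<alpha> s + \<mu> * \<kappa> i))"
    by (auto simp: \<beta>_def)
  moreover have "((\<lambda>s. \<alpha> s + \<mu> * \<kappa> i) has_real_derivative \<alpha>1 s) (at s)"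
    by (auto intro!: derivative_eq_intros \<alpha>_deriv)
  ultimately show ?thesis
    using \<alpha>_deriv[of s] DERIV_add[OF \<alpha>_deriv 1] by (simp add: \<beta>1_def)
qed

sublocale rosen: rosen_metric t r \<gamma> \<beta> \<beta>1
proof
  show "t \<noteq> r" by (rule tr)
  show "\<gamma> r = \<gamma> t" by (auto simp: \<gamma>_def)
qed (rule \<gamma>_nz \<gamma>_deriv \<beta>_deriv)+

abbreviation G where "G \<equiv> rosen.G"

text \<open>The tidal coefficient of all directions with \<open>\<kappa> \<noteq> 0\<close>; for these \<open>\<psi>\<^sub>i''/\<psi>\<^sub>i = \<mu>\<^sup>2\<close>.\<close>

definition tidal0 :: "real \<Rightarrow> real" where
  "tidal0 s = \<alpha>1 s - (\<alpha> s)\<^sup>2 + \<mu>\<^sup>2"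

lemma \<beta>_t: "\<beta> t = \<alpha>" by (auto simp: \<beta>_def)

lemma rosen_tidal:
  assumes "i \<noteq> t" "i \<noteq> r"
  shows "rosen.tidal i s = tidal0 s - (if \<kappa> i = 0 then \<sigma> s else 0)"
proof -
  have "\<kappa> i = 0 \<or> (\<kappa> i)\<^sup>2 = 1" using \<kappa>_range[of i] by auto
  then show ?thesis
    using assms by (auto simp: rosen.tidal_def \<beta>_t)
      (auto simp: \<beta>_def \<beta>1_def tidal0_def power2_eq_square algebra_simps)
qed

lemma card_transverse: "card (- {t, r}) = 3 * j"
  using tr dim card_Diff_subset[of "{t, r}" UNIV] by (simp add: Compl_eq_Diff_UNIV)

lemma rosen_\<rho>: "rosen.\<rho> s = real j * \<sigma> s - 3 * real j * tidal0 s"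
proof -
  have "(\<Sum>i\<in>- {t, r}. rosen.tidal i s) = (\<Sum>i\<in>- {t, r}. tidal0 s - (if \<kappa> i = 0 then \<sigma> s else 0))"
    by (rule sum.cong) (auto simp: rosen_tidal)
  also have "\<dots> = 3 * real j * tidal0 s - (\<Sum>i\<in>- {t, r}. if \<kappa> i = 0 then \<sigma> s else 0)"
    by (simp add: sum_subtractf card_transverse)
  also have "(\<Sum>i\<in>- {t, r}. if \<kappa> i = 0 then \<sigma> s else 0) = (\<Sum>i | i \<noteq> t \<and> i \<noteq> r \<and> \<kappa> i = 0. \<sigma> s)"
    by (rule sum.mono_neutral_cong_right) auto
  also have "\<dots> = real j * \<sigma> s" by (simp add: card_\<kappa>_0)
  finally show ?thesis by (simp add: rosen.\<rho>_def)
qed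

text \<open>The three kinds of indices are equally frequent, so the mean of the tidal coefficients is
  \<open>tidal0 - \<sigma>/3\<close>, and they differ from it by these multiples of \<open>\<sigma>\<close>.\<close>

definition weight :: "'n \<Rightarrow> real" where
  "weight i = (if \<kappa> i = 0 then - 2 / 3 else 1 / 3)"

lemma weyl_eq:
  "weyl G = (\<lambda>i k l m x. rosen.curvature_shape (\<lambda>i s. \<gamma> i s * (weight i * \<sigma> s)) i k l m (x $ t))"
proof (intro ext)
  fix i k l m x
  have "real CARD('n) - 2 = 3 * real j" using dim by simp
  have "rosen.tidal i s + rosen.\<rho> s / (real CARD('n) - 2) = weight i * \<sigma> s" if "i \<noteq> t" "i \<noteq> r" for i s
  proof -
    have "rosen.\<rho> s / (real CARD('n) - 2) = \<sigma> s / 3 - tidal0 s"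
      using j_pos unfolding \<open>real CARD('n) - 2 = 3 * real j\<close> rosen_\<rho> by (simp add: field_simps)
    then show ?thesis by (simp add: rosen_tidal that weight_def)
  qed
  then show "weyl G i k l m x =
      rosen.curvature_shape (\<lambda>i s. \<gamma> i s * (weight i * \<sigma> s)) i k l m (x $ t)"
    unfolding rosen.weyl_G by (intro rosen.curvature_shape_cong) simp
qed

text \<open>This is where the choice of the conformal factor enters: \<open>\<sigma>\<close> is the square of \<open>\<gamma>\<^sub>t\<close>,
  that is \<open>\<sigma>1 = 4 \<alpha> \<sigma>\<close>, so the derivative of \<open>\<sigma>\<close> cancels the two corrections by \<open>2 \<beta>\<^sub>t\<close>.\<close>

lemma weyl_parallel: "cov_deriv4 G (weyl G) m i k l n x = 0"
proof -
  let ?c' = "\<lambda>i. 2 * \<beta> i (x $ t) * \<gamma> i (x $ t) * (weight i * \<sigma> (x $ t)) + weight i * \<sigma>1 (x $ t) * \<gamma> i (x $ t)"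
  have "((\<lambda>s. \<gamma> i s * (weight i * \<sigma> s)) has_real_derivative ?c' i) (at (x $ t))" for i
    by (rule DERIV_mult[OF \<gamma>_deriv DERIV_cmult[OF \<sigma>_deriv]])
  then have eq: "cov_deriv4 G (weyl G) m i k l n x = rosen.null m *
     rosen.curvature_shape (\<lambda>i s. ?c' i - 4 * \<beta> t s * (\<gamma> i s * (weight i * \<sigma> s))
       - 2 * \<beta> i s * (\<gamma> i s * (weight i * \<sigma> s))) i k l n (x $ t)"
    unfolding weyl_eq by (rule rosen.cov_deriv4_curvature_shape)
  have "\<sigma>1 s = 4 * \<alpha> s * \<sigma> s" for s using \<sigma>_pos[of s] by (simp add: \<alpha>_def)
  then have "rosen.curvature_shape (\<lambda>i s. ?c' i - 4 * \<beta> t s * (\<gamma> i s * (weight i * \<sigma> s))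
       - 2 * \<beta> i s * (\<gamma> i s * (weight i * \<sigma> s))) i k l n (x $ t) = 0"
    by (intro rosen.curvature_shape_zero) (simp add: \<beta>_t)
  then show ?thesis unfolding eq by simp
qed

lemma weyl_nonzero:
  assumes "a \<noteq> t" "a \<noteq> r"
  shows "weyl G t a t a x \<noteq> 0"
  using assms \<gamma>_nz[of a "x $ t"] \<sigma>_pos[of "x $ t"]
  by (simp add: weyl_eq rosen.curvature_shape_diagonal weight_def)

lemma wave_tidal0: "tidal0 \<in> wave_functions"
  unfolding tidal0_def[abs_def]
  by (intro wave_functions.add wave_functions.const wave_diff wave_power wave_\<alpha>)

text \<open>If the curvature tensor were parallel, the tidal coefficient of a direction with \<open>\<kappa> = 0\<close> would be
  a constant multiple of \<open>\<sigma>\<close>.\<close>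

lemma curv_not_parallel:
  obtains m i k l n x where "cov_deriv4 G (curv G) m i k l n x \<noteq> 0"
proof (rule ccontr)
  assume "\<not> thesis"
  then have zero: "cov_deriv4 G (curv G) m i k l n x = 0" for m i k l n x
    using that by blast
  have "{i. i \<noteq> t \<and> i \<noteq> r \<and> \<kappa> i = 0} \<noteq> {}"
    using card_\<kappa>_0 j_pos by (metis card.empty not_one_le_zero)
  then obtain b where b: "b \<noteq> t" "b \<noteq> r" "\<kappa> b = 0" by blast
  have tidal_deriv: "\<exists>d. \<forall>s. (rosen.tidal i has_real_derivative d s) (at s)" if "i \<noteq> t" "i \<noteq> r" for i
  proof -
    have "rosen.tidal i = (\<lambda>s. tidal0 s - (if \<kappa> i = 0 then 1 else 0) * \<sigma> s)"
      using rosen_tidal[OF that] by auto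
    also have "\<dots> \<in> wave_functions"
      by (intro wave_diff wave_functions.mult wave_functions.const wave_\<sigma> wave_tidal0)
    finally show ?thesis using wave_functions_deriv by blast
  qed
  \<comment> \<open>The values at \<open>t\<close> and \<open>r\<close> do not enter the tensor; zero makes all of them differentiable.\<close>
  define c where "c i = (if i = t \<or> i = r then (\<lambda>_. 0) else (\<lambda>s. \<gamma> i s * rosen.tidal i s))" for i
  obtain d where d: "\<And>i s. i \<noteq> t \<Longrightarrow> i \<noteq> r \<Longrightarrow> (rosen.tidal i has_real_derivative d i s) (at s)"
    using tidal_deriv by metis
  have c': "(c i has_real_derivative (if i = t \<or> i = r then 0 else
      2 * \<beta> i s * \<gamma> i s * rosen.tidal i s + d i s * \<gamma> i s)) (at s)" for i s
    using DERIV_mult[OF \<gamma>_deriv[of i s] d[of i s]] by (auto simp: c_def)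
  have curv_eq: "curv G = (\<lambda>i k l m x. rosen.curvature_shape c i k l m (x $ t))"
    unfolding rosen.curv_G[abs_def]
    by (intro ext rosen.curvature_shape_cong) (simp add: c_def)
  have "(rosen.tidal b has_real_derivative 4 * \<alpha> s * rosen.tidal b s) (at s)" for s
  proof -
    \<comment> \<open>Any point with \<open>t\<close> coordinate \<open>s\<close> will do.\<close>
    define x :: "real ^ 'n" where "x = (\<chi> _. s)"
    have "cov_deriv4 G (curv G) t t b t b x = rosen.null t *
       rosen.curvature_shape (\<lambda>i s'. (if i = t \<or> i = r then 0 else
      2 * \<beta> i (x $ t) * \<gamma> i (x $ t) * rosen.tidal i (x $ t) + d i (x $ t) * \<gamma> i (x $ t))
       - 4 * \<beta> t s' * c i s' - 2 * \<beta> i s' * c i s') t b t b (x $ t)"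
      unfolding curv_eq by (rule rosen.cov_deriv4_curvature_shape) (rule c')
    then have "\<gamma> b s * (d b s - 4 * \<alpha> s * rosen.tidal b s) = 0"
      unfolding zero rosen.curvature_shape_diagonal[OF b(1,2)] using b
      by (auto simp: rosen.null_def \<beta>_t c_def x_def algebra_simps)
    then have "d b s = 4 * \<alpha> s * rosen.tidal b s" using \<gamma>_nz[of b s] by simp
    then show ?thesis using d[OF b(1,2), of s] by simp
  qed
  moreover have "rosen.tidal b = (\<lambda>s. \<alpha>1 s - (\<alpha> s)\<^sup>2 + \<mu>\<^sup>2 - \<sigma> s)"
    using rosen_tidal[OF b(1,2)] b(3) by (auto simp: tidal0_def)
  ultimately show False using ratio_not_constant by simp
qed

text \<open>The factor \<open>exp (2 \<mu> \<kappa>\<^sub>i s)\<close> in the coefficients compensates the dilations of the monodromy, and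
  the other factors are periodic.\<close>

lemma \<gamma>_shift:
  assumes "k \<in> \<int>"
  shows "exp (- (k * \<mu> * \<kappa> i)) * \<gamma> i (s + k) * exp (- (k * \<mu> * \<kappa> (rosen.cp i))) = \<gamma> i s"
proof -
  have "exp (- (k * \<mu> * \<kappa> i)) * exp (2 * \<mu> * \<kappa> i * (s + k)) * exp (- (k * \<mu> * \<kappa> i)) = exp (2 * \<mu> * \<kappa> i * s)"
    by (simp add: algebra_simps flip: exp_add)
  then have "exp (- (k * \<mu> * \<kappa> i)) * (\<epsilon> i * (sqrt (\<sigma> s) * exp (2 * \<mu> * \<kappa> i * (s + k)))) * exp (- (k * \<mu> * \<kappa> i))
      = \<epsilon> i * (sqrt (\<sigma> s) * exp (2 * \<mu> * \<kappa> i * s))"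
    by (simp add: mult_ac)
  then show ?thesis
    using periodic[OF assms] \<kappa>_t \<kappa>_r by (auto simp: \<gamma>_def rosen.cp_def)
qed

lemma matrix_flow: "matrix (flow k) = (\<chi> i j. if i = j then exp (- (k * \<mu> * \<kappa> i)) else 0)"
  by (auto simp: matrix_def flow_def axis_def vec_eq_iff)

lemma G_shift:
  assumes "u $ t - x $ t \<in> \<int>"
  shows "transpose (matrix (flow (u $ t - x $ t))) ** G u ** matrix (flow (u $ t - x $ t)) = G x"
proof -
  let ?k = "u $ t - x $ t"
  let ?f = "\<lambda>i. exp (- (?k * \<mu> * \<kappa> i))"
  have "transpose (\<chi> i j. if i = j then ?f i else 0) = (\<chi> i j. if i = j then ?f i else 0)"
    by (auto simp: transpose_def vec_eq_iff)
  then have "transpose (matrix (flow ?k)) ** G u ** matrix (flow ?k) = (\<chi> i j. ?f i * G u $ i $ j * ?f j)"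
    unfolding matrix_flow by (simp add: diagonal_matrix_mult)
  also have "\<dots> = G x"
    using \<gamma>_shift[OF assms, of _ "x $ t"] by (auto simp: vec_eq_iff rosen.G_def)
  finally show ?thesis .
qed

lemma smooth_G: "smooth_on S G"
proof (rule smooth_on_coordinate_matrix[where \<A> = wave_functions and t = t])
  show "\<exists>f'\<in>wave_functions. \<forall>s. (f has_real_derivative f' s) (at s)" if "f \<in> wave_functions" for f
    using wave_functions_deriv[OF that] .
  show "(\<lambda>s. a * f s) \<in> wave_functions" if "f \<in> wave_functions" for f a
    using that by (intro wave_functions.intros)
  fix i j
  have "\<gamma> i \<in> wave_functions"
  proof -
    have "\<gamma> i = (if i = t \<or> i = r then (\<lambda>s. sqrt (\<sigma> s))
     else if \<kappa> i = 0 then (\<lambda>s. \<epsilon> i * (sqrt (\<sigma> s) * (\<psi> s)\<^sup>2))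
     else (\<lambda>s. \<epsilon> i * (sqrt (\<sigma> s) * exp (2 * \<mu> * \<kappa> i * s))))"
      by (auto simp: \<gamma>_def)
    moreover have "(\<lambda>s. sqrt (\<sigma> s)) \<in> wave_functions"
      "(\<lambda>s. \<epsilon> i * (sqrt (\<sigma> s) * (\<psi> s)\<^sup>2)) \<in> wave_functions"
      "(\<lambda>s. \<epsilon> i * (sqrt (\<sigma> s) * exp (2 * \<mu> * \<kappa> i * s))) \<in> wave_functions"
      by (intro wave_functions.intros wave_power wave_\<psi>)+
    ultimately show ?thesis by simp
  qed
  then show "\<exists>f\<in>wave_functions. \<forall>x. G x $ i $ j = f (x $ t)"
    by (cases "j = rosen.cp i")
       (auto simp: rosen.G_def intro: bexI[of _ "\<gamma> i"] bexI[OF _ wave_functions.const[of 0]])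
qed

text \<open>The plane of \<open>t\<close> and \<open>r\<close> is hyperbolic and contributes one sign of each kind; a basis that
  diagonalises it consists of the multiples by \<open>a\<close> of the sum and of the difference of the two coordinate vectors.\<close>

lemma has_signature_G:
  assumes p: "card {i. i \<noteq> t \<and> i \<noteq> r \<and> \<epsilon> i = 1} + 1 = p"
    and q: "card {i. i \<noteq> t \<and> i \<noteq> r \<and> \<epsilon> i = - 1} + 1 = q"
  shows "has_signature (G x) p q"
proof -
  let ?s = "x $ t"
  \<comment> \<open>The signs of the diagonalised form.\<close>
  define \<eta> where "\<eta> i = (if i = t then 1 else if i = r then - 1 else \<epsilon> i)" for i
  define a where "a = 1 / sqrt (2 * \<gamma> t ?s)"
  define n where "n i = 1 / sqrt \<bar>\<gamma> i ?s\<bar>" for i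
  define P :: "real ^ 'n ^ 'n" where "P = (\<chi> k i. if i = t then (if k = t \<or> k = r then a else 0)
     else if i = r then (if k = t then a else if k = r then - a else 0)
     else if k = i then n i else 0)"
  have sum_P: "(\<Sum>k\<in>UNIV. P $ k $ i * f k) = (if i = t then a * (f t + f r)
     else if i = r then a * (f t - f r) else n i * f i)" for i and f :: "'n \<Rightarrow> real"
  proof -
    have "(\<Sum>k\<in>UNIV. P $ k $ i * f k) =
      (\<Sum>k\<in>UNIV. (if k = t then (if i = t \<or> i = r then a * f t else 0) else 0)
        + (if k = r then (if i = t then a * f r else if i = r then - a * f r else 0) else 0)
        + (if k = i then (if i \<noteq> t \<and> i \<noteq> r then n i * f i else 0) else 0))"
    proof (rule sum.cong[OF refl])
      fix k
      show "P $ k $ i * f k = (if k = t then (if i = t \<or> i = r then a * f t else 0) else 0)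
        + (if k = r then (if i = t then a * f r else if i = r then - a * f r else 0) else 0)
        + (if k = i then (if i \<noteq> t \<and> i \<noteq> r then n i * f i else 0) else 0)"
        using tr by (cases "i = t"; cases "i = r"; cases "k = t"; cases "k = r") (simp_all add: P_def)
    qed
    then show ?thesis
      using tr by (cases "i = t"; cases "i = r") (simp_all add: sum.distrib distrib_left right_diff_distrib)
  qed
  have GP: "(G x ** P) $ k $ i = \<gamma> k ?s * P $ rosen.cp k $ i" for k i
  proof -
    have "(G x ** P) $ k $ i = (\<Sum>l\<in>UNIV. (if l = rosen.cp k then \<gamma> k ?s else 0) * P $ l $ i)"
      by (simp add: matrix_matrix_mult_def rosen.G_def)
    then show ?thesis by (simp add: rosen.sum_cp)
  qed
  have aa: "2 * (a * (a * \<gamma> t ?s)) = 1"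
  proof -
    have pos: "\<gamma> t ?s > 0" using \<sigma>_pos[of ?s] by (simp add: \<gamma>_def)
    then have "a * a = 1 / (2 * \<gamma> t ?s)" by (simp add: a_def)
    moreover have "2 * (a * (a * \<gamma> t ?s)) = a * a * (2 * \<gamma> t ?s)" by simp
    ultimately show ?thesis using pos by simp
  qed
  have nn: "n i * (n i * \<gamma> i ?s) = \<epsilon> i" if "i \<noteq> t" "i \<noteq> r" for i
  proof -
    have "n i * n i = 1 / \<bar>\<gamma> i ?s\<bar>"
      by (simp add: n_def)
    then have "n i * (n i * \<gamma> i ?s) = \<gamma> i ?s / \<bar>\<gamma> i ?s\<bar>"
      by (simp flip: mult.assoc)
    also have "\<dots> = sgn (\<gamma> i ?s)" by (simp add: sgn_if \<gamma>_nz)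
    also have "\<dots> = sgn (\<epsilon> i)"
      using that \<sigma>_pos[of ?s] \<psi>_pos(2)[of ?s] by (simp add: \<gamma>_def sgn_mult)
    finally show ?thesis using \<epsilon>[of i] by auto
  qed
  have D: "transpose P ** G x ** P = (\<chi> i j. if i = j then \<eta> i else 0)"
  proof -
    have "(transpose P ** (G x ** P)) $ i $ j = (if i = j then \<eta> i else 0)" for i j
    proof -
      have "(transpose P ** (G x ** P)) $ i $ j = (\<Sum>k\<in>UNIV. P $ k $ i * (G x ** P) $ k $ j)"
        by (subst matrix_matrix_mult_def) (simp add: transpose_def)
      also have "\<dots> = (if i = t then a * (\<gamma> t ?s * P $ r $ j + \<gamma> t ?s * P $ t $ j)
          else if i = r then a * (\<gamma> t ?s * P $ r $ j - \<gamma> t ?s * P $ t $ j)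
          else n i * (\<gamma> i ?s * P $ i $ j))"
        unfolding sum_P GP using rosen.\<gamma>_r by simp
      also have "\<dots> = (if i = j then \<eta> i else 0)"
      proof -
        consider "i = t" | "i = r" | "i \<noteq> t" "i \<noteq> r" by blast
        then show ?thesis
        proof cases
          case 1
          have "P $ r $ j + P $ t $ j = (if j = t then 2 * a else 0)"
            using tr by (simp add: P_def)
          note e1 = this
          have e2: "a * (\<gamma> t ?s * P $ r $ j + \<gamma> t ?s * P $ t $ j) =
              a * \<gamma> t ?s * (P $ r $ j + P $ t $ j)"
            by (simp add: algebra_simps)
          have "a * (\<gamma> t ?s * P $ r $ j + \<gamma> t ?s * P $ t $ j) = (if j = t then 1 else 0)"
            unfolding e2 e1 using aa by (simp add: mult_ac)
          then show ?thesis using 1 by (auto simp: \<eta>_def)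
        next
          case 2
          have "P $ r $ j - P $ t $ j = (if j = r then - 2 * a else 0)"
            using tr by (simp add: P_def)
          note e1 = this
          have e2: "a * (\<gamma> t ?s * P $ r $ j - \<gamma> t ?s * P $ t $ j) =
              a * \<gamma> t ?s * (P $ r $ j - P $ t $ j)"
            by (simp add: algebra_simps)
          have "a * (\<gamma> t ?s * P $ r $ j - \<gamma> t ?s * P $ t $ j) = (if j = r then - 1 else 0)"
            unfolding e2 e1 using aa by (simp add: mult_ac)
          then show ?thesis using 2 tr by (auto simp: \<eta>_def)
        next
          case 3
          then have "P $ i $ j = (if i = j then n i else 0)" by (auto simp: P_def)
          then show ?thesis using 3 nn[OF 3] by (auto simp: \<eta>_def mult_ac)
        qed
      qed
      finally show ?thesis .
    qed
    then show ?thesis by (simp add: vec_eq_iff matrix_mul_assoc)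
  qed
  have \<eta>: "\<eta> i = 1 \<or> \<eta> i = - 1" for i using \<epsilon>[of i] by (auto simp: \<eta>_def)
  have "invertible P"
  proof -
    let ?D = "(\<chi> i j. if i = j then \<eta> i else 0) :: real ^ 'n ^ 'n"
    have "\<eta> i * \<eta> i = 1" for i using \<eta>[of i] by auto
    then have "?D ** ?D = mat 1"
      unfolding diagonal_matrix_mult by (simp add: mat_def vec_eq_iff)
    moreover have "(?D ** (transpose P ** G x)) ** P = ?D ** (transpose P ** G x ** P)"
      by (rule matrix_mul_assoc[symmetric])
    ultimately have "(?D ** (transpose P ** G x)) ** P = mat 1"
      unfolding D by (rule trans[rotated])
    then show ?thesis using invertible_left_inverse by blast
  qed
  moreover have "{i. \<eta> i = 1} = insert t {i. i \<noteq> t \<and> i \<noteq> r \<and> \<epsilon> i = 1}"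
    "{i. \<eta> i = - 1} = insert r {i. i \<noteq> t \<and> i \<noteq> r \<and> \<epsilon> i = - 1}"
    using tr by (auto simp: \<eta>_def split: if_splits)
  then have "card {i. \<eta> i = 1} = p" "card {i. \<eta> i = - 1} = q" using p q by simp_all
  ultimately show ?thesis
    unfolding has_signature_def using \<eta> D by blast
qed

lemma pseudo_riemannian_G:
  assumes "card {i. i \<noteq> t \<and> i \<noteq> r \<and> \<epsilon> i = 1} + 1 = p"
    and "card {i. i \<noteq> t \<and> i \<noteq> r \<and> \<epsilon> i = - 1} + 1 = q"
  shows "pseudo_riemannian_metric M (\<lambda>_. G) p q"
  unfolding pseudo_riemannian_metric_def
proof (intro conjI ballI)
  fix c d x assume c: "c \<in> charts M" and d: "d \<in> charts M" and x: "x \<in> snd c ` (fst c \<inter> fst d)"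
  obtain U where U: "open U" "inj_on cls U" "c = (cls ` U, inv_into U cls)"
    using c by (rule charts_ME)
  obtain V where V: "open V" "inj_on cls V" "d = (cls ` V, inv_into V cls)"
    using d by (rule charts_ME)
  obtain y where "y \<in> cls ` U" "y \<in> cls ` V" "x = inv_into U cls y"
    using U V x by auto
  then have xU: "x \<in> U" and "cls x \<in> cls ` V"
    by (simp_all add: f_inv_into_f inv_into_into)
  then obtain u where u: "u \<in> V" "cls x = cls u" by auto
  let ?k = "u $ t - x $ t"
  have ev: "\<forall>\<^sub>F z in nhds x. transition c d z = flow ?k z + (u - flow ?k x)"
    using transition_eventually[OF U(1,2) V(1,2) xU u] unfolding U(3) V(3)
    by eventually_elim (simp add: flow_diff)
  have "frechet_derivative (transition c d) (at x) = flow ?k"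
    using frechet_derivative_at[OF locally_affine_at_derivative[OF bounded_linear_flow ev]] by simp
  moreover have "transition c d x = u"
    using eventually_nhds_x_imp_x[OF ev] by simp
  moreover have "?k \<in> \<int>" using u(2) cls_eq_iff rel_shift_Ints by blast
  ultimately show "let J = matrix (frechet_derivative (transition c d) (at x))
        in G x = transpose J ** G (transition c d x) ** J"
    using G_shift[of u x] by (simp add: Let_def)
qed (use smooth_G has_signature_G assms in auto)

lemma chart_at:
  obtains c where "c \<in> charts M" "x \<in> chart_img c"
proof
  show "(cls ` ball x (1/2), inv_into (ball x (1/2)) cls) \<in> charts M"
    using inj_on_cls_ball[of x] by (auto simp: M_def)
  show "x \<in> chart_img (cls ` ball x (1/2), inv_into (ball x (1/2)) cls)"
    by (simp add: chart_img_M[OF inj_on_cls_ball])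
qed

lemma essentially_conformally_symmetric_G: "essentially_conformally_symmetric M (\<lambda>_. G)"
proof -
  have "{i. i \<noteq> t \<and> i \<noteq> r \<and> \<kappa> i = 0} \<noteq> {}"
    using card_\<kappa>_0 j_pos by (metis card.empty not_one_le_zero)
  then obtain b where b: "b \<noteq> t" "b \<noteq> r" by blast
  obtain c where c: "c \<in> charts M" "0 \<in> chart_img c" by (rule chart_at)
  then have "\<not> conformally_flat M (\<lambda>_. G)"
    unfolding conformally_flat_def using weyl_nonzero[OF b] by blast
  moreover obtain m i k l n x where "cov_deriv4 G (curv G) m i k l n x \<noteq> 0"
    by (rule curv_not_parallel)
  then have "\<not> locally_symmetric M (\<lambda>_. G)"
    unfolding locally_symmetric_def using chart_at[of x] by metis
  moreover have "conformally_symmetric M (\<lambda>_. G)"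
    unfolding conformally_symmetric_def using weyl_parallel dim j_pos by simp
  ultimately show ?thesis by (simp add: essentially_conformally_symmetric_def)
qed

text \<open>Both the Ricci tensor and its covariant derivatives are multiples of \<open>dt \<otimes> dt\<close>.\<close>

lemma ricci_recurrent_G: "ricci_recurrent M (\<lambda>_. G)"
  unfolding ricci_recurrent_def
proof (intro allI impI ballI)
  fix w c x
  have "rosen.\<rho> = (\<lambda>s. real j * \<sigma> s - 3 * real j * tidal0 s)"
    using rosen_\<rho> by auto
  also have "\<dots> \<in> wave_functions"
    by (intro wave_diff wave_functions.mult wave_functions.const wave_\<sigma> wave_tidal0)
  finally obtain \<rho>' where "\<And>s. (rosen.\<rho> has_real_derivative \<rho>' s) (at s)"
    using wave_functions_deriv by blast
  note D = rosen.cov_deriv2_ricci_G[OF this]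
  define a where "a = w c x $ t * (\<rho>' (x $ t) - 4 * \<beta> t (x $ t) * rosen.\<rho> (x $ t))"
  have sum: "(\<Sum>m\<in>UNIV. w c x $ m * cov_deriv2 G (ricci G) m i k x) =
      (if i = t \<and> k = t then a else 0)" for i k
  proof -
    have "(\<Sum>m\<in>UNIV. w c x $ m * cov_deriv2 G (ricci G) m i k x) =
        (\<Sum>m\<in>UNIV. if m = t then (if i = t \<and> k = t then a else 0) else 0)"
      by (rule sum.cong) (auto simp: D a_def)
    then show ?thesis by (simp add: sum.delta)
  qed
  show "\<exists>a b. (a \<noteq> 0 \<or> b \<noteq> 0) \<and> (\<forall>i k. a * ricci G i k x +
      b * (\<Sum>m\<in>UNIV. w c x $ m * cov_deriv2 G (ricci G) m i k x) = 0)"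
  proof (cases "rosen.\<rho> (x $ t) = 0")
    case True
    then show ?thesis
      by (intro exI[of _ 1] exI[of _ 0]) (simp add: rosen.ricci_G)
  next
    case False
    then show ?thesis
      unfolding sum
      by (intro exI[of _ "- a"] exI[of _ "rosen.\<rho> (x $ t)"]) (simp add: rosen.ricci_G)
  qed
qed

end

section \<open>Compact examples\<close>

text \<open>Number the indices from \<open>0\<close>. Then \<open>t\<close> and \<open>r\<close> are the numbers \<open>0\<close> and \<open>1\<close>, and the numbers
  \<open>3 a + 2\<close>, \<open>3 a + 3\<close>, \<open>3 a + 4\<close> form a triple with \<open>\<kappa> = 1, - 1, 0\<close>.\<close>

lemma golden_lattice_exists:
  assumes "CARD('n::finite) = 3 * j + 2" and "1 \<le> j"
  obtains t r :: "'n::finite" and \<kappa> pr where "golden_lattice t r \<kappa> pr"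
    "card {i. i \<noteq> t \<and> i \<noteq> r \<and> \<kappa> i = 0} = j" "\<exists>i. \<kappa> i \<noteq> 0"
proof -
  obtain f :: "'n \<Rightarrow> nat" where f: "bij_betw f UNIV {0..<3 * j + 2}"
    using ex_bij_betw_finite_nat[of "UNIV :: 'n set"] assms(1) by auto
  define g where "g = inv_into UNIV f"
  have gf [simp]: "g (f i) = i" for i
    using f by (simp add: g_def bij_betw_def)
  have fg [simp]: "f (g m) = m" if "m < 3 * j + 2" for m
    using f that by (simp add: g_def bij_betw_def f_inv_into_f)
  have f_less: "f i < 3 * j + 2" for i
    using f by (auto simp: bij_betw_def)
  define K :: "nat \<Rightarrow> real" where
    "K m = (if m < 2 then 0 else if m mod 3 = 2 then 1 else if m mod 3 = 0 then - 1 else 0)" for m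
  define R :: "nat \<Rightarrow> nat" where
    "R m = (if K m = 1 then m + 1 else if K m = - 1 then m - 1 else m)" for m
  have R: "R m < 3 * j + 2" "R (R m) = m" "K (R m) = - K m" "K m = 0 \<Longrightarrow> R m = m" if "m < 3 * j + 2" for m
  proof -
    have "K m = 0 \<or> 2 \<le> m \<and> m mod 3 = 2 \<or> 2 \<le> m \<and> m mod 3 = 0"
      by (simp add: K_def)
    then consider "K m = 0" | "2 \<le> m" "m mod 3 = 2" | "2 \<le> m" "m mod 3 = 0"
      by (elim disjE conjE)
    then have "R m < 3 * j + 2 \<and> R (R m) = m \<and> K (R m) = - K m \<and> (K m = 0 \<longrightarrow> R m = m)"
    proof cases
      case 1
      then show ?thesis using that by (simp add: R_def)
    next
      case 2
      then have "(m + 1) mod 3 = 0" by presburger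
      then have K: "K m = 1" "K (m + 1) = - 1" using 2 by (simp_all add: K_def)
      have "R m = m + 1" "R (m + 1) = m + 1 - 1" unfolding R_def K by simp_all
      moreover have "m + 1 < 3 * j + 2" using 2 that by presburger
      ultimately show ?thesis using K by simp
    next
      case 3
      then obtain l where l: "m = l + 1" by (metis Suc_eq_plus1 not_numeral_le_zero not0_implies_Suc)
      have "l mod 3 = 2" "2 \<le> l" using 3 unfolding l by presburger+
      then have K: "K m = - 1" "K l = 1" using 3 by (simp_all add: K_def)
      have "R m = l" "R l = m" unfolding R_def K by (simp_all add: l)
      then show ?thesis using that K l by simp
    qed
    then show "R m < 3 * j + 2" "R (R m) = m" "K (R m) = - K m" "K m = 0 \<Longrightarrow> R m = m" by blast+
  qed
  let ?t = "g 0" and ?r = "g 1" and ?\<kappa> = "\<lambda>i. K (f i)" and ?pr = "\<lambda>i. g (R (f i))"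
  have "golden_lattice ?t ?r ?\<kappa> ?pr"
  proof
    have "f (g 0) \<noteq> f (g 1)" by simp
    then show "?t \<noteq> ?r" by metis
    have "K 0 = 0" "K 1 = 0" by (simp_all add: K_def)
    then show "?\<kappa> ?t = 0" "?\<kappa> ?r = 0" by simp_all
    fix i
    show "?\<kappa> i \<in> {- 1, 0, 1}" by (simp add: K_def)
    show "?pr (?pr i) = i" "?\<kappa> (?pr i) = - ?\<kappa> i" "?\<kappa> i = 0 \<Longrightarrow> ?pr i = i"
      using R[OF f_less] by simp_all
  qed
  moreover have "card {i. i \<noteq> ?t \<and> i \<noteq> ?r \<and> ?\<kappa> i = 0} = j"
  proof -
    have less: "3 * a + 4 < 3 * j + 2" if "a < j" for a using that by simp
    have "{i. i \<noteq> ?t \<and> i \<noteq> ?r \<and> ?\<kappa> i = 0} = (\<lambda>a. g (3 * a + 4)) ` {..<j}"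
    proof (intro equalityI subsetI)
      fix i assume "i \<in> {i. i \<noteq> ?t \<and> i \<noteq> ?r \<and> ?\<kappa> i = 0}"
      then have i: "i \<noteq> ?t" "i \<noteq> ?r" "K (f i) = 0" by simp_all
      have "f i \<noteq> 0" "f i \<noteq> 1" using i(1,2) gf[of i] by metis+
      moreover have "f i < 2 \<or> (f i mod 3 \<noteq> 2 \<and> f i mod 3 \<noteq> 0)"
        using i(3) by (auto simp: K_def split: if_splits)
      ultimately have "\<exists>a. f i = 3 * a + 4" by presburger
      then obtain a where a: "f i = 3 * a + 4" by blast
      then have "a < j" using f_less[of i] by simp
      moreover have "i = g (3 * a + 4)" using gf[of i] a by simp
      ultimately show "i \<in> (\<lambda>a. g (3 * a + 4)) ` {..<j}" by blast
    next
      fix i assume "i \<in> (\<lambda>a. g (3 * a + 4)) ` {..<j}"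
      then obtain a where a: "a < j" "i = g (3 * a + 4)" by auto
      then have fi: "f i = 3 * a + 4" using fg[OF less] by simp
      have "f ?t = 0" "f ?r = 1" by simp_all
      then have "i \<noteq> ?t" "i \<noteq> ?r" using fi by auto
      moreover have "(3 * a + 4) mod 3 = 1" by presburger
      then have "K (f i) = 0" unfolding fi by (simp add: K_def)
      ultimately show "i \<in> {i. i \<noteq> ?t \<and> i \<noteq> ?r \<and> ?\<kappa> i = 0}" by simp
    qed
    moreover have "inj_on (\<lambda>a. g (3 * a + 4)) {..<j}"
    proof (rule inj_onI)
      fix a b assume "a \<in> {..<j}" "b \<in> {..<j}" "g (3 * a + 4) = g (3 * b + 4)"
      then have "3 * a + 4 = 3 * b + 4" using fg[OF less] by (metis lessThan_iff)
      then show "a = b" by simp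
    qed
    ultimately show ?thesis by (simp add: card_image)
  qed
  moreover have "?\<kappa> (g 2) \<noteq> 0" using assms(2) by (simp add: K_def)
  ultimately show thesis using that by blast
qed

lemma sign_pattern_exists:
  assumes "finite S" "card S = a + b"
  shows "\<exists>\<epsilon> :: 'a \<Rightarrow> real. (\<forall>i. \<epsilon> i = 1 \<or> \<epsilon> i = - 1) \<and>
    card {i\<in>S. \<epsilon> i = 1} = a \<and> card {i\<in>S. \<epsilon> i = - 1} = b"
proof -
  obtain T where T: "T \<subseteq> S" "card T = a"
    using obtain_subset_with_card_n[of a S] assms(2) by auto
  have "card (S - T) = b"
    using T assms by (simp add: card_Diff_subset finite_subset)
  moreover have "{i\<in>S. (if i \<in> T then 1 else - 1) = (1 :: real)} = T"
    "{i\<in>S. (if i \<in> T then 1 else - 1) = (- 1 :: real)} = S - T"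
    using T by auto
  ultimately show ?thesis
    using T by (intro exI[of _ "\<lambda>i. if i \<in> T then 1 else - 1"]) auto
qed

theorem theorem0p1:
  fixes j n p q :: nat
  assumes "1 \<le> j" and "n = 3 * j + 2"
    and "CARD('n::finite) = n" and "CARD('m::finite) = n - 1"
    and "1 \<le> p" and "1 \<le> q" and "p + q = n"
  shows "\<exists>(M :: ((real ^ 'n) set, real ^ 'n) manifold) (g :: ((real ^ 'n) set, 'n) metric).
           smooth_manifold M \<and> compact_space (mtop M) \<and>
           pseudo_riemannian_metric M g p q \<and>
           essentially_conformally_symmetric M g \<and>
           ricci_recurrent M g \<and>
           diffeomorphic_to_torus_bundle TYPE('m) M \<and>
           \<not> mtop M homeomorphic_space mtop (torus :: ('n \<Rightarrow> complex, real ^ 'n) manifold) \<and>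
           \<not> (\<exists>\<pi>. covering_projection
                    (mtop (torus :: ('n \<Rightarrow> complex, real ^ 'n) manifold)) (mtop M) \<pi>)"
proof -
  have "CARD('n) = 3 * j + 2" using assms by simp
  then obtain t r :: 'n and \<kappa> pr where lattice: "golden_lattice t r \<kappa> pr"
      and card_\<kappa>: "card {i. i \<noteq> t \<and> i \<noteq> r \<and> \<kappa> i = 0} = j" and "\<exists>i. \<kappa> i \<noteq> 0"
    using assms(1) by (rule golden_lattice_exists)
  then obtain a where a: "\<kappa> a \<noteq> 0" by blast
  interpret golden_lattice t r \<kappa> pr by (rule lattice)
  have "card (- {t, r}) = (p - 1) + (q - 1)"
    using tr assms card_Diff_subset[of "{t, r}" UNIV] by (simp add: Compl_eq_Diff_UNIV)
  then obtain \<epsilon> :: "'n \<Rightarrow> real" where signs: "\<forall>i. \<epsilon> i = 1 \<or> \<epsilon> i = - 1"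
      "card {i\<in>- {t, r}. \<epsilon> i = 1} = p - 1" "card {i\<in>- {t, r}. \<epsilon> i = - 1} = q - 1"
    using sign_pattern_exists[OF finite] by blast
  interpret ecs_model t r \<kappa> pr \<epsilon> j
    by unfold_locales (use signs(1) assms card_\<kappa> in auto)
  have "CARD('m) = card (- {t})"
    using assms card_Diff_subset[of "{t}" UNIV] by (simp add: Compl_eq_Diff_UNIV)
  then obtain e :: "'m \<Rightarrow> 'n" where "bij_betw e UNIV (- {t})"
    using finite_same_card_bij[of "UNIV :: 'm set" "- {t}"] by auto
  then interpret golden_fibration t r \<kappa> pr e by unfold_locales
  have mtop: "mtop M = qtop" by (simp add: M_def)
  have signature: "card {i. i \<noteq> t \<and> i \<noteq> r \<and> \<epsilon> i = 1} + 1 = p"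
      "card {i. i \<noteq> t \<and> i \<noteq> r \<and> \<epsilon> i = - 1} + 1 = q"
    using signs(2,3) assms(5,6) by simp_all
  have no_cover: "\<not> covering_projection (mtop (torus :: ('n \<Rightarrow> complex, real ^ 'n) manifold)) (mtop M) \<pi>" for \<pi>
  proof
    assume *: "covering_projection (mtop (torus :: ('n \<Rightarrow> complex, real ^ 'n) manifold)) (mtop M) \<pi>"
    then have "continuous_map (mtop (torus :: ('n \<Rightarrow> complex, real ^ 'n) manifold)) qtop \<pi>"
      by (simp add: covering_projection_def mtop)
    then show False
      using no_open_map_from_torus[OF a] covering_projection_imp_open_map[OF *] mtop by simp
  qed
  have no_homeo: "\<not> mtop M homeomorphic_space mtop (torus :: ('n \<Rightarrow> complex, real ^ 'n) manifold)"
  proof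
    assume "mtop M homeomorphic_space mtop (torus :: ('n \<Rightarrow> complex, real ^ 'n) manifold)"
    then obtain f where "homeomorphic_map (mtop (torus :: ('n \<Rightarrow> complex, real ^ 'n) manifold)) qtop f"
      using homeomorphic_space homeomorphic_space_sym mtop by metis
    then show False
      using no_open_map_from_torus[OF a] homeomorphic_imp_continuous_map homeomorphic_imp_open_map by blast
  qed
  show ?thesis
    using smooth_manifold_M compact_qtop pseudo_riemannian_G[OF signature]
      essentially_conformally_symmetric_G ricci_recurrent_G torus_bundle_M no_cover no_homeo
    by (intro exI[of _ M] exI[of _ "\<lambda>_. G"]) (simp add: mtop)
qed

end
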